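(* Let $\Phi$ be a stationary Gaussian noise that satisfies the noise conditions (i), (ii) and (iii) of the context, and let $\psi$ be a regular analytic wavelet. For any $0<a<b<\infty$ and any bounded and continuous function $w:[a,b]\to[0,\infty)$, define either $$M_{[a,b]}=\max_{s\in[a,b]}w(s)\left|W_\Phi(0,s)\right|,\qquad\sigma_{[a,b]}=\max_{s\in[a,b]}w(s)\left(\int_0^\infty|\widehat\psi(s\lambda)|^2p(\lambda)\,d\lambda\right)^{1/2},$$ or $$M_{[a,b]}=\max_{s\in[a,b]}w(s)\left|\frac{\partial W_\Phi}{\partial s}(0,s)\right|,\qquad\sigma_{[a,b]}=\max_{s\in[a,b]}w(s)\left(\int_0^\infty|\lambda[D\widehat\psi](s\lambda)|^2p(\lambda)\,d\lambda\right)^{1/2}.$$ In both cases $\mathbb{E}[M_{[a,b]}]<\infty$, and for any $u\ge\mathbb{E}[M_{[a,b]}]$, $$\mathbb{P}\left(M_{[a,b]}\ge u\right)\le\exp\left(-\frac{(u-\mathbb{E}[M_{[a,b]}])^2}{\sigma_{[a,b]}^2}\right).$$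
   Context: **Noise conditions.** (i) $\Phi=\{\Phi(t)\}_{t\in\mathbb{R}}$ is a real-valued, mean-square continuous, stationary Gaussian process whose covariance has a spectral density $p:\mathbb{R}\to(0,\infty)$, i.e. $\mathrm{Cov}(\Phi(t),\Phi(0))=\int_{\mathbb{R}}e^{it\lambda}p(\lambda)\,d\lambda$. (ii) There are $\gamma\in(0,2)$ and $C_1>0$ with $p(\lambda)\le C_1|\lambda|^{-(1+\gamma)}$ for all $\lambda\ne0$. (iii) One of the following holds: (long-range dependence) $p(\lambda)=L(|\lambda|^{-1})|\lambda|^{H-1}$ with $H\in(0,1)$ and $L:(0,\infty)\to(0,\infty)$ locally bounded and slowly varying at infinity, i.e. $L(cr)/L(r)\to1$ as $r\to\infty$ for every $c>0$; or (short-range dependence) $p$ is bounded and continuous at the origin. **Regular analytic wavelet.** $\psi\in L^1(\mathbb{R})\cap L^2(\mathbb{R})$ (complex-valued, nonzero), with Fourier transform $\widehat\psi(\omega)=\int_{\mathbb{R}}e^{-it\omega}\psi(t)\,dt$ satisfying $\widehat\psi(\omega)=0$ for $\omega\le0$ (analyticity); $\widehat\psi$ is three times differentiable on $(0,\infty)$ with $\sup_{\lambda>0}|\lambda^{q}\widehat\psi(\lambda)|<\infty$ for $q=1,2$; $\sup_{\lambda>0}|\lambda^{q}D\widehat\psi(\lambda)|<\infty$ for $q=0,1,2$; $\sup_{\lambda>0}|\lambda^{q}D^2\widehat\psi(\lambda)|<\infty$ for $q=2,3$; $\sup_{\lambda>0}|\lambda^{3}D^3\widehat\psi(\lambda)|<\infty$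 ($D^k$ is the $k$th derivative, $D=D^1$); and $|\widehat\psi|$ is unimodal. **Analytic wavelet transform.** $W_\Phi(t,s)=\int_{\mathbb{R}}\Phi(\tau)\frac1s\overline{\psi\left(\frac{\tau-t}{s}\right)}d\tau=\int_0^\infty e^{it\lambda}\overline{\widehat\psi(s\lambda)}\sqrt{p(\lambda)}\,Z(d\lambda)$ for $t\in\mathbb{R}$, $s>0$, where $Z$ is an orthogonally scattered complex Gaussian random measure on $\mathbb{R}$ with $Z(\Delta)=\overline{Z(-\Delta)}$, $\mathbb{E}[Z(\Delta)]=0$, $\mathbb{E}[Z(\Delta_1)\overline{Z(\Delta_2)}]=\mathrm{Leb}(\Delta_1\cap\Delta_2)$. The version of $W_\Phi$ with $C^2$ sample paths on $\mathbb{R}\times(0,\infty)$ is used. *)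

theory Defs
  imports "HOL-Probability.Probability"
begin

text \<open>Constants count as (degenerate) normal variables.\<close>

definition normal_rv :: "'a measure \<Rightarrow> ('a \<Rightarrow> real) \<Rightarrow> bool" where
  "normal_rv M X \<longleftrightarrow> X \<in> borel_measurable M \<and>
     ((\<exists>\<mu> \<sigma>. \<sigma> > 0 \<and> distributed M lborel X (normal_density \<mu> \<sigma>)) \<or>
      (\<exists>\<mu>. AE \<omega> in M. X \<omega> = \<mu>))"

definition gaussian_process :: "'a measure \<Rightarrow> (real \<Rightarrow> 'a \<Rightarrow> real) \<Rightarrow> bool" where
  "gaussian_process M \<Phi> \<longleftrightarrow>
     (\<forall>I c. finite I \<longrightarrow> normal_rv M (\<lambda>\<omega>. \<Sum>t\<in>I. c t * \<Phi> t \<omega>))"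

definition stationary :: "'a measure \<Rightarrow> (real \<Rightarrow> 'a \<Rightarrow> real) \<Rightarrow> bool" where
  "stationary M \<Phi> \<longleftrightarrow>
     (\<forall>I h. finite I \<longrightarrow>
        distr M (\<Pi>\<^sub>M t\<in>I. borel) (\<lambda>\<omega>. \<lambda>t\<in>I. \<Phi> (t + h) \<omega>) =
        distr M (\<Pi>\<^sub>M t\<in>I. borel) (\<lambda>\<omega>. \<lambda>t\<in>I. \<Phi> t \<omega>))"

definition mean_square_continuous :: "'a measure \<Rightarrow> (real \<Rightarrow> 'a \<Rightarrow> real) \<Rightarrow> bool" where
  "mean_square_continuous M \<Phi> \<longleftrightarrow>
     (\<forall>t. ((\<lambda>u. \<integral>\<omega>. (\<Phi> u \<omega> - \<Phi> t \<omega>)\<^sup>2 \<partial>M) \<longlongrightarrow> 0) (at t))"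

definition cov :: "'a measure \<Rightarrow> ('a \<Rightarrow> real) \<Rightarrow> ('a \<Rightarrow> real) \<Rightarrow> real" where
  "cov M X Y =
     (\<integral>\<omega>. (X \<omega> - (\<integral>\<xi>. X \<xi> \<partial>M)) * (Y \<omega> - (\<integral>\<xi>. Y \<xi> \<partial>M)) \<partial>M)"

definition has_spectral_density ::
  "'a measure \<Rightarrow> (real \<Rightarrow> 'a \<Rightarrow> real) \<Rightarrow> (real \<Rightarrow> real) \<Rightarrow> bool" where
  "has_spectral_density M \<Phi> p \<longleftrightarrow>
     (\<forall>l. p l > 0) \<and> integrable lborel p \<and>
     (\<forall>t. complex_of_real (cov M (\<Phi> t) (\<Phi> 0)) = (LINT l|lborel. iexp (t * l) * of_real (p l)))"

definition stationary_gaussian_noise ::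
  "'a measure \<Rightarrow> (real \<Rightarrow> 'a \<Rightarrow> real) \<Rightarrow> (real \<Rightarrow> real) \<Rightarrow> bool" where
  "stationary_gaussian_noise M \<Phi> p \<longleftrightarrow>
     gaussian_process M \<Phi> \<and> stationary M \<Phi> \<and> mean_square_continuous M \<Phi> \<and>
     has_spectral_density M \<Phi> p"

definition spectral_decay :: "(real \<Rightarrow> real) \<Rightarrow> bool" where
  "spectral_decay p \<longleftrightarrow>
     (\<exists>\<gamma> C. 0 < \<gamma> \<and> \<gamma> < 2 \<and> 0 < C \<and> (\<forall>l. l \<noteq> 0 \<longrightarrow> p l \<le> C * \<bar>l\<bar> powr (- (1 + \<gamma>))))"

definition slowly_varying :: "(real \<Rightarrow> real) \<Rightarrow> bool" where
  "slowly_varying L \<longleftrightarrow> (\<forall>c>0. ((\<lambda>r. L (c * r) / L r) \<longlongrightarrow> 1) at_top)"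

definition locally_bounded_pos :: "(real \<Rightarrow> real) \<Rightarrow> bool" where
  "locally_bounded_pos L \<longleftrightarrow> (\<forall>K. compact K \<and> K \<subseteq> {0<..} \<longrightarrow> bounded (L ` K))"

text \<open>A function on \<open>(0,\<infinity>)\<close> is a total function of which only the values at positive
  arguments matter. The formula for \<open>p\<close> is meaningless at the origin, so it is imposed
  away from the origin only.\<close>

definition long_range_dependent :: "(real \<Rightarrow> real) \<Rightarrow> bool" where
  "long_range_dependent p \<longleftrightarrow>
     (\<exists>H L. 0 < H \<and> H < 1 \<and> (\<forall>r>0. L r > 0) \<and> locally_bounded_pos L \<and> slowly_varying L \<and>
        (\<forall>l. l \<noteq> 0 \<longrightarrow> p l = L (inverse \<bar>l\<bar>) * \<bar>l\<bar> powr (H - 1)))"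

definition short_range_dependent :: "(real \<Rightarrow> real) \<Rightarrow> bool" where
  "short_range_dependent p \<longleftrightarrow> bounded (range p) \<and> isCont p 0"

definition fourier :: "(real \<Rightarrow> complex) \<Rightarrow> real \<Rightarrow> complex" where
  "fourier \<psi> \<omega> = (LINT t|lborel. iexp (- (t * \<omega>)) * \<psi> t)"

definition D :: "nat \<Rightarrow> (real \<Rightarrow> complex) \<Rightarrow> real \<Rightarrow> complex" where
  "D k f = ((\<lambda>g x. vector_derivative g (at x)) ^^ k) f"

definition bounded_weighted :: "nat \<Rightarrow> (real \<Rightarrow> complex) \<Rightarrow> bool" where
  "bounded_weighted q f \<longleftrightarrow> bdd_above ((\<lambda>l. cmod (of_real (l ^ q) * f l)) ` {0<..})"

definition unimodal :: "(real \<Rightarrow> real) \<Rightarrow> bool" where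
  "unimodal f \<longleftrightarrow> (\<exists>m. mono_on {..m} f \<and> antimono_on {m..} f)"

definition regular_analytic_wavelet :: "(real \<Rightarrow> complex) \<Rightarrow> bool" where
  "regular_analytic_wavelet \<psi> \<longleftrightarrow>
     integrable lborel \<psi> \<and> integrable lborel (\<lambda>t. (cmod (\<psi> t))\<^sup>2) \<and>
     \<not> (AE t in lborel. \<psi> t = 0) \<and>
     (\<forall>\<omega>\<le>0. fourier \<psi> \<omega> = 0) \<and>
     (\<forall>k<3. \<forall>l>0. D k (fourier \<psi>) differentiable (at l)) \<and>
     (\<forall>q\<in>{1, 2}. bounded_weighted q (fourier \<psi>)) \<and>
     (\<forall>q\<in>{0, 1, 2}. bounded_weighted q (D 1 (fourier \<psi>))) \<and>
     (\<forall>q\<in>{2, 3}. bounded_weighted q (D 2 (fourier \<psi>))) \<and>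
     bounded_weighted 3 (D 3 (fourier \<psi>)) \<and>
     unimodal (\<lambda>\<omega>. cmod (fourier \<psi> \<omega>))"

definition wavelet_integral ::
  "(real \<Rightarrow> complex) \<Rightarrow> (real \<Rightarrow> real) \<Rightarrow> real \<Rightarrow> real \<Rightarrow> complex" where
  "wavelet_integral \<psi> \<phi> t s =
     (LINT \<tau>|lborel. of_real (\<phi> \<tau>) * (of_real (1 / s) * cnj (\<psi> ((\<tau> - t) / s))))"

definition measurable_modification ::
  "'a measure \<Rightarrow> (real \<Rightarrow> 'a \<Rightarrow> real) \<Rightarrow> (real \<Rightarrow> 'a \<Rightarrow> real) \<Rightarrow> bool" where
  "measurable_modification M \<Phi> \<Phi>' \<longleftrightarrow>
     (\<lambda>(t, \<omega>). \<Phi>' t \<omega>) \<in> borel_measurable (borel \<Otimes>\<^sub>M M) \<and>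
     (\<forall>t. AE \<omega> in M. \<Phi>' t \<omega> = \<Phi> t \<omega>)"

text \<open>The sample paths of \<open>\<Phi>\<close> itself need not be measurable, so the pathwise integral that
  defines the transform is taken along a jointly measurable modification. A mean-square
  continuous process always has one, and by Fubini two of them give almost surely
  the same (absolutely convergent) integral.\<close>

definition wavelet_transform_version ::
  "'a measure \<Rightarrow> (real \<Rightarrow> complex) \<Rightarrow> (real \<Rightarrow> 'a \<Rightarrow> real) \<Rightarrow> (real \<Rightarrow> real \<Rightarrow> 'a \<Rightarrow> complex) \<Rightarrow> bool" where
  "wavelet_transform_version M \<psi> \<Phi> W \<longleftrightarrow>
     (\<forall>t. \<forall>s>0. W t s \<in> borel_measurable M) \<and>
     (\<exists>\<Phi>'. measurable_modification M \<Phi> \<Phi>' \<and>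
        (\<forall>t. \<forall>s>0. AE \<omega> in M. W t s \<omega> = wavelet_integral \<psi> (\<lambda>\<tau>. \<Phi>' \<tau> \<omega>) t s))"

text \<open>\<open>k\<close>-fold continuous (real) differentiability on an open set \<open>U\<close>; \<open>f1\<close> and \<open>f2\<close> are the
  two partial derivatives.\<close>

fun Ck_on :: "nat \<Rightarrow> (real \<times> real) set \<Rightarrow> (real \<times> real \<Rightarrow> complex) \<Rightarrow> bool" where
  "Ck_on 0 U f \<longleftrightarrow> continuous_on U f"
| "Ck_on (Suc k) U f \<longleftrightarrow>
     (\<exists>f1 f2. (\<forall>x\<in>U. (f has_derivative (\<lambda>h. fst h *\<^sub>R f1 x + snd h *\<^sub>R f2 x)) (at x)) \<and>
        Ck_on k U f1 \<and> Ck_on k U f2)"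

definition C2_paths :: "'a measure \<Rightarrow> (real \<Rightarrow> real \<Rightarrow> 'a \<Rightarrow> complex) \<Rightarrow> bool" where
  "C2_paths M W \<longleftrightarrow> (\<forall>\<omega>\<in>space M. Ck_on 2 (UNIV \<times> {0<..}) (\<lambda>(t, s). W t s \<omega>))"

definition deriv_scale ::
  "(real \<Rightarrow> real \<Rightarrow> 'a \<Rightarrow> complex) \<Rightarrow> real \<Rightarrow> real \<Rightarrow> 'a \<Rightarrow> complex" where
  "deriv_scale W t s \<omega> = vector_derivative (\<lambda>r. W t r \<omega>) (at s)"

text \<open>The maxima over \<open>[a,b]\<close> are written as suprema; they are attained whenever the maximised
  function is continuous. (The library's \<open>Max\<close> is for finite sets only.)\<close>

definition max_modulus ::
  "(real \<Rightarrow> real) \<Rightarrow> real \<Rightarrow> real \<Rightarrow> (real \<Rightarrow> real \<Rightarrow> 'a \<Rightarrow> complex) \<Rightarrow> 'a \<Rightarrow> real" where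
  "max_modulus w a b X \<omega> = (SUP s\<in>{a..b}. w s * cmod (X 0 s \<omega>))"

definition max_sd ::
  "(real \<Rightarrow> real) \<Rightarrow> real \<Rightarrow> real \<Rightarrow> (real \<Rightarrow> complex) \<Rightarrow> (real \<Rightarrow> real) \<Rightarrow> real" where
  "max_sd w a b \<psi> p =
     (SUP s\<in>{a..b}. w s * sqrt (LINT l:{0<..}|lborel. (cmod (fourier \<psi> (s * l)))\<^sup>2 * p l))"

definition max_sd_deriv ::
  "(real \<Rightarrow> real) \<Rightarrow> real \<Rightarrow> real \<Rightarrow> (real \<Rightarrow> complex) \<Rightarrow> (real \<Rightarrow> real) \<Rightarrow> real" where
  "max_sd_deriv w a b \<psi> p =
     (SUP s\<in>{a..b}. w s * sqrt (LINT l:{0<..}|lborel.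
        (cmod (of_real l * D 1 (fourier \<psi>) (s * l)))\<^sup>2 * p l))"

end

(*
  For fixed s, W(0,s) is the path integral of the noise against an integrable function g. Sampling
  points t with probability proportional to |g(t)| and averaging approximates this integral in mean
  square by finite linear combinations of the noise, so all real linear combinations of values of
  W(0,.), and of its scale derivative as a limit of difference quotients, are centred normal. As the
  wavelet has no negative frequencies, E W^2 = 0, so Re (u W) has variance (1/2) E |W|^2 for |u| = 1.
  The maximum of w |W| is the supremum of w(s) Re (u W(0,s)) over countably many (s,u), and
  the claim is the Borell-TIS inequality with the sharp constant. That inequality is
  obtained from its exponential form for maxima of finitely many variables, a consequence of
  the dual form of Talagrand's transport inequality for the standard Gaussian measure: if
  g(x) <= f(y) + |x - y|^2/2 for all x, y, then the integral of e^g is at most exp of the integral of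
  f. It tensorises, and in dimension one it follows from the monotone transport map.
*)
theory Submission
  imports Defs
begin

section \<open>The Gaussian transport inequality\<close>

text \<open>The paths of the noise carry no regularity and its mean is an unspecified constant. The
  law of the transform is therefore reached through characteristic functions of path integrals along
  a jointly measurable modification; the constant mean is annihilated because the Fourier transform
  of the wavelet vanishes at 0. The transport inequality enters with f = l F and g = l F - l^2 v /
  2, where F is a maximum of finitely many linear forms whose coefficient vectors have squared
  length at most v. Such an F is Lipschitz with constant sqrt v, and l sqrt v |x - y| <= l^2 v / 2 +
  |x - y|^2 / 2 is exactly the cost condition. The outcome E exp (l Z) <= exp (l E Z + l^2 v / 2)
  yields the tail exp (- (u - m)^2 / (2 v)), and v = \<sigma>^2 / 2 gives the stated
  exponent.\<close>

lemma normalised_cdf: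
  fixes u :: "real \<Rightarrow> real"
  assumes ab: "a < b" and cont: "continuous_on {a..b} u" and pos: "\<forall>x\<in>{a..b}. 0 < u x"
    and U: "U = (\<lambda>x. integral {a..x} u / integral {a..b} u)"
  shows "0 < integral {a..b} u" "U a = 0" "U b = 1" "continuous_on {a..b} U" "strict_mono_on {a..b} U"
    and "\<And>x. x \<in> {a<..<b} \<Longrightarrow> (U has_real_derivative (u x / integral {a..b} u)) (at x)"
proof -
  define c where "c = integral {a..b} u"
  have der: "((\<lambda>x. integral {a..x} u) has_real_derivative u x) (at x)" if "x \<in> {a<..<b}" for x
    using integral_has_real_derivative[OF cont, of x] that
      at_within_Icc_at[of a x b] by simp
  have cI: "continuous_on {a..b} (\<lambda>x. integral {a..x} u)"
    by (intro indefinite_integral_continuous_1 integrable_continuous_real cont)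
  have sm: "integral {a..x} u < integral {a..y} u" if xy: "x \<in> {a..b}" "y \<in> {a..b}" "x < y" for x y
  proof -
    have "continuous_on {x..y} (\<lambda>x. integral {a..x} u)"
      using cI xy by (auto intro: continuous_on_subset)
    moreover have "(\<lambda>x. integral {a..x} u) differentiable (at z)" if "x < z" "z < y" for z
      using der[of z] that xy by (auto simp: real_differentiable_def)
    ultimately have "\<exists>l z. x < z \<and> z < y \<and> ((\<lambda>x. integral {a..x} u) has_real_derivative l) (at z) \<and>
        integral {a..y} u - integral {a..x} u = (y - x) * l"
      by (rule MVT[OF xy(3)])
    then obtain l z where z: "x < z" "z < y" "((\<lambda>x. integral {a..x} u) has_real_derivative l) (at z)"
        "integral {a..y} u - integral {a..x} u = (y - x) * l"
      by blast
    have "l = u z" using DERIV_unique[OF z(3) der[of z]] z xy by auto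
    moreover have "0 < u z" using pos z xy by auto
    ultimately have "0 < (y - x) * l" using xy by simp
    with z show ?thesis by simp
  qed
  have c: "0 < c" using sm[of a b] ab by (simp add: c_def)
  then show "0 < integral {a..b} u" by (simp add: c_def)
  have U: "U = (\<lambda>x. integral {a..x} u / c)" by (simp add: U c_def)
  show "U a = 0" by (simp add: U)
  show "U b = 1" using c unfolding U by (simp flip: c_def)
  show "continuous_on {a..b} U" unfolding U using c by (intro continuous_on_divide cI continuous_on_const) auto
  show "strict_mono_on {a..b} U" unfolding U strict_mono_on_def
    by (intro allI impI divide_strict_right_mono sm c) auto
  show "(U has_real_derivative (u x / integral {a..b} u)) (at x)" if "x \<in> {a<..<b}" for x
    unfolding U c_def[symmetric] by (intro DERIV_cdivide der that)
qed

text \<open>T is the distribution function of u followed by the inverse of that of v, both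
  normalised, so it carries the probability density proportional to u to the one proportional to v;
  the derivative formula is the change of variables equation. Positivity of v keeps the derivative
  of its distribution function away from 0, so the inverse is differentiable in the
  interior.\<close>

lemma monotone_transport:
  fixes u v :: "real \<Rightarrow> real"
  assumes ab: "a < b"
    and u: "continuous_on {a..b} u" "\<forall>x\<in>{a..b}. 0 < u x"
    and v: "continuous_on {a..b} v" "\<forall>x\<in>{a..b}. 0 < v x"
  obtains T where "T a = a" "T b = b" "continuous_on {a..b} T" "\<And>x. x \<in> {a..b} \<Longrightarrow> T x \<in> {a..b}"
    "\<And>x. x \<in> {a<..<b} \<Longrightarrow>
      (T has_real_derivative (u x * integral {a..b} v) / (v (T x) * integral {a..b} u)) (at x)"
proof -
  define U where "U = (\<lambda>x. integral {a..x} u / integral {a..b} u)"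
  define V where "V = (\<lambda>x. integral {a..x} v / integral {a..b} v)"
  note Uf = normalised_cdf[OF ab u U_def]
  note Vf = normalised_cdf[OF ab v V_def]
  \<comment> \<open>The derivatives are known on the open intervals only, so the open interval has
    to be mapped into the open unit interval.\<close>
  have range01: "F x \<in> {0..1}" "x \<in> {a<..<b} \<Longrightarrow> F x \<in> {0<..<1}"
    if F: "F a = 0" "F b = 1" "strict_mono_on {a..b} F" and x: "x \<in> {a..b}" for F :: "real \<Rightarrow> real" and x
  proof -
    have 1: "F x \<in> {0<..<1}" if "x \<in> {a<..<b}"
    proof -
      have "F a < F x" "F x < F b" by (rule strict_mono_onD[OF F(3)]; use that in simp)+
      then show ?thesis using F by simp
    qed
    show "F x \<in> {0..1}" using 1 x F by (cases "x = a"; cases "x = b") force+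
    show "x \<in> {a<..<b} \<Longrightarrow> F x \<in> {0<..<1}" by (rule 1)
  qed
  note rangeU = range01[OF Uf(2,3,5)] and rangeV = range01(1)[OF Vf(2,3,5)]
  have injV: "inj_on V {a..b}" by (rule strict_mono_on_imp_inj_on[OF Vf(5)])
  have imV: "V ` {a..b} = {0..1}"
  proof
    show "V ` {a..b} \<subseteq> {0..1}" using rangeV by auto
    show "{0..1} \<subseteq> V ` {a..b}"
    proof
      fix y :: real assume "y \<in> {0..1}"
      then obtain x where "a \<le> x" "x \<le> b" "V x = y"
        using IVT'[of V a y b] Vf(2,3,4) ab by auto
      then show "y \<in> V ` {a..b}" by auto
    qed
  qed
  define S where "S = inv_into {a..b} V"
  have SV: "S (V x) = x" if "x \<in> {a..b}" for x using injV that by (simp add: S_def)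
  have VS: "V (S y) = y" "S y \<in> {a..b}" if "y \<in> {0..1}" for y
    using that imV by (simp_all only: S_def f_inv_into_f inv_into_into)
  have contS: "continuous_on {0..1} S"
    using continuous_on_inv[OF Vf(4) compact_Icc, of S] SV imV by auto
  have Sint: "S y \<in> {a<..<b}" if "y \<in> {0<..<1}" for y
    using VS[of y] that Vf(2,3) by (cases "S y = a"; cases "S y = b"; auto)
  have derS: "(S has_real_derivative inverse (v (S y) / integral {a..b} v)) (at y)" if y: "y \<in> {0<..<1}" for y
  proof (rule DERIV_inverse_function[where a=0 and b=1 and f=V])
    show "(V has_real_derivative v (S y) / integral {a..b} v) (at (S y))"
      using Vf(6) Sint[OF y] by auto
    show "v (S y) / integral {a..b} v \<noteq> 0"
      using bspec[OF v(2), of "S y"] Sint[OF y] Vf(1) by auto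
    show "0 < y" "y < 1" using y by auto
    show "V (S z) = z" if "0 < z" "z < 1" for z using VS that by auto
    show "isCont S y"
      using continuous_on_interior[OF contS, of y] y by auto
  qed
  show thesis
  proof (rule that[of "S \<circ> U"])
    show "(S \<circ> U) a = a" "(S \<circ> U) b = b" using SV[of a] SV[of b] Uf Vf ab by auto
    show "continuous_on {a..b} (S \<circ> U)"
      using Uf(4) rangeU(1) by (intro continuous_on_compose continuous_on_subset[OF contS]) auto
    show "(S \<circ> U) x \<in> {a..b}" if "x \<in> {a..b}" for x using VS rangeU that by auto
    show "((S \<circ> U) has_real_derivative
            (u x * integral {a..b} v) / (v ((S \<circ> U) x) * integral {a..b} u)) (at x)"
      if x: "x \<in> {a<..<b}" for x
    proof -
      have "((S \<circ> U) has_real_derivative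
          inverse (v (S (U x)) / integral {a..b} v) * (u x / integral {a..b} u)) (at x)"
        using derS[of "U x"] rangeU(2)[of x] x Uf(6)[OF x] by (intro DERIV_chain) auto
      then show ?thesis by (simp add: divide_simps mult.commute)
    qed
  qed
qed

lemma ln_std_normal_density:
  "ln (std_normal_density x) = ln (std_normal_density 0) - x\<^sup>2 / 2"
  by (simp add: std_normal_density_def ln_mult ln_div)

lemma continuous_on_std_normal_density [continuous_intros]: "continuous_on A std_normal_density"
  unfolding std_normal_density_def by (intro continuous_intros) auto

lemma has_real_derivative_std_normal_density [derivative_intros]:
  "(std_normal_density has_real_derivative (- x * std_normal_density x)) (at x)"
  unfolding std_normal_density_def by (auto intro!: derivative_eq_intros simp: field_simps)

(* Integrate ln T' <= T' - 1 for the monotone transport map T; the terms in T recombine to (T * phi)'. *)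
lemma gaussian_transport_interval:
  fixes f g :: "real \<Rightarrow> real" and n :: real
  assumes n: "0 < n" and g: "continuous_on {-n..n} g"
    and fg: "\<And>x y. g x \<le> f y + (x - y)\<^sup>2 / 2"
    and int: "(\<lambda>x. (x\<^sup>2 - 1 + f x) * std_normal_density x) integrable_on {-n..n}"
  defines "c \<equiv> integral {-n..n} std_normal_density"
    and "Z \<equiv> integral {-n..n} (\<lambda>x. exp (g x) * std_normal_density x)"
  shows "c * ln (Z / c) \<le> 2 * n * std_normal_density n +
           integral {-n..n} (\<lambda>x. (x\<^sup>2 - 1 + f x) * std_normal_density x)"
proof -
  let ?\<phi> = std_normal_density
  have u: "continuous_on {-n..n} ?\<phi>" "\<forall>x\<in>{-n..n}. 0 < ?\<phi> x"
    by (auto intro: continuous_on_std_normal_density simp: normal_density_pos)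
  have v: "continuous_on {-n..n} (\<lambda>x. exp (g x) * ?\<phi> x)" "\<forall>x\<in>{-n..n}. 0 < exp (g x) * ?\<phi> x"
    using g u(2) by (auto intro!: continuous_intros)
  have ab: "-n < n" using n by simp
  obtain T where T: "T (-n) = -n" "T n = n" "continuous_on {-n..n} T"
    and T_der: "\<And>x. x \<in> {-n<..<n} \<Longrightarrow> (T has_real_derivative (?\<phi> x * Z) / (exp (g (T x)) * ?\<phi> (T x) * c)) (at x)"
    using monotone_transport[OF ab u v, folded c_def Z_def] by metis
  define T' where "T' x = (?\<phi> x * Z) / (exp (g (T x)) * ?\<phi> (T x) * c)" for x
  have c: "0 < c" and Z: "0 < Z"
    using normalised_cdf(1)[OF ab u refl] normalised_cdf(1)[OF ab v refl] by (auto simp: c_def Z_def)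
  \<comment> \<open>The logarithm of the change of variables equation gives ln T'. The hypothesis
    \<open>fg\<close> is used at the pair (T x, x): its cost cancels the square of T x coming from
    the density and leaves x^2 and the cross term - x * T x.\<close>
  have pw: "?\<phi> x * ln (Z / c) \<le> (T' x * ?\<phi> x + T x * (- x * ?\<phi> x)) + (x\<^sup>2 - 1 + f x) * ?\<phi> x" for x
  proof -
    have T'pos: "0 < T' x" unfolding T'_def using c Z by (simp add: normal_density_pos)
    have "ln (T' x) = ln (Z / c) + (T x)\<^sup>2 / 2 - x\<^sup>2 / 2 - g (T x)"
      unfolding T'_def using c Z
      by (simp add: normal_density_pos less_imp_neq[OF normal_density_pos, symmetric] ln_div ln_mult ln_std_normal_density[of x] ln_std_normal_density[of "T x"])
    moreover have "ln (T' x) \<le> T' x - 1" using ln_le_minus_one T'pos by auto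
    moreover note fg[of "T x" x]
    ultimately have "ln (Z / c) \<le> T' x - 1 - (T x)\<^sup>2 / 2 + x\<^sup>2 / 2 + f x + (T x - x)\<^sup>2 / 2"
      by linarith
    also have "\<dots> = T' x - T x * x + (x\<^sup>2 - 1 + f x)"
      by (simp add: power2_eq_square field_simps)
    finally have "?\<phi> x * ln (Z / c) \<le> ?\<phi> x * (T' x - T x * x + (x\<^sup>2 - 1 + f x))"
      by (intro mult_left_mono) auto
    then show ?thesis by (simp add: algebra_simps)
  qed
  have "((\<lambda>x. T' x * ?\<phi> x + T x * (- x * ?\<phi> x)) has_integral T n * ?\<phi> n - T (-n) * ?\<phi> (-n)) {-n..n}"
  proof (rule fundamental_theorem_of_calculus_interior)
    show "- n \<le> n" using n by simp
    show "continuous_on {- n..n} (\<lambda>x. T x * ?\<phi> x)"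
      using T(3) by (intro continuous_intros)
    show "((\<lambda>x. T x * ?\<phi> x) has_vector_derivative T' x * ?\<phi> x + T x * (- x * ?\<phi> x)) (at x)"
      if "x \<in> {-n<..<n}" for x
      unfolding has_real_derivative_iff_has_vector_derivative[symmetric]
      using T_der[OF that] has_real_derivative_std_normal_density[of x]
      by (auto intro!: derivative_eq_intros simp: T'_def)
  qed
  from has_integral_add[OF this integrable_integral[OF int]]
  have 2: "((\<lambda>x. (T' x * ?\<phi> x + T x * (- x * ?\<phi> x)) + (x\<^sup>2 - 1 + f x) * ?\<phi> x) has_integral
      T n * ?\<phi> n - T (-n) * ?\<phi> (-n) + integral {-n..n} (\<lambda>x. (x\<^sup>2 - 1 + f x) * ?\<phi> x)) {-n..n}" .
  have 1: "((\<lambda>x. ?\<phi> x * ln (Z / c)) has_integral c * ln (Z / c)) {-n..n}"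
    unfolding c_def by (intro has_integral_mult_left integrable_integral integrable_continuous_real u)
  have "c * ln (Z / c) \<le> T n * ?\<phi> n - T (-n) * ?\<phi> (-n) + integral {-n..n} (\<lambda>x. (x\<^sup>2 - 1 + f x) * ?\<phi> x)"
    by (rule has_integral_le[OF 1 2 pw])
  \<comment> \<open>T fixes both end points and the density is even, so the two boundary terms add
    up; their sum vanishes as n grows.\<close>
  also have "T n * ?\<phi> n - T (-n) * ?\<phi> (-n) = 2 * n * ?\<phi> n"
    using T by (simp add: std_normal_density_def)
  finally show ?thesis .
qed

text \<open>The interval estimate lives in the gauge integral, where the fundamental theorem of
  calculus was applied; this carries it to the Lebesgue integral over the line.\<close>

lemma tendsto_integral_Icc_nat:
  fixes h :: "real \<Rightarrow> real"
  assumes h: "integrable lborel h"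
  shows "(\<lambda>n. integral {- real n..real n} h) \<longlonglongrightarrow> integral\<^sup>L lborel h"
proof -
  have "integral {- real n..real n} h = (\<integral>x. indicator {- real n..real n} x * h x \<partial>lborel)" for n
  proof -
    have "set_integrable lborel {- real n..real n} h"
      unfolding set_integrable_def using h by (intro integrable_mult_indicator) auto
    from set_borel_integral_eq_integral(2)[OF this] show ?thesis
      by (simp add: set_lebesgue_integral_def)
  qed
  moreover have "(\<lambda>n. \<integral>x. indicator {- real n..real n} x * h x \<partial>lborel) \<longlonglongrightarrow> integral\<^sup>L lborel h"
  proof (rule integral_dominated_convergence[where w = "\<lambda>x. \<bar>h x\<bar>"])
    show "AE x in lborel. (\<lambda>n. indicator {- real n..real n} x * h x) \<longlonglongrightarrow> h x"
    proof (intro AE_I2 tendsto_eventually)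
      fix x
      obtain N where "\<bar>x\<bar> \<le> real N" using real_arch_simple by blast
      then show "\<forall>\<^sub>F n in sequentially. indicator {- real n..real n} x * h x = h x"
        by (intro eventually_sequentiallyI[of N]) (auto simp: indicator_def)
    qed
  qed (use h in \<open>auto simp: indicator_def\<close>)
  ultimately show ?thesis by simp
qed

lemma integral_std_normal_distribution:
  fixes h :: "real \<Rightarrow> real"
  assumes "h \<in> borel_measurable borel"
  shows "integral\<^sup>L std_normal_distribution h = (\<integral>x. h x * std_normal_density x \<partial>lborel)"
  using assms by (simp add: integral_density mult.commute)

lemma integrable_times_std_normal_density:
  fixes h :: "real \<Rightarrow> real"
  assumes [measurable]: "h \<in> borel_measurable borel" and "\<And>x. \<bar>h x\<bar> \<le> B"
  shows "integrable lborel (\<lambda>x. h x * std_normal_density x)"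
proof (rule Bochner_Integration.integrable_bound)
  show "integrable lborel (\<lambda>x. B * std_normal_density x)" by simp
  show "AE x in lborel. norm (h x * std_normal_density x) \<le> norm (B * std_normal_density x)"
  proof (rule AE_I2)
    fix x
    have "\<bar>h x\<bar> * std_normal_density x \<le> B * std_normal_density x"
      by (intro mult_right_mono assms normal_density_nonneg)
    also have "\<dots> \<le> \<bar>B\<bar> * std_normal_density x"
      by (intro mult_right_mono normal_density_nonneg) simp
    finally show "norm (h x * std_normal_density x) \<le> norm (B * std_normal_density x)"
      by (simp add: abs_mult)
  qed
qed simp

text \<open>The interval estimate is exhausted over [-n, n]: the mass \<open>c\<close> tends to 1,
  the boundary term tends to 0, and x^2 - 1 has Gaussian integral 0, so that only the integral of f
  survives on the right.\<close>

lemma gaussian_transport_continuous: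
  fixes f g :: "real \<Rightarrow> real"
  assumes f[measurable]: "f \<in> borel_measurable borel" and fB: "\<And>x. \<bar>f x\<bar> \<le> B"
    and g: "continuous_on UNIV g" and gB: "\<And>x. \<bar>g x\<bar> \<le> B'"
    and fg: "\<And>x y. g x \<le> f y + (x - y)\<^sup>2 / 2"
  shows "ln (\<integral>x. exp (g x) \<partial>std_normal_distribution) \<le> (\<integral>x. f x \<partial>std_normal_distribution)"
proof -
  let ?\<phi> = std_normal_density
  let ?h = "\<lambda>x. (x\<^sup>2 - 1 + f x) * ?\<phi> x"
  have [measurable]: "g \<in> borel_measurable borel" using g by (rule borel_measurable_continuous_onI)
  have eB: "\<bar>exp (g x)\<bar> \<le> exp B'" for x using gB[of x] by simp
  have gB': "- B' \<le> g x" for x using gB[of x] by linarith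
  have i_phi: "integrable lborel ?\<phi>" by simp
  have i_g: "integrable lborel (\<lambda>x. exp (g x) * ?\<phi> x)"
    using eB by (intro integrable_times_std_normal_density) auto
  have i_f: "integrable lborel (\<lambda>x. f x * ?\<phi> x)"
    using fB by (intro integrable_times_std_normal_density) auto
  have i_2: "integrable lborel (\<lambda>x. ?\<phi> x * x^2)" by (rule integrable_std_normal_moment)
  have "(\<integral>x. (?\<phi> x * x^2 - ?\<phi> x) + f x * ?\<phi> x \<partial>lborel) = 1 - 1 + (\<integral>x. f x * ?\<phi> x \<partial>lborel)"
    using i_f i_2 i_phi integral_std_normal_moment_even[of 1] by (simp add: fact_numeral)
  moreover have h_eq: "?h = (\<lambda>x. (?\<phi> x * x^2 - ?\<phi> x) + f x * ?\<phi> x)"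
    by (simp add: fun_eq_iff algebra_simps)
  ultimately have h_int: "integral\<^sup>L lborel ?h = (\<integral>x. f x \<partial>std_normal_distribution)"
    by (simp add: integral_std_normal_distribution)
  have i_h: "integrable lborel ?h" unfolding h_eq using i_f i_2 i_phi by simp
  define c where "c n = integral {- real n..real n} ?\<phi>" for n
  define Z where "Z n = integral {- real n..real n} (\<lambda>x. exp (g x) * ?\<phi> x)" for n
  define I where "I n = integral {- real n..real n} ?h" for n
  let ?Z = "\<integral>x. exp (g x) \<partial>std_normal_distribution"
  have c_lim: "c \<longlonglongrightarrow> 1"
    using tendsto_integral_Icc_nat[OF i_phi] by (simp add: c_def[abs_def])
  have Z_lim: "Z \<longlonglongrightarrow> ?Z"
    using tendsto_integral_Icc_nat[OF i_g] by (simp add: Z_def[abs_def] integral_std_normal_distribution)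
  have I_lim: "I \<longlonglongrightarrow> (\<integral>x. f x \<partial>std_normal_distribution)"
    using tendsto_integral_Icc_nat[OF i_h] by (simp add: I_def[abs_def] h_int)
  have Zpos: "0 < ?Z"
  proof -
    have "exp (- B') = (\<integral>x. exp (- B') * ?\<phi> x \<partial>lborel)" by simp
    also have "\<dots> \<le> (\<integral>x. exp (g x) * ?\<phi> x \<partial>lborel)"
      by (rule integral_mono[OF _ i_g]) (auto intro!: mult_right_mono gB')
    finally have "0 < (\<integral>x. exp (g x) * ?\<phi> x \<partial>lborel)" by (rule less_le_trans[rotated]) simp
    then show ?thesis by (simp add: integral_std_normal_distribution)
  qed
  have "(\<lambda>n. c n * ln (Z n / c n)) \<longlonglongrightarrow> 1 * ln (?Z / 1)"
    using Zpos by (intro tendsto_intros c_lim Z_lim) auto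
  moreover have "(\<lambda>n. 2 * real n * ?\<phi> (real n) + I n) \<longlonglongrightarrow> 0 + (\<integral>x. f x \<partial>std_normal_distribution)"
  proof (intro tendsto_add I_lim)
    show "(\<lambda>n. 2 * real n * ?\<phi> (real n)) \<longlonglongrightarrow> 0"
      unfolding std_normal_density_def by real_asymp
  qed
  moreover have "c n * ln (Z n / c n) \<le> 2 * real n * ?\<phi> (real n) + I n" if "n \<ge> 1" for n
    unfolding c_def Z_def I_def
  proof (rule gaussian_transport_interval)
    show "?h integrable_on {- real n..real n}"
    proof (rule set_borel_integral_eq_integral(1))
      show "set_integrable lborel {- real n..real n} ?h"
        unfolding set_integrable_def using i_h by (intro integrable_mult_indicator) auto
    qed
  qed (use that g fg in \<open>auto intro: continuous_on_subset\<close>)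
  ultimately have "1 * ln (?Z / 1) \<le> 0 + (\<integral>x. f x \<partial>std_normal_distribution)"
    by (intro LIMSEQ_le[where X = "\<lambda>n. c n * ln (Z n / c n)"]) auto
  then show ?thesis by simp
qed

text \<open>Continuity of g is removed here because the induction on the dimension feeds in sections
  of functions that are known only to be measurable. The remedy is to replace g by the largest
  function compatible with f.\<close>

lemma gaussian_transport_1:
  fixes f g :: "real \<Rightarrow> real"
  assumes f[measurable]: "f \<in> borel_measurable borel" and fB: "\<And>x. \<bar>f x\<bar> \<le> B"
    and g[measurable]: "g \<in> borel_measurable borel" and gB: "\<And>x. \<bar>g x\<bar> \<le> B"
    and fg: "\<And>x y. g x \<le> f y + (x - y)\<^sup>2 / 2"
  shows "ln (\<integral>x. exp (g x) \<partial>std_normal_distribution) \<le> (\<integral>x. f x \<partial>std_normal_distribution)"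
proof -
  (* q is the infimal convolution of f with the quadratic cost: it dominates g, and it is continuous
     because x^2/2 - q x is convex. *)
  define h where "h x = (SUP y. x * y - y\<^sup>2 / 2 - f y)" for x
  define q where "q x = x\<^sup>2 / 2 - h x" for x
  have bdd: "x * y - y\<^sup>2 / 2 - f y \<le> x\<^sup>2 / 2 + B" for x y
    using fB[of y] zero_le_power2[of "x - y"] unfolding power2_diff by (simp add: abs_le_iff)
  have bddA: "bdd_above (range (\<lambda>y. x * y - y\<^sup>2 / 2 - f y))" for x
    using bdd by (auto intro!: bdd_aboveI)
  have h_upper: "x * y - y\<^sup>2 / 2 - f y \<le> h x" for x y
    unfolding h_def by (rule cSUP_upper[OF _ bddA]) simp
  have h_le: "h x \<le> c" if "\<And>y. x * y - y\<^sup>2 / 2 - f y \<le> c" for x c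
    unfolding h_def using that by (intro cSUP_least) auto
  have q_fg: "q x \<le> f y + (x - y)\<^sup>2 / 2" for x y
    using h_upper[of x y] unfolding q_def by (simp add: power2_diff field_simps)
  have gq: "g x \<le> q x" for x
  proof -
    have "h x \<le> x\<^sup>2 / 2 - g x"
    proof (rule h_le)
      fix y show "x * y - y\<^sup>2 / 2 - f y \<le> x\<^sup>2 / 2 - g x"
        using fg[of x y] by (simp add: power2_diff field_simps)
    qed
    then show ?thesis by (simp add: q_def)
  qed
  have qB: "\<bar>q x\<bar> \<le> B" for x
  proof -
    have "q x \<le> B" using q_fg[of x x] fB[of x] by auto
    moreover have "- B \<le> q x" using h_le[OF bdd, of x] by (simp add: q_def)
    ultimately show ?thesis by auto
  qed
  \<comment> \<open>\<open>h\<close> is the Legendre transform of y^2 / 2 + f y, a supremum of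
    functions affine in x. Boundedness of f makes it finite, and a finite convex function on the
    line is continuous.\<close>
  have "convex_on UNIV h"
  proof (rule convex_onI)
    fix t x y :: real assume t: "0 < t" "t < 1"
    show "h ((1 - t) *\<^sub>R x + t *\<^sub>R y) \<le> (1 - t) * h x + t * h y"
    proof (rule h_le)
      fix z
      have "((1 - t) *\<^sub>R x + t *\<^sub>R y) * z - z\<^sup>2 / 2 - f z
          = (1 - t) * (x * z - z\<^sup>2 / 2 - f z) + t * (y * z - z\<^sup>2 / 2 - f z)"
        by (simp add: field_simps)
      also have "\<dots> \<le> (1 - t) * h x + t * h y"
        using t by (intro add_mono mult_left_mono h_upper) auto
      finally show "((1 - t) *\<^sub>R x + t *\<^sub>R y) * z - z\<^sup>2 / 2 - f z \<le> (1 - t) * h x + t * h y" .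
    qed
  qed simp
  then have "continuous_on UNIV h" by (rule convex_on_continuous[OF open_UNIV])
  then have q_cont: "continuous_on UNIV q" unfolding q_def by (intro continuous_intros) auto
  then have [measurable]: "q \<in> borel_measurable borel" by (rule borel_measurable_continuous_onI)
  have i: "integrable lborel (\<lambda>x. exp (u x) * std_normal_density x)"
    if "\<And>x. \<bar>u x\<bar> \<le> B" and [measurable]: "u \<in> borel_measurable borel" for u :: "real \<Rightarrow> real"
  proof (rule integrable_times_std_normal_density)
    show "\<bar>exp (u x)\<bar> \<le> exp B" for x using that(1)[of x] by simp
  qed simp
  have ig: "integrable lborel (\<lambda>x. exp (g x) * std_normal_density x)" by (rule i[OF gB g])
  have iq: "integrable lborel (\<lambda>x. exp (q x) * std_normal_density x)" by (rule i[OF qB]) simp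
  have gB': "- B \<le> g x" for x using gB[of x] by linarith
  have "(\<integral>x. exp (- B) * std_normal_density x \<partial>lborel) \<le> (\<integral>x. exp (g x) * std_normal_density x \<partial>lborel)"
    by (rule integral_mono[OF _ ig]) (auto intro!: mult_right_mono gB')
  then have "0 < (\<integral>x. exp (g x) * std_normal_density x \<partial>lborel)"
    by (rule less_le_trans[rotated]) simp
  moreover have "(\<integral>x. exp (g x) * std_normal_density x \<partial>lborel) \<le> (\<integral>x. exp (q x) * std_normal_density x \<partial>lborel)"
    by (rule integral_mono[OF ig iq]) (auto intro!: mult_right_mono gq)
  ultimately have "ln (\<integral>x. exp (g x) \<partial>std_normal_distribution) \<le> ln (\<integral>x. exp (q x) \<partial>std_normal_distribution)"
    by (simp add: integral_std_normal_distribution)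
  also have "\<dots> \<le> (\<integral>x. f x \<partial>std_normal_distribution)"
    by (rule gaussian_transport_continuous[OF f fB q_cont qB q_fg])
  finally show ?thesis .
qed

text \<open>Induction on the dimension. For fixed x and y the one-dimensional inequality in the last
  coordinate shows that \<open>F\<close> and \<open>ln E\<close>, the partial averages of f and of
  the exponential of g, again satisfy the hypothesis with the cost of the first k coordinates.
  Averages over a probability measure keep the bound \<open>B\<close>, and Fubini recombines the
  integrals.\<close>

lemma gaussian_transport:
  fixes f g :: "(nat \<Rightarrow> real) \<Rightarrow> real"
  defines "\<gamma> \<equiv> \<lambda>k. \<Pi>\<^sub>M i\<in>{..<k}. std_normal_distribution"
  assumes "f \<in> borel_measurable (\<gamma> k)" "\<And>x. x \<in> space (\<gamma> k) \<Longrightarrow> \<bar>f x\<bar> \<le> B"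
    and "g \<in> borel_measurable (\<gamma> k)" "\<And>x. x \<in> space (\<gamma> k) \<Longrightarrow> \<bar>g x\<bar> \<le> B"
    and "\<And>x y. x \<in> space (\<gamma> k) \<Longrightarrow> y \<in> space (\<gamma> k) \<Longrightarrow> g x \<le> f y + (\<Sum>i<k. (x i - y i)\<^sup>2) / 2"
  shows "ln (\<integral>x. exp (g x) \<partial>\<gamma> k) \<le> (\<integral>x. f x \<partial>\<gamma> k)"
  using assms(2-)
proof (induction k arbitrary: f g)
  case 0
  have "\<gamma> 0 = count_space {\<lambda>_. undefined}" by (simp add: \<gamma>_def PiM_empty)
  then show ?case
    using "0.prems"(5)[of "\<lambda>_. undefined" "\<lambda>_. undefined"] by (simp add: lebesgue_integral_count_space_finite)
next
  case (Suc k)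
  let ?N = std_normal_distribution
  interpret N: prob_space ?N by (rule prob_space_normal_density) simp
  interpret product_sigma_finite "\<lambda>_::nat. ?N" by standard
  interpret P: prob_space "\<gamma> k" unfolding \<gamma>_def by (intro prob_space_PiM N.prob_space_axioms)
  interpret PS: prob_space "\<gamma> (Suc k)" unfolding \<gamma>_def by (intro prob_space_PiM N.prob_space_axioms)
  note [measurable] = Suc.prems(1,3)
  have Suc_eq: "\<gamma> (Suc k) = Pi\<^sub>M (insert k {..<k}) (\<lambda>_. ?N)" by (simp add: \<gamma>_def lessThan_Suc)
  have upd[measurable]: "(\<lambda>(x, s). x(k := s)) \<in> \<gamma> k \<Otimes>\<^sub>M ?N \<rightarrow>\<^sub>M \<gamma> (Suc k)"
    unfolding Suc_eq unfolding \<gamma>_def by (rule measurable_add_dim)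
  have upd1: "(\<lambda>s. x(k := s)) \<in> ?N \<rightarrow>\<^sub>M \<gamma> (Suc k)" if "x \<in> space (\<gamma> k)" for x
    using measurable_compose[OF measurable_Pair1'[OF that] upd] by simp
  have upd_in: "x(k := s) \<in> space (\<gamma> (Suc k))" if "x \<in> space (\<gamma> k)" for x s
    using measurable_space[OF upd1[OF that], of s] by simp
  have int1: "integrable ?N (\<lambda>s. u (x(k := s)))"
    if "u \<in> borel_measurable (\<gamma> (Suc k))" "\<And>x. x \<in> space (\<gamma> (Suc k)) \<Longrightarrow> \<bar>u x\<bar> \<le> C" "x \<in> space (\<gamma> k)"
    for u and x and C :: real
    using measurable_compose[OF upd1[OF that(3)] that(1)] that(2)[OF upd_in[OF that(3)]]
    by (intro N.integrable_const_bound[of _ C]) auto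
  have split: "(\<integral>x. u x \<partial>\<gamma> (Suc k)) = (\<integral>x. (\<integral>s. u (x(k := s)) \<partial>?N) \<partial>\<gamma> k)"
    if "u \<in> borel_measurable (\<gamma> (Suc k))" "\<And>x. x \<in> space (\<gamma> (Suc k)) \<Longrightarrow> \<bar>u x\<bar> \<le> C" for u and C :: real
  proof -
    have "integrable (\<gamma> (Suc k)) u" using that by (intro PS.integrable_const_bound[of _ C]) auto
    then show ?thesis unfolding Suc_eq unfolding \<gamma>_def by (intro product_integral_insert) auto
  qed
  have gexp: "\<bar>exp (g x)\<bar> \<le> exp B" "exp (- B) \<le> exp (g x)" if "x \<in> space (\<gamma> (Suc k))" for x
    using Suc.prems(4)[OF that] by auto
  have mexp: "(\<lambda>x. exp (g x)) \<in> borel_measurable (\<gamma> (Suc k))" by simp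
  have fB: "\<bar>f (x(k := s))\<bar> \<le> B" and gB: "\<bar>g (x(k := s))\<bar> \<le> B"
    if "x \<in> space (\<gamma> k)" for x s
    by (rule Suc.prems(2) Suc.prems(4), rule upd_in[OF that])+
  have fg: "g (x(k := s)) \<le> f (y(k := t)) + ((\<Sum>i<k. (x i - y i)\<^sup>2) + (s - t)\<^sup>2) / 2"
    if "x \<in> space (\<gamma> k)" "y \<in> space (\<gamma> k)" for x y s t
  proof -
    have "(\<Sum>i<Suc k. ((x(k := s)) i - (y(k := t)) i)\<^sup>2) = (\<Sum>i<k. (x i - y i)\<^sup>2) + (s - t)\<^sup>2"
      by (simp add: lessThan_Suc)
    then show ?thesis using Suc.prems(5)[OF upd_in[OF that(1)] upd_in[OF that(2)]] by metis
  qed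
  define F where "F x = (\<integral>s. f (x(k := s)) \<partial>?N)" for x
  define E where "E x = (\<integral>s. exp (g (x(k := s))) \<partial>?N)" for x
  have E: "exp (- B) \<le> E x" "E x \<le> exp B" "0 < E x" if x: "x \<in> space (\<gamma> k)" for x
  proof -
    note i = int1[OF mexp gexp(1) x]
    show *: "exp (- B) \<le> E x" unfolding E_def
      by (intro N.integral_ge_const i AE_I2 gexp upd_in x)
    show "E x \<le> exp B" unfolding E_def
      by (intro N.integral_le_const i AE_I2 abs_le_D1[OF gexp(1)] upd_in x)
    show "0 < E x" by (rule less_le_trans[OF _ *]) simp
  qed
  have "ln (\<integral>x. exp (ln (E x)) \<partial>\<gamma> k) \<le> (\<integral>x. F x \<partial>\<gamma> k)"
  proof (rule Suc.IH)
    show "F \<in> borel_measurable (\<gamma> k)" unfolding F_def by measurable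
    show "(\<lambda>x. ln (E x)) \<in> borel_measurable (\<gamma> k)" unfolding E_def by measurable
    show "\<bar>ln (E x)\<bar> \<le> B" if "x \<in> space (\<gamma> k)" for x
    proof -
      have "ln (exp (- B)) \<le> ln (E x)" "ln (E x) \<le> ln (exp B)"
        using E[OF that] by (subst ln_le_cancel_iff; simp)+
      then show ?thesis by auto
    qed
    show "\<bar>F x\<bar> \<le> B" if x: "x \<in> space (\<gamma> k)" for x
    proof -
      note i = int1[of f, OF Suc.prems(1,2) x]
      have fB': "f (x(k := s)) \<le> B" "- B \<le> f (x(k := s))" for s
        using fB[OF x, of s] by linarith+
      have "F x \<le> B" unfolding F_def by (intro N.integral_le_const i AE_I2 fB')
      moreover have "- B \<le> F x" unfolding F_def by (intro N.integral_ge_const i AE_I2 fB')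
      ultimately show ?thesis by auto
    qed
    fix x y assume x: "x \<in> space (\<gamma> k)" and y: "y \<in> space (\<gamma> k)"
    \<comment> \<open>The cost of the first k coordinates does not depend on the last one, so it is
      absorbed into the function f as a constant.\<close>
    define d where "d = (\<Sum>i<k. (x i - y i)\<^sup>2) / 2"
    have d: "0 \<le> d" by (simp add: d_def sum_nonneg)
    have N_borel: "borel_measurable ?N = (borel_measurable borel :: (real \<Rightarrow> real) set)"
      by (intro measurable_cong_sets) simp_all
    have mf: "(\<lambda>s. f (y(k := s)) + d) \<in> borel_measurable borel"
      using measurable_compose[OF upd1[OF y] Suc.prems(1)] unfolding N_borel
      by (intro borel_measurable_add borel_measurable_const)
    have mg: "(\<lambda>s. g (x(k := s))) \<in> borel_measurable borel"
      using measurable_compose[OF upd1[OF x] Suc.prems(3)] unfolding N_borel .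
    have "ln (\<integral>s. exp (g (x(k := s))) \<partial>?N) \<le> (\<integral>s. f (y(k := s)) + d \<partial>?N)"
    proof (rule gaussian_transport_1[OF mf _ mg, of "B + d"])
      show "\<bar>f (y(k := s)) + d\<bar> \<le> B + d" "\<bar>g (x(k := s))\<bar> \<le> B + d" for s
        using fB[OF y, of s] gB[OF x, of s] d by linarith+
      show "g (x(k := s)) \<le> f (y(k := t)) + d + (s - t)\<^sup>2 / 2" for s t
        using fg[OF x y, of s t] by (simp add: d_def add_divide_distrib)
    qed
    also have "(\<integral>s. f (y(k := s)) + d \<partial>?N) = F y + d"
      using int1[of f, OF Suc.prems(1,2) y] by (simp add: F_def N.prob_space[simplified])
    finally show "ln (E x) \<le> F y + (\<Sum>i<k. (x i - y i)\<^sup>2) / 2" by (simp add: E_def d_def)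
  qed
  also have "(\<integral>x. F x \<partial>\<gamma> k) = (\<integral>x. f x \<partial>\<gamma> (Suc k))"
    unfolding F_def by (rule split[OF Suc.prems(1,2), symmetric])
  also have "(\<integral>x. exp (ln (E x)) \<partial>\<gamma> k) = (\<integral>x. E x \<partial>\<gamma> k)"
    using E by (intro Bochner_Integration.integral_cong) auto
  also have "\<dots> = (\<integral>x. exp (g x) \<partial>\<gamma> (Suc k))"
    unfolding E_def by (rule split[OF mexp gexp(1), symmetric])
  finally show ?case .
qed

section \<open>Gaussian vectors\<close>

context prob_space
begin

lemma integrable_iexp_mult [simp]:
  assumes [measurable]: "X \<in> borel_measurable M" and Y: "integrable M (Y :: 'a \<Rightarrow> complex)"
  shows "integrable M (\<lambda>z. Y z * iexp (X z))"
  by (rule Bochner_Integration.integrable_bound[OF Y]) (use Y in \<open>auto simp: norm_mult\<close>)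

text \<open>Under the probability measure with density Y / E Y the variable X has the characteristic
  function of \<nu>, so Levy uniqueness identifies its law. This is the tool for splitting one
  coordinate at a time off a joint law.\<close>

lemma weighted_law_unique_nonneg:
  assumes nu: "real_distribution \<nu>" and [measurable]: "X \<in> borel_measurable M" 
    and Y: "integrable M Y" and Y0: "\<And>z. 0 \<le> Y z"
    and char: "\<And>t. (\<integral>z. of_real (Y z) * iexp (t * X z) \<partial>M) = of_real (expectation Y) * char \<nu> t"
    and A: "A \<in> sets borel"
  shows "(\<integral>z. Y z * indicator A (X z) \<partial>M) = (expectation Y) * measure \<nu> A"
proof (cases "(expectation Y) = 0")
  case True
  then have "AE z in M. Y z = 0" using integral_nonneg_eq_0_iff_AE[OF Y] Y0 by simp
  then have "(\<integral>z. Y z * indicator A (X z) \<partial>M) = 0" by (intro integral_eq_zero_AE) auto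
  with True show ?thesis by simp
next
  case False
  define c where "c = (expectation Y)"
  have c: "0 < c" using False Y0 by (auto simp: c_def less_le intro!: integral_nonneg)
  have [measurable]: "Y \<in> borel_measurable M" using Y by simp
  define N where "N = density M (\<lambda>z. ennreal (Y z / c))"
  have "emeasure N (space N) = 1"
  proof -
    have "emeasure N (space N) = (\<integral>\<^sup>+z. ennreal (Y z / c) \<partial>M)"
      by (simp add: N_def emeasure_density cong: nn_integral_cong)
    also have "\<dots> = ennreal (\<integral>z. Y z / c \<partial>M)"
      using Y Y0 c by (intro nn_integral_eq_integral) auto
    also have "(\<integral>z. Y z / c \<partial>M) = 1" using c by (simp add: c_def)
    finally show ?thesis by simp
  qed
  then interpret N: prob_space N by (rule prob_spaceI)
  have [measurable]: "X \<in> borel_measurable N" by (simp add: N_def)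
  have "char (distr N borel X) t = char \<nu> t" for t
  proof -
    have "char (distr N borel X) t = (\<integral>z. iexp (t * X z) \<partial>N)"
      unfolding char_def by (subst integral_distr) auto
    also have "\<dots> = (\<integral>z. (Y z / c) *\<^sub>R iexp (t * X z) \<partial>M)"
      unfolding N_def using Y0 c by (subst integral_density) auto
    also have "\<dots> = (\<integral>z. of_real (Y z) * iexp (t * X z) / c \<partial>M)"
      by (simp add: scaleR_conv_of_real)
    also have "\<dots> = char \<nu> t" using char[of t] c by (simp flip: c_def)
    finally show ?thesis .
  qed
  then have "distr N borel X = \<nu>" using nu by (intro Levy_uniqueness) auto
  then have "measure \<nu> A = measure N (X -` A \<inter> space N)"
    using A by (auto simp: measure_distr)
  also have "\<dots> = (\<integral>z. indicat_real A (X z) \<partial>N)"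
  proof -
    have "(\<integral>z. indicat_real A (X z) \<partial>N) = (\<integral>z. indicat_real (X -` A \<inter> space N) z \<partial>N)"
      by (intro Bochner_Integration.integral_cong) (auto simp: indicator_def)
    also have "\<dots> = measure N (X -` A \<inter> space N)"
      by (subst Bochner_Integration.integral_indicator) (simp add: Int_absorb2)
    finally show ?thesis by simp
  qed
  also have "\<dots> = (\<integral>z. (Y z / c) *\<^sub>R indicator A (X z) \<partial>M)"
    unfolding N_def using Y0 c A by (subst integral_density) auto
  also have "\<dots> = (\<integral>z. Y z * indicator A (X z) \<partial>M) / c" by simp
  finally show ?thesis using c by (simp add: c_def[symmetric])
qed

text \<open>A weight with values in [-1, 1] is the difference of the nonnegative weights 1 + Y and
  1; the assumption \<open>X\<close> settles the weight 1.\<close>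

lemma weighted_law_unique_real:
  assumes nu: "real_distribution \<nu>" and [measurable]: "X \<in> borel_measurable M" 
    and X: "\<And>t. (\<integral>z. iexp (t * X z) \<partial>M) = char \<nu> t"
    and Y[measurable]: "Y \<in> borel_measurable M" and Y1: "\<And>z. \<bar>Y z\<bar> \<le> 1"
    and char: "\<And>t. (\<integral>z. of_real (Y z) * iexp (t * X z) \<partial>M) = of_real (expectation Y) * char \<nu> t"
    and A[measurable]: "A \<in> sets borel"
  shows "(\<integral>z. Y z * indicator A (X z) \<partial>M) = (expectation Y) * measure \<nu> A"
proof -
  have iY: "integrable M Y" using Y1 by (intro integrable_const_bound[of _ 1]) auto
  then have iY': "integrable M (\<lambda>z. complex_of_real (Y z))" by simp
  have ii: "integrable M (\<lambda>z. indicator A (X z) :: real)"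
    by (intro integrable_const_bound[of _ 1]) (auto simp: indicator_def)
  have iYi: "integrable M (\<lambda>z. Y z * indicator A (X z))"
    using Y1 by (intro integrable_const_bound[of _ 1]) (auto simp: indicator_def)
  have e: "integrable M (\<lambda>z. iexp (t * X z))" for t
    using integrable_iexp_mult[of "\<lambda>z. t * X z" "\<lambda>_. 1"] by simp
  have 1: "(\<integral>z. 1 * indicator A (X z) \<partial>M) = (\<integral>z. 1 \<partial>M) * measure \<nu> A"
    using X by (intro weighted_law_unique_nonneg[OF nu]) (auto simp: prob_space)
  have "(\<integral>z. (1 + Y z) * indicator A (X z) \<partial>M) = (\<integral>z. 1 + Y z \<partial>M) * measure \<nu> A"
  proof (rule weighted_law_unique_nonneg[OF nu])
    show "0 \<le> 1 + Y z" for z using Y1[of z] by linarith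
    fix t
    have "(\<integral>z. of_real (1 + Y z) * iexp (t * X z) \<partial>M)
        = (\<integral>z. iexp (t * X z) + of_real (Y z) * iexp (t * X z) \<partial>M)"
      by (simp add: distrib_right)
    also have "\<dots> = char \<nu> t + of_real (expectation Y) * char \<nu> t"
      using X[of t] char[of t] by (subst Bochner_Integration.integral_add) (auto intro: e integrable_iexp_mult iY' simp del: of_real_mult)
    finally show "(\<integral>z. of_real (1 + Y z) * iexp (t * X z) \<partial>M) = of_real (\<integral>z. 1 + Y z \<partial>M) * char \<nu> t"
      using iY by (simp add: prob_space distrib_right)
  qed (use iY in auto)
  moreover have "(\<integral>z. (1 + Y z) * indicator A (X z) \<partial>M)
      = (\<integral>z. 1 * indicator A (X z) \<partial>M) + (\<integral>z. Y z * indicator A (X z) \<partial>M)"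
    using ii iYi by (simp add: distrib_right)
  moreover have "(\<integral>z. 1 + Y z \<partial>M) = (\<integral>z. 1 \<partial>M) + (expectation Y)" using iY by simp
  ultimately show ?thesis using 1 by (simp add: distrib_right)
qed

text \<open>Conjugating the hypothesis at -t, where \<open>char\<close> \<nu> takes the conjugate
  value, shows that the conjugate weight factorises as well; Re Y is half the sum of the two
  weights.\<close>

lemma weighted_law_unique_Re:
  fixes Y :: "'a \<Rightarrow> complex"
  assumes nu: "real_distribution \<nu>" and [measurable]: "X \<in> borel_measurable M"
    and X: "\<And>t. (\<integral>z. iexp (t * X z) \<partial>M) = char \<nu> t"
    and Y[measurable]: "Y \<in> borel_measurable M" and Y1: "\<And>z. cmod (Y z) \<le> 1"
    and char: "\<And>t. (\<integral>z. Y z * iexp (t * X z) \<partial>M) = expectation Y * char \<nu> t"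
    and A[measurable]: "A \<in> sets borel"
  shows "Re (\<integral>z. Y z * indicator A (X z) \<partial>M) = Re (expectation Y) * measure \<nu> A"
proof -
  have iY: "integrable M Y" using Y1 by (intro integrable_const_bound[of _ 1]) auto
  have e: "integrable M (\<lambda>z. Y z * iexp (t * X z))" "integrable M (\<lambda>z. cnj (Y z) * iexp (t * X z))" for t
    by (rule integrable_iexp_mult; use iY in simp)+
  have cchar: "(\<integral>z. cnj (Y z) * iexp (t * X z) \<partial>M) = cnj (expectation Y) * char \<nu> t" for t
  proof -
    have "(\<integral>z. cnj (Y z) * iexp (t * X z) \<partial>M) = (\<integral>z. cnj (Y z * iexp (- t * X z)) \<partial>M)"
      by (intro Bochner_Integration.integral_cong) (auto simp: exp_cnj)
    also have "\<dots> = cnj (expectation Y * char \<nu> (- t))"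
      by (subst Bochner_Integration.integral_cnj) (simp only: char)
    also have "\<dots> = cnj (expectation Y) * cnj (char \<nu> (- t))" by simp
    also have "cnj (char \<nu> (- t)) = char \<nu> t"
      unfolding char_def by (simp flip: Bochner_Integration.integral_cnj add: exp_cnj)
    finally show ?thesis .
  qed
  have re: "(\<integral>z. Re (Y z) * indicator A (X z) \<partial>M) = (\<integral>z. Re (Y z) \<partial>M) * measure \<nu> A"
  proof (rule weighted_law_unique_real[OF nu _ X])
    show "\<bar>Re (Y z)\<bar> \<le> 1" for z using Y1[of z] abs_Re_le_cmod[of "Y z"] by linarith
    fix t
    have "(\<integral>z. of_real (Re (Y z)) * iexp (t * X z) \<partial>M)
        = (\<integral>z. (Y z * iexp (t * X z) + cnj (Y z) * iexp (t * X z)) / 2 \<partial>M)"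
      by (intro Bochner_Integration.integral_cong) (auto simp: complex_eq_iff)
    also have "\<dots> = (expectation Y * char \<nu> t + cnj (expectation Y) * char \<nu> t) / 2"
      using e[of t] char[of t] cchar[of t] by simp
    also have "\<dots> = of_real (Re (expectation Y)) * char \<nu> t" by (simp add: complex_eq_iff)
    finally show "(\<integral>z. of_real (Re (Y z)) * iexp (t * X z) \<partial>M) = of_real (\<integral>z. Re (Y z) \<partial>M) * char \<nu> t"
      using iY by simp
  qed auto
  have ind: "indicator A x = complex_of_real (indicator A x)" for x by (simp add: indicator_def)
  have i: "integrable M (\<lambda>z. Y z * indicator A (X z))"
    using Y1 by (intro integrable_const_bound[of _ 1]) (auto simp: indicator_def)
  have "Re (\<integral>z. Y z * indicator A (X z) \<partial>M) = (\<integral>z. Re (Y z) * indicator A (X z) \<partial>M)"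
    using i by (simp flip: integral_Re) (simp add: ind del: of_real_indicator)
  then show ?thesis using re iY by simp
qed

lemma weighted_law_unique:
  fixes Y :: "'a \<Rightarrow> complex"
  assumes nu: "real_distribution \<nu>" and X: "X \<in> borel_measurable M" "\<And>t. (\<integral>z. iexp (t * X z) \<partial>M) = char \<nu> t"
    and Y: "Y \<in> borel_measurable M" "\<And>z. cmod (Y z) \<le> 1"
    and char: "\<And>t. (\<integral>z. Y z * iexp (t * X z) \<partial>M) = expectation Y * char \<nu> t"
    and A: "A \<in> sets borel"
  shows "(\<integral>z. Y z * indicator A (X z) \<partial>M) = expectation Y * measure \<nu> A"
proof (rule complex_eqI)
  show "Re (\<integral>z. Y z * indicator A (X z) \<partial>M) = Re (expectation Y * measure \<nu> A)"
    using weighted_law_unique_Re[OF nu X Y char A] by simp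
  have "Re (\<integral>z. (- \<i> * Y z) * indicator A (X z) \<partial>M) = Re (\<integral>z. - \<i> * Y z \<partial>M) * measure \<nu> A"
  proof (rule weighted_law_unique_Re[OF nu X])
    show "(\<integral>z. (- \<i> * Y z) * iexp (t * X z) \<partial>M) = (\<integral>z. - \<i> * Y z \<partial>M) * char \<nu> t" for t
      using char[of t] by (simp only: mult.assoc integral_mult_right_zero)
  qed (use Y A in \<open>auto simp: norm_mult\<close>)
  then show "Im (\<integral>z. Y z * indicator A (X z) \<partial>M) = Im (expectation Y * measure \<nu> A)"
    by (simp only: mult.assoc integral_mult_right_zero) simp
qed

text \<open>Square integrability is part of the conclusion: the characteristic function identifies
  the law of X with that of sqrt v times a standard normal variable, and the second moment is
  computed there. The degenerate case v = 0 is covered.\<close>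

lemma variance_of_gaussian_char:
  assumes [measurable]: "X \<in> borel_measurable M" and v: "0 \<le> v"
    and char: "\<And>t. (\<integral>z. iexp (t * X z) \<partial>M) = of_real (exp (- (t\<^sup>2 * v) / 2))"
  shows "integrable M (\<lambda>z. (X z)\<^sup>2)" "(\<integral>z. (X z)\<^sup>2 \<partial>M) = v"
proof -
  let ?N = std_normal_distribution
  have eq: "distr M borel X = distr ?N borel (\<lambda>x. sqrt v * x)"
  proof (rule Levy_uniqueness)
    interpret N: real_distribution ?N by (rule real_dist_normal_dist)
    show "real_distribution (distr M borel X)" by simp
    show "real_distribution (distr ?N borel (\<lambda>x. sqrt v * x))" by (rule N.real_distribution_distr) simp
    show "char (distr M borel X) = char (distr ?N borel (\<lambda>x. sqrt v * x))"
    proof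
      fix t
      have "char (distr ?N borel (\<lambda>x. sqrt v * x)) t = char ?N (t * sqrt v)"
        unfolding char_def by (subst integral_distr) (auto simp: mult.assoc)
      also have "\<dots> = of_real (exp (- (t\<^sup>2 * v) / 2))"
        using v by (simp add: char_std_normal_distribution power_mult_distrib)
      also have "\<dots> = char (distr M borel X) t"
        unfolding char_def using char[of t] by (subst integral_distr) auto
      finally show "char (distr M borel X) t = char (distr ?N borel (\<lambda>x. sqrt v * x)) t" by simp
    qed
  qed
  have i: "integrable ?N (\<lambda>x. x^2)" by (rule integrable_std_normal_distribution_moment)
  have "integrable (distr ?N borel (\<lambda>x. sqrt v * x)) (\<lambda>x. x\<^sup>2)"
    using i by (subst integrable_distr_eq) (auto simp: power_mult_distrib)
  then show "integrable M (\<lambda>z. (X z)\<^sup>2)"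
    unfolding eq[symmetric] by (subst (asm) integrable_distr_eq) auto
  have "(\<integral>z. (X z)\<^sup>2 \<partial>M) = (\<integral>x. x\<^sup>2 \<partial>distr M borel X)" by (subst integral_distr) auto
  also have "\<dots> = (\<integral>x. (sqrt v * x)\<^sup>2 \<partial>?N)" unfolding eq by (subst integral_distr) auto
  also have "\<dots> = v * (\<integral>x. x\<^sup>2 \<partial>?N)" using v by (simp add: power_mult_distrib)
  also have "(\<integral>x. x\<^sup>2 \<partial>?N) = 1" using std_normal_distribution_even_moments(1)[of 1] by simp
  finally show "(\<integral>z. (X z)\<^sup>2 \<partial>M) = v" by simp
qed

end

section \<open>Linear spaces of centred Gaussian variables and orthonormal coordinates\<close>

lemma integrable_mult_square_integrable:
  fixes f g :: "'a \<Rightarrow> real"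
  assumes [measurable]: "f \<in> borel_measurable M" "g \<in> borel_measurable M"
    and f: "integrable M (\<lambda>x. (f x)\<^sup>2)" and g: "integrable M (\<lambda>x. (g x)\<^sup>2)"
  shows "integrable M (\<lambda>x. f x * g x)"
proof (rule Bochner_Integration.integrable_bound)
  show "integrable M (\<lambda>x. (f x)\<^sup>2 + (g x)\<^sup>2)" using f g by simp
  show "AE x in M. norm (f x * g x) \<le> norm ((f x)\<^sup>2 + (g x)\<^sup>2)"
  proof (rule AE_I2)
    fix x
    have "2 * (\<bar>f x\<bar> * \<bar>g x\<bar>) \<le> (f x)\<^sup>2 + (g x)\<^sup>2"
      using zero_le_power2[of "\<bar>f x\<bar> - \<bar>g x\<bar>"] unfolding power2_diff by simp
    moreover have "0 \<le> \<bar>f x\<bar> * \<bar>g x\<bar>" by simp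
    ultimately show "norm (f x * g x) \<le> norm ((f x)\<^sup>2 + (g x)\<^sup>2)"
      unfolding real_norm_def abs_mult by linarith
  qed
qed simp

text \<open>\<open>char_G\<close> prescribes the characteristic function at the argument 1 only; as
  \<open>G\<close> is closed under scaling, every member is a centred normal variable, possibly
  degenerate, with its second moment as variance. Members are functions, not classes modulo null
  sets.\<close>

locale gaussian_space = prob_space M for M :: "'a measure" +
  fixes G :: "('a \<Rightarrow> real) set"
  assumes measurable_G: "Y \<in> G \<Longrightarrow> Y \<in> borel_measurable M"
    and square_integrable_G: "Y \<in> G \<Longrightarrow> integrable M (\<lambda>z. (Y z)\<^sup>2)"
    and char_G: "Y \<in> G \<Longrightarrow> (\<integral>z. iexp (Y z) \<partial>M) = of_real (exp (- (\<integral>z. (Y z)\<^sup>2 \<partial>M) / 2))"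
    and add_G: "Y \<in> G \<Longrightarrow> Z \<in> G \<Longrightarrow> (\<lambda>z. Y z + Z z) \<in> G"
    and scale_G: "Y \<in> G \<Longrightarrow> (\<lambda>z. c * Y z) \<in> G"
    and zero_G: "(\<lambda>z. 0) \<in> G"
begin

lemma sum_G: "(\<And>i. i \<in> I \<Longrightarrow> X i \<in> G) \<Longrightarrow> (\<lambda>z. \<Sum>i\<in>I. c i * X i z) \<in> G"
proof (induction I rule: infinite_finite_induct)
  case (insert i I)
  have "(\<lambda>z. c i * X i z + (\<Sum>i\<in>I. c i * X i z)) \<in> G"
    by (rule add_G[OF scale_G insert.IH]) (use insert.prems in auto)
  then show ?case using insert.hyps by simp
qed (auto intro: zero_G)

lemma integrable_prod_G:
  assumes "Y \<in> G" "Z \<in> G"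
  shows "integrable M (\<lambda>z. Y z * Z z)"
  using assms by (intro integrable_mult_square_integrable measurable_G square_integrable_G)

lemma integrable_G: "Y \<in> G \<Longrightarrow> integrable M Y"
  using square_integrable_imp_integrable measurable_G square_integrable_G by blast

text \<open>Gram-Schmidt with respect to the inner product E (Y Z). A residual of norm 0 vanishes
  only almost surely, hence the expansions hold almost everywhere, and k may be smaller than
  N.\<close>

lemma orthonormal_basis:
  fixes X :: "nat \<Rightarrow> 'a \<Rightarrow> real"
  assumes "\<forall>i<N. X i \<in> G"
  shows "\<exists>(k::nat) g A. (\<forall>j<k. g j \<in> G) \<and>
    (\<forall>i<k. \<forall>j<k. (\<integral>z. g i z * g j z \<partial>M) = (if i = j then 1 else 0)) \<and>
    (\<forall>i<N. AE z in M. X i z = (\<Sum>j<k. A i j * g j z))"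
  using assms
proof (induction N)
  case 0
  then show ?case by (intro exI[of _ 0]) auto
next
  case (Suc N)
  have IH0: "\<forall>i<N. X i \<in> G" using Suc.prems by simp
  from Suc.IH[OF IH0] obtain k :: nat and g A where IH: "(\<forall>j<k. g j \<in> G) \<and>
      (\<forall>i<k. \<forall>j<k. (\<integral>z. g i z * g j z \<partial>M) = (if i = j then 1 else 0)) \<and>
      (\<forall>i<N. AE z in M. X i z = (\<Sum>j<k. A i j * g j z))"
    by blast
  then have g: "\<And>j. j < k \<Longrightarrow> g j \<in> G"
    and orth: "\<And>i j. i < k \<Longrightarrow> j < k \<Longrightarrow> (\<integral>z. g i z * g j z \<partial>M) = (if i = j then 1 else 0)"
    and A: "\<And>i. i < N \<Longrightarrow> AE z in M. X i z = (\<Sum>j<k. A i j * g j z)"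
    by simp_all
  define a where "a j = (\<integral>z. X N z * g j z \<partial>M)" for j
  define R where "R z = X N z + (\<Sum>j<k. (- a j) * g j z)" for z
  have XN: "X N \<in> G" using Suc.prems by auto
  have R: "R \<in> G" unfolding R_def using g by (intro add_G XN sum_G) auto
  have R_orth: "(\<integral>z. R z * g j z \<partial>M) = 0" if j: "j < k" for j
  proof -
    have "(\<integral>z. R z * g j z \<partial>M) = (\<integral>z. X N z * g j z + (\<Sum>i<k. (- a i) * (g i z * g j z)) \<partial>M)"
      by (simp add: R_def distrib_right sum_distrib_right mult.assoc)
    also have "\<dots> = a j + (\<Sum>i<k. (- a i) * (\<integral>z. g i z * g j z \<partial>M))"
    proof -
      have i: "integrable M (\<lambda>z. (- a i) * (g i z * g j z))" if "i \<in> {..<k}" for i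
        using that j by (intro integrable_mult_right integrable_prod_G g) auto
      have "(\<integral>z. X N z * g j z + (\<Sum>i<k. (- a i) * (g i z * g j z)) \<partial>M)
          = a j + (\<integral>z. (\<Sum>i<k. (- a i) * (g i z * g j z)) \<partial>M)"
        unfolding a_def[of j]
        by (intro Bochner_Integration.integral_add Bochner_Integration.integrable_sum i integrable_prod_G XN g j)
      also have "(\<integral>z. (\<Sum>i<k. (- a i) * (g i z * g j z)) \<partial>M) = (\<Sum>i<k. \<integral>z. (- a i) * (g i z * g j z) \<partial>M)"
        by (intro Bochner_Integration.integral_sum i)
      finally show ?thesis by (simp only: integral_mult_right_zero)
    qed
    also have "(\<Sum>i<k. (- a i) * (\<integral>z. g i z * g j z \<partial>M)) = (\<Sum>i<k. if i = j then - a i else 0)"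
      using orth j by (intro sum.cong) auto
    also have "\<dots> = - a j" using j by simp
    finally show ?thesis by simp
  qed
  define r where "r = (\<integral>z. (R z)\<^sup>2 \<partial>M)"
  have X_R: "X N z = (\<Sum>j<k. a j * g j z) + R z" for z by (simp add: R_def sum_negf)
  show ?case
  proof (cases "r = 0")
    case True
    have "AE z in M. (R z)\<^sup>2 = 0"
      using integral_nonneg_eq_0_iff_AE[OF square_integrable_G[OF R]] True by (simp add: r_def)
    then have "AE z in M. X N z = (\<Sum>j<k. a j * g j z)"
      by eventually_elim (simp add: X_R)
    then show ?thesis
      using g orth A by (intro exI[of _ k] exI[of _ g] exI[of _ "A(N := a)"]) (auto simp: less_Suc_eq)
  next
    case False
    then have r: "0 < r" by (simp add: r_def less_le)
    define g' where "g' = g(k := \<lambda>z. (1 / sqrt r) * R z)"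
    \<comment> \<open>The new row consists of the projection coefficients followed by the norm of
      the residual; the old rows get 0 in the new column.\<close>
    define A' where "A' i j = (if i = N then (if j = k then sqrt r else a j) else if j = k then 0 else A i j)" for i j
    have g'_less: "g' j = g j" if "j < k" for j using that by (simp add: g'_def)
    have g'_k: "g' k = (\<lambda>z. (1 / sqrt r) * R z)" by (simp add: g'_def)
    have "g' j \<in> G" if "j < Suc k" for j
    proof (cases "j = k")
      case True
      then show ?thesis unfolding True g'_k by (intro scale_G R)
    qed (use that g in \<open>simp add: g'_less\<close>)
    moreover have "(\<integral>z. g' i z * g' j z \<partial>M) = (if i = j then 1 else 0)" if ij: "i < Suc k" "j < Suc k" for i j
    proof -
      consider "i < k" "j < k" | "i = k" "j < k" | "i < k" "j = k" | "i = k" "j = k"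
        using ij by (auto simp: less_Suc_eq)
      then show ?thesis
      proof cases
        case 1 then show ?thesis using orth by (simp add: g'_less)
      next
        case 2
        then show ?thesis using R_orth[of j] by (simp add: g'_less g'_k mult.assoc)
      next
        case 3
        then show ?thesis using R_orth[of i] by (simp add: g'_less g'_k mult.commute)
      next
        case 4
        have "(\<integral>z. g' i z * g' j z \<partial>M) = (\<integral>z. (1 / r) * (R z)\<^sup>2 \<partial>M)"
          using 4 r by (intro Bochner_Integration.integral_cong) (auto simp: g'_k power2_eq_square)
        then show ?thesis using 4 r by (simp add: r_def[symmetric])
      qed
    qed
    moreover have "AE z in M. X i z = (\<Sum>j<Suc k. A' i j * g' j z)" if "i < Suc N" for i
    proof (cases "i = N")
      case True
      have "X N z = (\<Sum>j<Suc k. A' N j * g' j z)" for z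
        using r unfolding X_R by (simp add: g'_k g'_less A'_def)
      then show ?thesis using True by simp
    next
      case False
      then have "i < N" using that by simp
      from A[OF this] show ?thesis
        by eventually_elim (use \<open>i < N\<close> in \<open>simp add: g'_less A'_def\<close>)
    qed
    ultimately show ?thesis
      by (intro exI[of _ "Suc k"] exI[of _ g'] exI[of _ A'] conjI allI impI)
  qed
qed

lemma char_orthonormal:
  fixes g :: "nat \<Rightarrow> 'a \<Rightarrow> real"
  assumes g: "\<And>j. j < k \<Longrightarrow> g j \<in> G"
    and orth: "\<And>i j. i < k \<Longrightarrow> j < k \<Longrightarrow> (\<integral>z. g i z * g j z \<partial>M) = (if i = j then 1 else 0)"
    and I: "I \<subseteq> {..<k}"
  shows "(\<integral>z. (\<Sum>j\<in>I. t j * g j z)\<^sup>2 \<partial>M) = (\<Sum>j\<in>I. (t j)\<^sup>2)"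
    and "(\<integral>z. iexp (\<Sum>j\<in>I. t j * g j z) \<partial>M) = of_real (exp (- (\<Sum>j\<in>I. (t j)\<^sup>2) / 2))"
proof -
  have fin: "finite I" using I finite_subset by blast
  have *: "(\<Sum>j\<in>I. t j * g j z)\<^sup>2 = (\<Sum>i\<in>I. \<Sum>j\<in>I. (t i * t j) * (g i z * g j z))" for z
    by (simp add: power2_eq_square sum_product algebra_simps)
  have "(\<integral>z. (\<Sum>j\<in>I. t j * g j z)\<^sup>2 \<partial>M) = (\<Sum>i\<in>I. \<Sum>j\<in>I. (t i * t j) * (\<integral>z. g i z * g j z \<partial>M))"
  proof -
    have i: "integrable M (\<lambda>z. (t i * t j) * (g i z * g j z))" if "i \<in> I" "j \<in> I" for i j
      using that I by (intro integrable_mult_right integrable_prod_G g) auto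
    have "(\<integral>z. (\<Sum>i\<in>I. \<Sum>j\<in>I. (t i * t j) * (g i z * g j z)) \<partial>M)
        = (\<Sum>i\<in>I. \<integral>z. (\<Sum>j\<in>I. (t i * t j) * (g i z * g j z)) \<partial>M)"
      by (intro Bochner_Integration.integral_sum Bochner_Integration.integrable_sum i)
    also have "\<dots> = (\<Sum>i\<in>I. \<Sum>j\<in>I. \<integral>z. (t i * t j) * (g i z * g j z) \<partial>M)"
      by (intro sum.cong refl Bochner_Integration.integral_sum i)
    finally show ?thesis unfolding * by (simp only: integral_mult_right_zero)
  qed
  also have "\<dots> = (\<Sum>i\<in>I. \<Sum>j\<in>I. if i = j then (t i)\<^sup>2 else 0)"
    using orth I by (intro sum.cong) (auto simp: subset_iff power2_eq_square)
  also have "\<dots> = (\<Sum>i\<in>I. (t i)\<^sup>2)" using fin by simp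
  finally show eq: "(\<integral>z. (\<Sum>j\<in>I. t j * g j z)\<^sup>2 \<partial>M) = (\<Sum>j\<in>I. (t j)\<^sup>2)" .
  have "(\<lambda>z. \<Sum>j\<in>I. t j * g j z) \<in> G" using g I by (intro sum_G) auto
  from char_G[OF this] show "(\<integral>z. iexp (\<Sum>j\<in>I. t j * g j z) \<partial>M) = of_real (exp (- (\<Sum>j\<in>I. (t j)\<^sup>2) / 2))"
    unfolding eq .
qed

text \<open>Orthonormality factorises the joint characteristic function. Rectangle probabilities are
  extracted from it by replacing exponentials by indicators one coordinate after the other; each
  replacement is \<open>weighted_law_unique\<close> with the product of all other factors as
  weight.\<close>

lemma distr_orthonormal:
  fixes g :: "nat \<Rightarrow> 'a \<Rightarrow> real"
  assumes g: "\<And>j. j < k \<Longrightarrow> g j \<in> G"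
    and orth: "\<And>i j. i < k \<Longrightarrow> j < k \<Longrightarrow> (\<integral>z. g i z * g j z \<partial>M) = (if i = j then 1 else 0)"
  shows "distr M (\<Pi>\<^sub>M j\<in>{..<k}. std_normal_distribution) (\<lambda>z. \<lambda>j\<in>{..<k}. g j z)
    = (\<Pi>\<^sub>M j\<in>{..<k}. std_normal_distribution)"
proof -
  define \<gamma> where "\<gamma> = std_normal_distribution"
  interpret \<gamma>: real_distribution \<gamma> unfolding \<gamma>_def by (rule real_dist_normal_dist)
  interpret product_sigma_finite "\<lambda>_::nat. \<gamma>" by standard
  have [measurable]: "g j \<in> borel_measurable M" if "j < k" for j using measurable_G g that by auto
  have char_\<gamma>: "char \<gamma> t = of_real (exp (- t\<^sup>2 / 2))" for t
    by (simp add: \<gamma>_def char_std_normal_distribution)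
  \<comment> \<open>m counts the coordinates that already carry an indicator: at m = 0 this is the
    joint characteristic function, at m = k the probability of a rectangle. \<open>t\<close> stays
    arbitrary because its value at m is varied in the induction step.\<close>
  have key: "(\<integral>z. complex_of_real (\<Prod>j<m. indicator (A j) (g j z)) * iexp (\<Sum>j\<in>{m..<k}. t j * g j z) \<partial>M)
      = of_real ((\<Prod>j<m. measure \<gamma> (A j)) * exp (- (\<Sum>j\<in>{m..<k}. (t j)\<^sup>2) / 2))"
    if "m \<le> k" and A: "\<And>j. j < k \<Longrightarrow> A j \<in> sets borel" for m A and t :: "nat \<Rightarrow> real"
    using that(1)
  proof (induction m arbitrary: t)
    case 0
    have "(\<integral>z. iexp (\<Sum>j\<in>{0..<k}. t j * g j z) \<partial>M) = of_real (exp (- (\<Sum>j\<in>{0..<k}. (t j)\<^sup>2) / 2))"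
      by (rule char_orthonormal(2)[OF g orth]) auto
    then show ?case by simp
  next
    case (Suc m)
    then have m: "m < k" by simp
    define Y where "Y z = complex_of_real (\<Prod>j<m. indicator (A j) (g j z)) * iexp (\<Sum>j\<in>{Suc m..<k}. t j * g j z)" for z
    have Ym[measurable]: "Y \<in> borel_measurable M"
    proof -
      have "(\<lambda>z. \<Sum>j\<in>{Suc m..<k}. t j * g j z) \<in> borel_measurable M"
        by (intro borel_measurable_sum borel_measurable_times borel_measurable_const) simp
      moreover have "(\<lambda>z. \<Prod>j<m. indicat_real (A j) (g j z)) \<in> borel_measurable M"
      proof (rule borel_measurable_prod)
        fix j assume "j \<in> {..<m}"
        then have j: "j < k" using m by simp
        show "(\<lambda>z. indicat_real (A j) (g j z)) \<in> borel_measurable M"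
          by (rule measurable_compose[OF _ borel_measurable_indicator[OF A[OF j]]]) (simp add: j)
      qed
      ultimately show ?thesis unfolding Y_def by measurable
    qed
    have Ycm: "(\<integral>z. Y z * iexp (s * g m z) \<partial>M)
      = of_real ((\<Prod>j<m. measure \<gamma> (A j)) * exp (- (\<Sum>j\<in>{Suc m..<k}. (t j)\<^sup>2) / 2)) * char \<gamma> s" for s
    proof -
      have *: "(\<Sum>j\<in>{m..<k}. f ((t(m := s)) j) j) = f s m + (\<Sum>j\<in>{Suc m..<k}. f (t j) j)" for f :: "real \<Rightarrow> nat \<Rightarrow> real"
        using m by (simp add: sum.atLeast_Suc_lessThan)
      have "Y z * iexp (s * g m z) = complex_of_real (\<Prod>j<m. indicator (A j) (g j z)) * iexp (\<Sum>j\<in>{m..<k}. (t(m := s)) j * g j z)" for z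
        unfolding Y_def *[of "\<lambda>x j. x * g j z"] by (simp add: distrib_left exp_add)
      then have "(\<integral>z. Y z * iexp (s * g m z) \<partial>M)
        = of_real ((\<Prod>j<m. measure \<gamma> (A j)) * exp (- (\<Sum>j\<in>{m..<k}. ((t(m := s)) j)\<^sup>2) / 2))"
        using Suc.IH[of "t(m := s)"] m by simp
      also have "exp (- (\<Sum>j\<in>{m..<k}. ((t(m := s)) j)\<^sup>2) / 2)
          = exp (- (\<Sum>j\<in>{Suc m..<k}. (t j)\<^sup>2) / 2) * exp (- s\<^sup>2 / 2)"
        unfolding *[of "\<lambda>x j. x\<^sup>2"] exp_add[symmetric] by (simp add: add_divide_distrib diff_divide_distrib)
      also have "complex_of_real ((\<Prod>j<m. measure \<gamma> (A j)) * (exp (- (\<Sum>j\<in>{Suc m..<k}. (t j)\<^sup>2) / 2) * exp (- s\<^sup>2 / 2)))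
          = of_real ((\<Prod>j<m. measure \<gamma> (A j)) * exp (- (\<Sum>j\<in>{Suc m..<k}. (t j)\<^sup>2) / 2)) * char \<gamma> s"
        unfolding char_\<gamma> by simp
      finally show ?thesis .
    qed
    have Y0: "(expectation Y) = of_real ((\<Prod>j<m. measure \<gamma> (A j)) * exp (- (\<Sum>j\<in>{Suc m..<k}. (t j)\<^sup>2) / 2))"
      using Ycm[of 0] by (simp add: char_\<gamma>)
    have "(\<integral>z. Y z * indicator (A m) (g m z) \<partial>M) = (expectation Y) * measure \<gamma> (A m)"
    proof (rule weighted_law_unique)
      show "real_distribution \<gamma>" by standard
      show "g m \<in> borel_measurable M" using m by simp
      show "A m \<in> sets borel" using A m by simp
      show "(\<integral>z. iexp (s * g m z) \<partial>M) = char \<gamma> s" for s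
        using char_orthonormal(2)[OF g orth, of k "{m}" "\<lambda>_. s"] m by (simp add: char_\<gamma>)
      show "(\<integral>z. Y z * iexp (s * g m z) \<partial>M) = (expectation Y) * char \<gamma> s" for s
        using Ycm Y0 by simp
      show "cmod (Y z) \<le> 1" for z
      proof -
        have "\<bar>\<Prod>j<m. indicat_real (A j) (g j z)\<bar> \<le> 1"
          unfolding abs_prod by (intro prod_le_1) (auto simp: indicator_def)
        then show ?thesis by (simp add: Y_def norm_mult del: of_real_prod)
      qed
    qed simp
    moreover have "Y z * indicator (A m) (g m z) = complex_of_real (\<Prod>j<Suc m. indicator (A j) (g j z)) * iexp (\<Sum>j\<in>{Suc m..<k}. t j * g j z)" for z
      by (simp add: Y_def indicator_def)
    ultimately show ?case unfolding Y0 by simp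
  qed
  have "distr M (\<Pi>\<^sub>M j\<in>{..<k}. \<gamma>) (\<lambda>z. \<lambda>j\<in>{..<k}. g j z) = (\<Pi>\<^sub>M j\<in>{..<k}. \<gamma>)"
  proof (rule PiM_eqI)
    fix A :: "nat \<Rightarrow> real set" assume "\<And>i. i \<in> {..<k} \<Longrightarrow> A i \<in> sets \<gamma>"
    then have A: "\<And>i. i < k \<Longrightarrow> A i \<in> sets borel" by auto
    have m: "(\<lambda>z. \<lambda>j\<in>{..<k}. g j z) \<in> M \<rightarrow>\<^sub>M (\<Pi>\<^sub>M j\<in>{..<k}. \<gamma>)"
      by (intro measurable_restrict) (simp add: \<gamma>_def)
    let ?S = "(\<lambda>z. \<lambda>j\<in>{..<k}. g j z) -` (\<Pi>\<^sub>E j\<in>{..<k}. A j) \<inter> space M"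
    have S: "?S = {z\<in>space M. \<forall>j\<in>{..<k}. g j z \<in> A j}" by (auto simp: PiE_def Pi_def)
    have Sm: "?S \<in> sets M" unfolding S using A by measurable
    have "complex_of_real (measure M ?S) = (\<integral>z. complex_of_real (indicator ?S z) \<partial>M)"
      using Sm by (subst integral_complex_of_real) (simp add: Int_absorb2)
    also have "\<dots> = (\<integral>z. complex_of_real (\<Prod>j<k. indicator (A j) (g j z)) \<partial>M)"
    proof (intro Bochner_Integration.integral_cong arg_cong[where f = complex_of_real] refl)
      fix z assume "z \<in> space M"
      then show "indicator ?S z = (\<Prod>j<k. indicat_real (A j) (g j z))"
        unfolding S by (cases "\<forall>j<k. g j z \<in> A j") (auto simp: indicator_def prod_zero_iff)
    qed
    also have "\<dots> = complex_of_real (\<Prod>j<k. measure \<gamma> (A j))"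
      using key[OF order_refl, of A "\<lambda>_. 0"] A by simp
    finally have "measure M ?S = (\<Prod>j<k. measure \<gamma> (A j))" using of_real_eq_iff by blast
    moreover have "emeasure (distr M (\<Pi>\<^sub>M j\<in>{..<k}. \<gamma>) (\<lambda>z. \<lambda>j\<in>{..<k}. g j z)) (\<Pi>\<^sub>E j\<in>{..<k}. A j) = emeasure M ?S"
      using A by (intro emeasure_distr m sets_PiM_I_finite) auto
    ultimately show "emeasure (distr M (\<Pi>\<^sub>M j\<in>{..<k}. \<gamma>) (\<lambda>z. \<lambda>j\<in>{..<k}. g j z)) (\<Pi>\<^sub>E j\<in>{..<k}. A j)
        = (\<Prod>j\<in>{..<k}. emeasure \<gamma> (A j))"
      by (simp add: emeasure_eq_measure \<gamma>.emeasure_eq_measure prod_ennreal)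
  qed auto
  then show ?thesis unfolding \<gamma>_def .
qed

end

section \<open>The Borell-TIS inequality\<close>

text \<open>Fatou's lemma, in the form that passes exponential bounds to a pointwise limit before
  that limit is known to have an exponential moment.\<close>

lemma nn_integral_le_limit:
  assumes [measurable]: "\<And>n. Z n \<in> borel_measurable M"
    and lim: "\<And>x. x \<in> space M \<Longrightarrow> (\<lambda>n. Z n x) \<longlonglongrightarrow> S x" and c: "c \<longlonglongrightarrow> d"
    and le: "\<And>n. (\<integral>\<^sup>+x. ennreal (Z n x) \<partial>M) \<le> ennreal (c n)"
  shows "(\<integral>\<^sup>+x. ennreal (S x) \<partial>M) \<le> ennreal d"
proof -
  have "(\<integral>\<^sup>+x. ennreal (S x) \<partial>M) = (\<integral>\<^sup>+x. liminf (\<lambda>n. ennreal (Z n x)) \<partial>M)"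
    by (intro nn_integral_cong lim_imp_Liminf[symmetric] tendsto_ennrealI lim) auto
  also have "\<dots> \<le> liminf (\<lambda>n. \<integral>\<^sup>+x. ennreal (Z n x) \<partial>M)"
    by (intro nn_integral_liminf) simp
  also have "\<dots> \<le> liminf (\<lambda>n. ennreal (c n))"
    by (intro Liminf_mono always_eventually allI le)
  also have "\<dots> = ennreal d"
    by (intro lim_imp_Liminf tendsto_ennrealI c) auto
  finally show ?thesis .
qed

lemma clamp_diff_le:
  fixes x y R :: real
  shows "\<bar>max (- R) (min R x) - max (- R) (min R y)\<bar> \<le> \<bar>x - y\<bar>"
  by (auto simp: max_def min_def abs_if)

context gaussian_space
begin

text \<open>Orthonormal coordinates turn Z into a function \<open>F\<close> on standard Gaussian
  space. The transport inequality concerns bounded functions, so it is applied to clamped versions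
  of \<open>F\<close>, and the clamp is released by dominated convergence and Fatou's lemma. The
  sign of l is free: nonnegative l gives the tail, l = -1 the finiteness of the expected
  supremum.\<close>

lemma mgf_Max_le:
  fixes X :: "nat \<Rightarrow> 'a \<Rightarrow> real"
  assumes N: "0 < N" and X: "\<And>i. i < N \<Longrightarrow> X i \<in> G"
    and v: "\<And>i. i < N \<Longrightarrow> (\<integral>z. (X i z)\<^sup>2 \<partial>M) \<le> v"
  defines "Z \<equiv> \<lambda>z. Max ((\<lambda>i. X i z) ` {..<N})"
  shows "integrable M Z"
    and "(\<integral>\<^sup>+z. ennreal (exp (l * Z z)) \<partial>M) \<le> ennreal (exp (l * (expectation Z) + l\<^sup>2 * v / 2))"
proof -
  have ne: "{..<N} \<noteq> {}" using N by auto
  have Xm[measurable]: "X i \<in> borel_measurable M" if "i < N" for i using measurable_G X that by auto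
  have Zm[measurable]: "Z \<in> borel_measurable M"
    unfolding Z_def by (intro borel_measurable_Max) (auto intro: Xm)
  show Zi: "integrable M Z"
  proof (rule Bochner_Integration.integrable_bound)
    show "integrable M (\<lambda>z. \<Sum>i<N. \<bar>X i z\<bar>)"
      using X by (intro Bochner_Integration.integrable_sum Bochner_Integration.integrable_abs integrable_G) auto
    show "AE z in M. norm (Z z) \<le> norm (\<Sum>i<N. \<bar>X i z\<bar>)"
    proof (rule AE_I2)
      fix z
      have "Z z \<in> (\<lambda>i. X i z) ` {..<N}" unfolding Z_def using ne by (intro Max_in) auto
      then obtain i where i: "i < N" "Z z = X i z" by auto
      have "\<bar>X i z\<bar> \<le> (\<Sum>i<N. \<bar>X i z\<bar>)" using i by (intro member_le_sum) auto
      then show "norm (Z z) \<le> norm (\<Sum>i<N. \<bar>X i z\<bar>)" using i by simp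
    qed
  qed simp
  have "\<forall>i<N. X i \<in> G" using X by simp
  from orthonormal_basis[OF this] obtain k :: nat and g :: "nat \<Rightarrow> 'a \<Rightarrow> real" and A where
    *: "(\<forall>j<k. g j \<in> G) \<and> (\<forall>i<k. \<forall>j<k. (\<integral>z. g i z * g j z \<partial>M) = (if i = j then 1 else 0)) \<and>
      (\<forall>i<N. AE z in M. X i z = (\<Sum>j<k. A i j * g j z))" by blast
  then have g: "\<And>j. j < k \<Longrightarrow> g j \<in> G"
    and orth: "\<And>i j. i < k \<Longrightarrow> j < k \<Longrightarrow> (\<integral>z. g i z * g j z \<partial>M) = (if i = j then 1 else 0)"
    and A: "\<And>i. i < N \<Longrightarrow> AE z in M. X i z = (\<Sum>j<k. A i j * g j z)"
    by simp_all
  have gm: "g j \<in> borel_measurable M" if "j < k" for j using measurable_G g that by auto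
  have Av: "(\<Sum>j<k. (A i j)\<^sup>2) \<le> v" if i: "i < N" for i
  proof -
    have "(\<Sum>j<k. (A i j)\<^sup>2) = (\<integral>z. (\<Sum>j<k. A i j * g j z)\<^sup>2 \<partial>M)"
      by (rule char_orthonormal(1)[OF g orth, symmetric]) auto
    also have "\<dots> = (\<integral>z. (X i z)\<^sup>2 \<partial>M)"
    proof (rule integral_cong_AE)
      show "AE z in M. (\<Sum>j<k. A i j * g j z)\<^sup>2 = (X i z)\<^sup>2" using A[OF i] by eventually_elim simp
      show "(\<lambda>z. (\<Sum>j<k. A i j * g j z)\<^sup>2) \<in> borel_measurable M"
        by (intro borel_measurable_power borel_measurable_sum borel_measurable_times borel_measurable_const gm) simp
    qed (use i in simp)
    finally show ?thesis using v[OF i] by simp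
  qed
  define \<gamma> where "\<gamma> = (\<Pi>\<^sub>M j\<in>{..<k}. std_normal_distribution)"
  define gg where "gg z = (\<lambda>j\<in>{..<k}. g j z)" for z
  have ggm[measurable]: "gg \<in> M \<rightarrow>\<^sub>M \<gamma>"
    unfolding gg_def \<gamma>_def by (intro measurable_restrict) (simp add: gm)
  have distr_gg: "distr M \<gamma> gg = \<gamma>"
    unfolding gg_def[abs_def] \<gamma>_def by (rule distr_orthonormal[OF g orth])
  define F where "F y = Max ((\<lambda>i. \<Sum>j<k. A i j * y j) ` {..<N})" for y :: "nat \<Rightarrow> real"
  have comp: "(\<lambda>y. y j) \<in> borel_measurable \<gamma>" if "j < k" for j
    unfolding \<gamma>_def using measurable_component_singleton[of j "{..<k}" "\<lambda>_. std_normal_distribution"] that by simp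
  have Fm[measurable]: "F \<in> borel_measurable \<gamma>"
    unfolding F_def
    by (intro borel_measurable_Max borel_measurable_sum borel_measurable_times borel_measurable_const comp) auto
  have ZF: "AE z in M. Z z = F (gg z)"
  proof -
    have "AE z in M. \<forall>i\<in>{..<N}. X i z = (\<Sum>j<k. A i j * g j z)"
      using A by (intro AE_finite_allI) auto
    then show ?thesis
    proof eventually_elim
      case (elim z)
      then have "(\<lambda>i. X i z) ` {..<N} = (\<lambda>i. \<Sum>j<k. A i j * gg z j) ` {..<N}"
        by (intro image_cong) (auto simp: gg_def)
      then show ?case by (simp add: Z_def F_def)
    qed
  qed
  \<comment> \<open>The index attaining the maximum at x bounds the difference by a single linear
    form in x - y. Then 2 a b <= a^2 + b^2 in each coordinate, and \<open>Av\<close> bounds the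
    squared length of the coefficient vector.\<close>
  have F_le: "\<bar>l\<bar> * (F x - F y) \<le> l\<^sup>2 * v / 2 + (\<Sum>j<k. (x j - y j)\<^sup>2) / 2" for x y
  proof -
    have "F x \<in> (\<lambda>i. \<Sum>j<k. A i j * x j) ` {..<N}" unfolding F_def using ne by (intro Max_in) auto
    then obtain i where i: "i < N" "F x = (\<Sum>j<k. A i j * x j)" by auto
    have "(\<Sum>j<k. A i j * y j) \<le> F y" unfolding F_def using i by (intro Max_ge) auto
    then have "F x - F y \<le> (\<Sum>j<k. A i j * (x j - y j))"
      using i by (simp add: right_diff_distrib sum_subtractf)
    then have "\<bar>l\<bar> * (F x - F y) \<le> \<bar>l\<bar> * (\<Sum>j<k. A i j * (x j - y j))" by (intro mult_left_mono) auto
    also have "\<dots> = (\<Sum>j<k. (\<bar>l\<bar> * A i j) * (x j - y j))" by (simp add: sum_distrib_left mult.assoc)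
    also have "\<dots> \<le> (\<Sum>j<k. l\<^sup>2 * (A i j)\<^sup>2 / 2 + (x j - y j)\<^sup>2 / 2)"
    proof (rule sum_mono)
      fix j
      show "(\<bar>l\<bar> * A i j) * (x j - y j) \<le> l\<^sup>2 * (A i j)\<^sup>2 / 2 + (x j - y j)\<^sup>2 / 2"
        using zero_le_power2[of "\<bar>l\<bar> * A i j - (x j - y j)"]
        unfolding power2_diff[of "\<bar>l\<bar> * A i j"] power_mult_distrib by simp
    qed
    also have "\<dots> = l\<^sup>2 * (\<Sum>j<k. (A i j)\<^sup>2) / 2 + (\<Sum>j<k. (x j - y j)\<^sup>2) / 2"
      by (simp add: sum.distrib sum_distrib_left sum_divide_distrib)
    also have "\<dots> \<le> l\<^sup>2 * v / 2 + (\<Sum>j<k. (x j - y j)\<^sup>2) / 2"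
      using Av[OF i(1)] by (intro add_mono divide_right_mono mult_left_mono) auto
    finally show ?thesis .
  qed
  have F_abs: "\<bar>l\<bar> * \<bar>F x - F y\<bar> \<le> l\<^sup>2 * v / 2 + (\<Sum>j<k. (x j - y j)\<^sup>2) / 2" for x y
    using F_le[of x y] F_le[of y x] by (auto simp: abs_if power2_commute[of "y _"])
  \<comment> \<open>Clamping to [-n, n] is a contraction, so the clamped function inherits the cost
    condition from \<open>F\<close>.\<close>
  define T where "T n x = max (- real n) (min (real n) x)" for n :: nat and x :: real
  have T_bound: "\<bar>T n x\<bar> \<le> real n" "\<bar>T n x\<bar> \<le> \<bar>x\<bar>" for n x by (auto simp: T_def)
  have Tm[measurable]: "T n \<in> borel_measurable borel" for n unfolding T_def by measurable
  have v0: "0 \<le> v" using v[OF N] by (rule order_trans[rotated]) simp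
  have trunc: "(\<integral>\<^sup>+z. ennreal (exp (l * T n (Z z))) \<partial>M) \<le> ennreal (exp (l * (\<integral>z. T n (Z z) \<partial>M) + l\<^sup>2 * v / 2))" for n
  proof -
    define c where "c = l\<^sup>2 * v / 2"
    define B where "B = \<bar>l\<bar> * real n + c"
    have c: "0 \<le> c" using v0 by (simp add: c_def)
    have b: "\<bar>l * T n x\<bar> \<le> \<bar>l\<bar> * real n" for x
      unfolding abs_mult by (intro mult_left_mono T_bound) simp
    \<comment> \<open>The surplus l^2 v / 2 of the estimate \<open>F_abs\<close> is subtracted from
      the second function, which leaves the pure quadratic cost.\<close>
    have 1: "ln (\<integral>x. exp (l * T n (F x) - c) \<partial>\<gamma>) \<le> (\<integral>x. l * T n (F x) \<partial>\<gamma>)"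
      unfolding \<gamma>_def
    proof (rule gaussian_transport[where B = B], unfold \<gamma>_def[symmetric])
      show "(\<lambda>x. l * T n (F x)) \<in> borel_measurable \<gamma>" "(\<lambda>x. l * T n (F x) - c) \<in> borel_measurable \<gamma>"
        by measurable
      show "\<bar>l * T n (F x)\<bar> \<le> B" "\<bar>l * T n (F x) - c\<bar> \<le> B" for x
        using b[of "F x"] c unfolding B_def by linarith+
      fix x y
      have "l * T n (F x) - l * T n (F y) \<le> \<bar>l\<bar> * \<bar>T n (F x) - T n (F y)\<bar>"
        by (simp add: right_diff_distrib[symmetric] abs_mult[symmetric])
      also have "\<dots> \<le> \<bar>l\<bar> * \<bar>F x - F y\<bar>"
        unfolding T_def by (intro mult_left_mono clamp_diff_le) simp
      finally show "l * T n (F x) - c \<le> l * T n (F y) + (\<Sum>i<k. (x i - y i)\<^sup>2) / 2"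
        using F_abs[of x y] unfolding c_def by linarith
    qed
    have tr: "(\<integral>x. u (F x) \<partial>\<gamma>) = (\<integral>z. u (Z z) \<partial>M)" if [measurable]: "u \<in> borel_measurable borel" for u :: "real \<Rightarrow> real"
    proof -
      have "(\<integral>x. u (F x) \<partial>\<gamma>) = (\<integral>z. u (F (gg z)) \<partial>M)"
        by (subst distr_gg[symmetric], subst integral_distr) auto
      also have "\<dots> = (\<integral>z. u (Z z) \<partial>M)"
        using ZF by (intro integral_cong_AE) auto
      finally show ?thesis .
    qed
    have i: "integrable M (\<lambda>z. exp (l * T n (Z z)))"
      using b by (intro integrable_const_bound[of _ "exp (\<bar>l\<bar> * real n)"]) (auto simp: abs_le_iff)
    have "(\<integral>z. exp (- (\<bar>l\<bar> * real n)) \<partial>M) \<le> (\<integral>z. exp (l * T n (Z z)) \<partial>M)"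
    proof (rule integral_mono[OF _ i])
      fix z show "exp (- (\<bar>l\<bar> * real n)) \<le> exp (l * T n (Z z))"
        using b[of "Z z"] unfolding exp_le_cancel_iff by linarith
    qed simp
    then have pos: "0 < (\<integral>z. exp (l * T n (Z z)) \<partial>M)" by (rule less_le_trans[rotated]) (simp add: prob_space)
    have "(\<integral>x. exp (l * T n (F x) - c) \<partial>\<gamma>) = exp (- c) * (\<integral>z. exp (l * T n (Z z)) \<partial>M)"
      by (subst tr[of "\<lambda>y. exp (l * T n y - c)"]) (simp_all add: exp_diff exp_minus divide_inverse mult.commute)
    then have "ln (\<integral>x. exp (l * T n (F x) - c) \<partial>\<gamma>) = ln (\<integral>z. exp (l * T n (Z z)) \<partial>M) - c"
      using pos by (simp add: ln_mult)
    moreover have "(\<integral>x. l * T n (F x) \<partial>\<gamma>) = l * (\<integral>z. T n (Z z) \<partial>M)"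
      by (subst tr[of "\<lambda>y. l * T n y"]) simp_all
    ultimately have "ln (\<integral>z. exp (l * T n (Z z)) \<partial>M) \<le> l * (\<integral>z. T n (Z z) \<partial>M) + c" using 1 by linarith
    then have "exp (ln (\<integral>z. exp (l * T n (Z z)) \<partial>M)) \<le> exp (l * (\<integral>z. T n (Z z) \<partial>M) + c)"
      unfolding exp_le_cancel_iff .
    then have "(\<integral>z. exp (l * T n (Z z)) \<partial>M) \<le> exp (l * (\<integral>z. T n (Z z) \<partial>M) + c)"
      unfolding exp_ln[OF pos] .
    then show ?thesis
      unfolding c_def using i by (subst nn_integral_eq_integral) (auto intro!: ennreal_leI)
  qed
  have T_lim: "(\<lambda>n. T n x) \<longlonglongrightarrow> x" for x
  proof (rule tendsto_eventually)
    obtain n0 where "\<bar>x\<bar> \<le> real n0" using real_arch_simple by blast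
    then show "\<forall>\<^sub>F n in sequentially. T n x = x"
      by (intro eventually_sequentiallyI[of n0]) (auto simp: T_def)
  qed
  have lim: "(\<lambda>n. \<integral>z. T n (Z z) \<partial>M) \<longlonglongrightarrow> (expectation Z)"
    by (rule integral_dominated_convergence[where w = "\<lambda>z. \<bar>Z z\<bar>"]) (use Zi T_lim T_bound in auto)
  show "(\<integral>\<^sup>+z. ennreal (exp (l * Z z)) \<partial>M) \<le> ennreal (exp (l * (expectation Z) + l\<^sup>2 * v / 2))"
    by (rule nn_integral_le_limit[OF _ _ _ trunc]) (auto intro!: tendsto_intros T_lim lim)
qed

text \<open>The maxima \<open>Z n\<close> of the first n + 1 variables increase to S. Their means
  converge once they are bounded, the exponential bound survives the limit, and Chernoff's method
  turns it into the tail bound.\<close>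

lemma borell_tis:
  fixes X :: "nat \<Rightarrow> 'a \<Rightarrow> real"
  assumes X: "\<And>i. X i \<in> G"
    and v: "\<And>i. (\<integral>z. (X i z)\<^sup>2 \<partial>M) \<le> v"
    and bdd: "\<And>z. z \<in> space M \<Longrightarrow> bdd_above (range (\<lambda>i. X i z))"
  defines "S \<equiv> \<lambda>z. SUP i. X i z"
  shows "integrable M S"
    and "u \<ge> (expectation S) \<Longrightarrow>
      measure M {z\<in>space M. S z \<ge> u} \<le> exp (- ((u - (expectation S))\<^sup>2 / (2 * v)))"
proof -
  define Z where "Z n z = Max ((\<lambda>i. X i z) ` {..<Suc n})" for n z
  have Xm[measurable]: "X i \<in> borel_measurable M" for i using measurable_G X by auto
  have Zi: "integrable M (Z n)" for n
    unfolding Z_def using mgf_Max_le(1)[of "Suc n" X v] X v by auto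
  have Zmgf: "(\<integral>\<^sup>+z. ennreal (exp (l * Z n z)) \<partial>M) \<le> ennreal (exp (l * (expectation (Z n)) + l\<^sup>2 * v / 2))" for n l
    unfolding Z_def using mgf_Max_le(2)[of "Suc n" X v] X v by auto
  have v0: "0 \<le> v" using v[of 0] by (rule order_trans[rotated]) simp
  have Zmono: "mono (\<lambda>n. Z n z)" for z
    unfolding Z_def by (intro monoI Max_mono) auto
  have ZS: "Z n z \<le> S z" if "z \<in> space M" for n z
  proof -
    have "X i z \<le> S z" for i unfolding S_def using bdd[OF that] by (rule cSUP_upper2[OF _ UNIV_I order_refl])
    then show ?thesis unfolding Z_def by (subst Max_le_iff) auto
  qed
  have XZ: "X n z \<le> Z n z" for n z unfolding Z_def by (intro Max_ge) auto
  have Zlim: "(\<lambda>n. Z n z) \<longlonglongrightarrow> S z" if z: "z \<in> space M" for z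
  proof -
    have bZ: "bdd_above (range (\<lambda>n. Z n z))" using ZS[OF z] by (auto intro!: bdd_aboveI)
    have "(SUP n. Z n z) = S z"
    proof (rule antisym)
      show "(SUP n. Z n z) \<le> S z" by (intro cSUP_least ZS z) auto
      show "S z \<le> (SUP n. Z n z)" unfolding S_def
        by (intro cSUP_least) (auto intro: cSUP_upper2[OF bZ UNIV_I XZ])
    qed
    then show ?thesis using LIMSEQ_incseq_SUP[OF bZ Zmono] by simp
  qed
  have Zm[measurable]: "Z n \<in> borel_measurable M" for n using Zi by auto
  have Sm[measurable]: "S \<in> borel_measurable M"
    by (rule borel_measurable_LIMSEQ_real[OF Zlim Zm])
  define m where "m n = (expectation (Z n))" for n
  have m_mono: "incseq m"
    unfolding m_def by (intro monoI integral_mono Zi) (use Zmono in \<open>auto simp: mono_def\<close>)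
  (* The expectations m n stay bounded because exp (- S) has positive expectation and bounds
     exp (- m n + v / 2) from below. *)
  define c where "c = (\<integral>\<^sup>+z. ennreal (exp (- S z)) \<partial>M)"
  have c_pos: "c \<noteq> 0"
  proof
    assume "c = 0"
    then have "AE z in M. ennreal (exp (- S z)) = 0" unfolding c_def by (subst (asm) nn_integral_0_iff_AE) auto
    then have "AE z in M. False" by eventually_elim simp
    then show False by simp
  qed
  have c_le: "c \<le> ennreal (exp (- m n + v / 2))" for n
  proof -
    have "c \<le> (\<integral>\<^sup>+z. ennreal (exp (- Z n z)) \<partial>M)"
      unfolding c_def by (intro nn_integral_mono ennreal_leI) (use ZS in auto)
    also have "\<dots> \<le> ennreal (exp (- m n + v / 2))" using Zmgf[of "-1" n] by (simp add: m_def)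
    finally show ?thesis .
  qed
  have c_fin: "c < \<top>" using c_le[of 0] by (rule le_less_trans) simp
  have m_bdd: "m n \<le> v / 2 - ln (enn2real c)" for n
  proof -
    have pos: "0 < enn2real c" using c_pos c_fin by (simp add: enn2real_positive_iff zero_less_iff_neq_zero)
    have "enn2real c \<le> exp (- m n + v / 2)" using c_le[of n] by (intro enn2real_leI) auto
    then have "ln (enn2real c) \<le> ln (exp (- m n + v / 2))" using pos by (subst ln_le_cancel_iff) auto
    then show ?thesis by simp
  qed
  have "bdd_above (range m)" using m_bdd by (auto intro!: bdd_aboveI)
  from LIMSEQ_incseq_SUP[OF this m_mono] obtain m0 where m_lim: "m \<longlonglongrightarrow> m0" by blast
  show Si: "integrable M S"
    by (rule integrable_monotone_convergence[OF Zi _ _ m_lim[unfolded m_def[abs_def]] Sm]) (use Zmono Zlim in auto)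
  have ES: "(expectation S) = m0"
    by (rule integral_monotone_convergence[OF Zi _ _ m_lim[unfolded m_def[abs_def]] Sm]) (use Zmono Zlim in auto)
  have mgf: "(\<integral>\<^sup>+z. ennreal (exp (l * S z)) \<partial>M) \<le> ennreal (exp (l * m0 + l\<^sup>2 * v / 2))" for l
    by (rule nn_integral_le_limit[OF _ _ _ Zmgf[folded m_def]]) (auto intro!: tendsto_intros Zlim m_lim)
  show "measure M {z\<in>space M. S z \<ge> u} \<le> exp (- ((u - (expectation S))\<^sup>2 / (2 * v)))"
    if u: "u \<ge> (expectation S)"
  proof (cases "v = 0")
    \<comment> \<open>Division by 0 gives 0, so the claimed bound is exp 0 = 1.\<close>
    case True
    then show ?thesis by simp
  next
    case False
    with v0 have vp: "0 < v" by simp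
    \<comment> \<open>This l minimises - l u + l m0 + l^2 v / 2; it is nonnegative because u is at
      least the expectation.\<close>
    define l where "l = (u - m0) / v"
    have l: "0 \<le> l" using u vp by (simp add: l_def ES)
    have "emeasure M {z\<in>space M. S z \<ge> u} = (\<integral>\<^sup>+z. indicator {z\<in>space M. S z \<ge> u} z \<partial>M)" by simp
    also have "\<dots> \<le> (\<integral>\<^sup>+z. ennreal (exp (- l * u)) * ennreal (exp (l * S z)) \<partial>M)"
    proof (rule nn_integral_mono)
      fix z
      have "1 \<le> exp (- l * u + l * S z)" if "u \<le> S z"
        using mult_left_mono[OF that l] by simp
      then show "indicator {z\<in>space M. S z \<ge> u} z \<le> ennreal (exp (- l * u)) * ennreal (exp (l * S z))"
        by (auto simp: indicator_def ennreal_mult[symmetric] exp_add[symmetric] simp flip: ennreal_1 intro!: ennreal_leI)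
    qed
    also have "\<dots> = ennreal (exp (- l * u)) * (\<integral>\<^sup>+z. ennreal (exp (l * S z)) \<partial>M)"
      by (rule nn_integral_cmult) simp
    also have "\<dots> \<le> ennreal (exp (- l * u)) * ennreal (exp (l * m0 + l\<^sup>2 * v / 2))"
      by (intro mult_left_mono mgf) simp
    also have "\<dots> = ennreal (exp (- l * u + (l * m0 + l\<^sup>2 * v / 2)))"
      by (simp only: ennreal_mult[symmetric] exp_ge_zero exp_add[symmetric])
    also have "- l * u + (l * m0 + l\<^sup>2 * v / 2) = - ((u - m0)\<^sup>2 / (2 * v))"
      using vp by (simp add: l_def power2_eq_square field_simps)
    finally have "ennreal (measure M {z\<in>space M. S z \<ge> u}) \<le> ennreal (exp (- ((u - m0)\<^sup>2 / (2 * v))))"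
      by (simp add: emeasure_eq_measure)
    then show ?thesis by (simp add: ES ennreal_le_iff)
  qed
qed

end

(* The divisor 4 is 2 from the normal characteristic function times 2 because the real part of a
   circular complex Gaussian variable carries half of its variance. *)
definition spectral_gaussian ::
  "'a measure \<Rightarrow> (real \<Rightarrow> real) \<Rightarrow> real set \<Rightarrow> (real \<Rightarrow> 'a \<Rightarrow> complex) \<Rightarrow> (real \<Rightarrow> real \<Rightarrow> complex) \<Rightarrow> bool" where
  "spectral_gaussian M p S V \<kappa> \<longleftrightarrow>
     (\<forall>s\<in>S. V s \<in> borel_measurable M) \<and>
     (\<forall>N c s. (\<forall>i<(N::nat). s i \<in> S) \<longrightarrow>
        (\<integral>z. iexp (Re (\<Sum>i<N. c i * V (s i) z)) \<partial>M) =
        complex_of_real (exp (- (LINT l:{0<..}|lborel. (cmod (\<Sum>i<N. c i * \<kappa> (s i) l))\<^sup>2 * p l) / 4)))"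

lemma spectral_gaussian_char:
  fixes V :: "real \<Rightarrow> 'a \<Rightarrow> complex" and c :: "nat \<Rightarrow> complex" and s :: "nat \<Rightarrow> real"
  assumes "spectral_gaussian M p S V \<kappa>" and "\<forall>i<N. s i \<in> S"
  shows "(\<integral>z. iexp (Re (\<Sum>i<N. c i * V (s i) z)) \<partial>M) =
    complex_of_real (exp (- (LINT l:{0<..}|lborel. (cmod (\<Sum>i<N. c i * \<kappa> (s i) l))\<^sup>2 * p l) / 4))"
  using assms(1)[unfolded spectral_gaussian_def, THEN conjunct2, THEN spec[of _ N], THEN spec[of _ c], THEN spec[of _ s]]
    assms(2) by (rule mp)

lemma sum_lessThan_concat:
  fixes f :: "nat \<Rightarrow> 'b::comm_monoid_add"
  shows "(\<Sum>i<m + n. f i) = (\<Sum>i<m. f i) + (\<Sum>i<n. f (m + i))"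
  by (induction n) (simp_all add: add.assoc)

text \<open>Multiplying the coefficients by t turns the formula at the argument 1 into the full
  characteristic function of Y, that of a centred normal law with variance q / 2.\<close>

lemma spectral_gaussian_variance:
  fixes V :: "real \<Rightarrow> 'a \<Rightarrow> complex" and c :: "nat \<Rightarrow> complex" and s :: "nat \<Rightarrow> real"
  assumes M: "prob_space M" and V: "spectral_gaussian M p S V \<kappa>" and s: "\<forall>i<N. s i \<in> S"
    and p: "\<And>l. 0 \<le> p l"
  defines "Y \<equiv> \<lambda>z. Re (\<Sum>i<N. c i * V (s i) z)"
    and "q \<equiv> LINT l:{0<..}|lborel. (cmod (\<Sum>i<N. c i * \<kappa> (s i) l))\<^sup>2 * p l"
  shows "Y \<in> borel_measurable M" "integrable M (\<lambda>z. (Y z)\<^sup>2)" "(\<integral>z. (Y z)\<^sup>2 \<partial>M) = q / 2"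
proof -
  interpret prob_space M by (rule M)
  have "(\<lambda>z. \<Sum>i<N. c i * V (s i) z) \<in> borel_measurable M"
    using V s unfolding spectral_gaussian_def
    by (intro borel_measurable_sum borel_measurable_times borel_measurable_const) auto
  then show Ym: "Y \<in> borel_measurable M" unfolding Y_def by (rule measurable_compose[OF _ borel_measurable_Re])
  have q: "0 \<le> q / 2" unfolding q_def set_lebesgue_integral_def
    by (intro divide_nonneg_pos Bochner_Integration.integral_nonneg) (auto simp: p indicator_def)
  have char: "(\<integral>z. iexp (t * Y z) \<partial>M) = of_real (exp (- (t\<^sup>2 * (q / 2)) / 2))" for t
  proof -
    have "(\<integral>z. iexp (Re (\<Sum>i<N. (of_real t * c i) * V (s i) z)) \<partial>M) =
        complex_of_real (exp (- (LINT l:{0<..}|lborel. (cmod (\<Sum>i<N. (of_real t * c i) * \<kappa> (s i) l))\<^sup>2 * p l) / 4))"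
      by (rule spectral_gaussian_char[OF V s])
    moreover have "(\<Sum>i<N. (of_real t * c i) * V (s i) z) = of_real t * (\<Sum>i<N. c i * V (s i) z)" for z
      by (simp add: sum_distrib_left mult.assoc)
    moreover have "(\<Sum>i<N. (of_real t * c i) * \<kappa> (s i) l) = of_real t * (\<Sum>i<N. c i * \<kappa> (s i) l)" for l
      by (simp add: sum_distrib_left mult.assoc)
    moreover have "(LINT l:{0<..}|lborel. (cmod (of_real t * (\<Sum>i<N. c i * \<kappa> (s i) l)))\<^sup>2 * p l) = t\<^sup>2 * q"
      unfolding q_def set_integral_mult_right[symmetric] norm_mult power_mult_distrib
      by (simp add: mult.assoc)
    ultimately show ?thesis by (simp add: Y_def)
  qed
  show "integrable M (\<lambda>z. (Y z)\<^sup>2)" "(\<integral>z. (Y z)\<^sup>2 \<partial>M) = q / 2"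
    by (rule variance_of_gaussian_char[OF Ym q char])+
qed

text \<open>Combinations are indexed by initial segments of the naturals and may repeat a scale, so
  the sum of two of them is their concatenation.\<close>

lemma spectral_gaussian_space:
  assumes M: "prob_space M" and V: "spectral_gaussian M p S V \<kappa>" and p: "\<And>l. 0 \<le> p l"
  shows "gaussian_space M {Y. \<exists>N c s. (\<forall>i<(N::nat). s i \<in> S) \<and> Y = (\<lambda>z. Re (\<Sum>i<N. c i * V (s i) z))}"
    (is "gaussian_space M ?G")
proof -
  interpret prob_space M by (rule M)
  show ?thesis
  proof
    fix Y assume "Y \<in> ?G"
    then obtain N :: nat and c s where s: "\<forall>i<N. s i \<in> S" and Y: "Y = (\<lambda>z. Re (\<Sum>i<N. c i * V (s i) z))"
      by blast
    note var = spectral_gaussian_variance[OF M V s p, of c]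
    show "Y \<in> borel_measurable M" "integrable M (\<lambda>z. (Y z)\<^sup>2)" unfolding Y by (rule var)+
    have "(\<integral>z. iexp (Y z) \<partial>M) =
        complex_of_real (exp (- (LINT l:{0<..}|lborel. (cmod (\<Sum>i<N. c i * \<kappa> (s i) l))\<^sup>2 * p l) / 4))"
      unfolding Y by (rule spectral_gaussian_char[OF V s])
    then show "(\<integral>z. iexp (Y z) \<partial>M) = of_real (exp (- (\<integral>z. (Y z)\<^sup>2 \<partial>M) / 2))"
      unfolding Y var(3) by simp
    show "(\<lambda>z. r * Y z) \<in> ?G" for r
      using s by (intro CollectI exI[of _ N] exI[of _ "\<lambda>i. of_real r * c i"] exI[of _ s])
        (simp add: Y sum_distrib_left mult.assoc)
    fix Z assume "Z \<in> ?G"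
    then obtain N' :: nat and c' s' where s': "\<forall>i<N'. s' i \<in> S" and Z: "Z = (\<lambda>z. Re (\<Sum>i<N'. c' i * V (s' i) z))"
      by blast
    show "(\<lambda>z. Y z + Z z) \<in> ?G"
      using s s'
      by (intro CollectI exI[of _ "N + N'"] exI[of _ "\<lambda>i. if i < N then c i else c' (i - N)"]
          exI[of _ "\<lambda>i. if i < N then s i else s' (i - N)"])
        (auto simp: Y Z sum_lessThan_concat)
  next
    show "(\<lambda>z. 0) \<in> ?G" by (intro CollectI exI[of _ 0]) auto
  qed
qed

text \<open>The modulus is the supremum of the real Gaussian variables \<open>Re (u * V s)\<close> over the
  unit circle, and each of these has only half the variance of \<open>V s\<close>: this is why the exponent
  has no factor 2.\<close>

theorem spectral_gaussian_sup:
  fixes V :: "real \<Rightarrow> 'a \<Rightarrow> complex"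
  assumes M: "prob_space M" and V: "spectral_gaussian M p {a..b} V \<kappa>" and p: "\<And>l. 0 \<le> p l"
    and ab: "a \<le> b"
    and cont: "\<And>z. z \<in> space M \<Longrightarrow> continuous_on {a..b} (\<lambda>s. V s z)"
    and w: "continuous_on {a..b} w" and w0: "\<And>s. s \<in> {a..b} \<Longrightarrow> 0 \<le> w s"
    and bdd: "bdd_above ((\<lambda>s. LINT l:{0<..}|lborel. (cmod (\<kappa> s l))\<^sup>2 * p l) ` {a..b})"
  defines "X \<equiv> \<lambda>z. SUP s\<in>{a..b}. w s * cmod (V s z)"
    and "\<sigma> \<equiv> SUP s\<in>{a..b}. w s * sqrt (LINT l:{0<..}|lborel. (cmod (\<kappa> s l))\<^sup>2 * p l)"
  shows "integrable M X"
    and "(\<integral>z. X z \<partial>M) \<le> u \<Longrightarrow>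
      measure M {z\<in>space M. u \<le> X z} \<le> exp (- ((u - (\<integral>z. X z \<partial>M))\<^sup>2 / \<sigma>\<^sup>2))"
proof -
  define \<tau> where "\<tau> s = (LINT l:{0<..}|lborel. (cmod (\<kappa> s l))\<^sup>2 * p l)" for s
  have \<tau>0: "0 \<le> \<tau> s" for s unfolding \<tau>_def set_lebesgue_integral_def
    by (intro Bochner_Integration.integral_nonneg) (auto simp: p indicator_def)
  define G where "G = {Y. \<exists>N c s. (\<forall>i<(N::nat). s i \<in> {a..b}) \<and> Y = (\<lambda>z. Re (\<Sum>i<N. c i * V (s i) z))}"
  interpret gaussian_space M G unfolding G_def by (rule spectral_gaussian_space[OF M V p])
  \<comment> \<open>A supremum of reals is an upper bound only for a set that is bounded above; this
    is ensured by \<open>bdd\<close> and by the continuity of w on a compact interval.\<close>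
  have \<sigma>_upper: "w s * sqrt (\<tau> s) \<le> \<sigma>" if s: "s \<in> {a..b}" for s
  proof -
    have "bdd_above (\<tau> ` {a..b})" using bdd by (simp add: \<tau>_def[abs_def])
    then obtain B where B: "\<And>s. s \<in> {a..b} \<Longrightarrow> \<tau> s \<le> B" unfolding bdd_above_def by (metis imageI)
    have "compact (w ` {a..b})" using w by (intro compact_continuous_image) auto
    then obtain C where C: "\<And>s. s \<in> {a..b} \<Longrightarrow> w s \<le> C"
      using compact_imp_bounded bounded_imp_bdd_above unfolding bdd_above_def by (metis imageI)
    have "w s * sqrt (\<tau> s) \<le> C * sqrt B" if "s \<in> {a..b}" for s
      using B[OF that] C[OF that] w0[OF that] \<tau>0[of s] by (intro mult_mono) auto
    then have "bdd_above ((\<lambda>s. w s * sqrt (\<tau> s)) ` {a..b})" by (rule bdd_aboveI2)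
    then show ?thesis unfolding \<sigma>_def \<tau>_def[symmetric] by (rule cSUP_upper[OF s])
  qed
  \<comment> \<open>A point of K is a scale together with a phase. A countable dense subset recovers
    the supremum on every path, without an exceptional set, because \<open>h z\<close> is continuous
    on K for each z in the space.\<close>
  define K where "K = {a..b} \<times> (sphere 0 1 :: complex set)"
  have K: "closed K" unfolding K_def by (intro closed_Times) auto
  obtain T where T: "countable T" "T \<subseteq> K" "K \<subseteq> closure T" using separable[of K] .
  have clT: "closure T = K" using T K by (simp add: closure_minimal subset_antisym)
  have "(a, 1) \<in> K" using ab by (simp add: K_def)
  then have Tne: "T \<noteq> {}" using clT by auto
  define e where "e = from_nat_into T"
  have e: "range e = T" unfolding e_def by (rule range_from_nat_into[OF Tne T(1)])
  have eK: "fst (e i) \<in> {a..b}" "cmod (snd (e i)) = 1" for i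
  proof -
    have "e i \<in> K" using e T(2) by blast
    then show "fst (e i) \<in> {a..b}" "cmod (snd (e i)) = 1" by (auto simp: K_def)
  qed
  define h where "h z x = w (fst x) * Re (snd x * V (fst x) z)" for z x
  define Xi where "Xi i z = h z (e i)" for i z
  have Xi_eq: "Xi i = (\<lambda>z. Re (\<Sum>j<(1::nat). (of_real (w (fst (e i))) * snd (e i)) * V (fst (e i)) z))" for i
    by (auto simp: Xi_def h_def fun_eq_iff algebra_simps)
  have XiG: "Xi i \<in> G" for i
    unfolding G_def Xi_eq using eK(1)[of i]
    by (intro CollectI exI[of _ 1] exI[of _ "\<lambda>_. of_real (w (fst (e i))) * snd (e i)"] exI[of _ "\<lambda>_. fst (e i)"]) auto
  have Xiv: "(\<integral>z. (Xi i z)\<^sup>2 \<partial>M) \<le> \<sigma>\<^sup>2 / 2" for i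
  proof -
    let ?s = "fst (e i)"
    have "(\<integral>z. (Xi i z)\<^sup>2 \<partial>M) =
        (LINT l:{0<..}|lborel. (cmod (\<Sum>j<(1::nat). (of_real (w ?s) * snd (e i)) * \<kappa> ?s l))\<^sup>2 * p l) / 2"
      unfolding Xi_eq by (rule spectral_gaussian_variance(3)[OF M V _ p]) (use eK in auto)
    also have "(LINT l:{0<..}|lborel. (cmod (\<Sum>j<(1::nat). (of_real (w ?s) * snd (e i)) * \<kappa> ?s l))\<^sup>2 * p l) = (w ?s)\<^sup>2 * \<tau> ?s"
      unfolding \<tau>_def set_integral_mult_right[symmetric]
      using eK(2)[of i] by (simp add: norm_mult power_mult_distrib mult.assoc)
    also have "\<dots> = (w ?s * sqrt (\<tau> ?s))\<^sup>2" by (simp add: power_mult_distrib \<tau>0)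
    also have "\<dots> \<le> \<sigma>\<^sup>2" using eK(1) w0 \<tau>0 by (intro power_mono \<sigma>_upper) auto
    finally show ?thesis by simp
  qed
  have sup: "bdd_above (range (\<lambda>i. Xi i z))" "(SUP i. Xi i z) = X z" if z: "z \<in> space M" for z
  proof -
    have "continuous_on {a..b} (\<lambda>s. w s * cmod (V s z))"
      by (intro continuous_intros w cont z)
    then have "compact ((\<lambda>s. w s * cmod (V s z)) ` {a..b})" by (intro compact_continuous_image) auto
    then have bX: "bdd_above ((\<lambda>s. w s * cmod (V s z)) ` {a..b})"
      by (intro bounded_imp_bdd_above compact_imp_bounded)
    have hX: "h z x \<le> X z" if "x \<in> K" for x
    proof -
      have x: "fst x \<in> {a..b}" "cmod (snd x) = 1" using that by (auto simp: K_def)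
      have "Re (snd x * V (fst x) z) \<le> cmod (V (fst x) z)"
        using complex_Re_le_cmod[of "snd x * V (fst x) z"] x by (simp add: norm_mult)
      then have "h z x \<le> w (fst x) * cmod (V (fst x) z)"
        unfolding h_def using w0 x by (intro mult_left_mono) auto
      also have "\<dots> \<le> X z" unfolding X_def by (rule cSUP_upper[OF x(1) bX])
      finally show ?thesis .
    qed
    have XiX: "Xi i z \<le> X z" for i unfolding Xi_def using e T(2) by (intro hX) auto
    then show bXi: "bdd_above (range (\<lambda>i. Xi i z))" by (auto intro!: bdd_aboveI)
    have hc: "continuous_on K (h z)"
    proof -
      have f: "continuous_on K fst" "continuous_on K snd" by (intro continuous_intros)+
      have im: "fst ` K \<subseteq> {a..b}" by (auto simp: K_def)
      have "continuous_on K (\<lambda>x. w (fst x))" "continuous_on K (\<lambda>x. V (fst x) z)"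
        using continuous_on_compose2[OF w f(1) im] continuous_on_compose2[OF cont[OF z] f(1) im] by auto
      then show ?thesis unfolding h_def by (intro continuous_intros f)
    qed
    show "(SUP i. Xi i z) = X z"
    proof (rule antisym)
      show "(SUP i. Xi i z) \<le> X z" by (intro cSUP_least XiX) auto
      have hS: "h z x \<le> (SUP i. Xi i z)" if "x \<in> K" for x
      proof (rule continuous_le_on_closure[where S = T])
        show "continuous_on (closure T) (h z)" "x \<in> closure T" using hc that by (auto simp: clT)
        fix y assume "y \<in> T"
        then obtain i where "y = e i" using e by blast
        then show "h z y \<le> (SUP i. Xi i z)"
          using cSUP_upper[OF UNIV_I bXi, of i] by (simp add: Xi_def)
      qed
      show "X z \<le> (SUP i. Xi i z)" unfolding X_def
      proof (rule cSUP_least)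
        fix s assume s: "s \<in> {a..b}"
        \<comment> \<open>This phase makes v * V s z real and nonnegative; at a zero of V any phase
          does.\<close>
        define v where "v = (if V s z = 0 then 1 else cnj (V s z) / cmod (V s z))"
        have v: "cmod v = 1" "Re (v * V s z) = cmod (V s z)"
        proof -
          show "cmod v = 1" by (simp add: v_def norm_divide)
          show "Re (v * V s z) = cmod (V s z)"
          proof (cases "V s z = 0")
            case False
            have "v * V s z = (V s z * cnj (V s z)) / cmod (V s z)"
              using False by (simp add: v_def mult.commute)
            also have "V s z * cnj (V s z) = of_real ((cmod (V s z))\<^sup>2)"
              by (rule complex_norm_square[symmetric])
            also have "\<dots> / complex_of_real (cmod (V s z)) = complex_of_real (cmod (V s z))"
              using False by (simp add: power2_eq_square)
            finally show ?thesis by simp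
          qed simp
        qed
        have "(s, v) \<in> K" using s v by (simp add: K_def)
        from hS[OF this] show "w s * cmod (V s z) \<le> (SUP i. Xi i z)" by (simp only: h_def fst_conv snd_conv v)
      qed (use ab in auto)
    qed
  qed
  note bt = borell_tis[of Xi "\<sigma>\<^sup>2 / 2", OF XiG Xiv sup(1)]
  have EX: "(\<integral>z. (SUP i. Xi i z) \<partial>M) = (\<integral>z. X z \<partial>M)"
    by (intro Bochner_Integration.integral_cong refl sup)
  show "integrable M X"
    using bt(1) by (rule iffD1[OF Bochner_Integration.integrable_cong, rotated 2]) (auto simp: sup)
  show "measure M {z\<in>space M. u \<le> X z} \<le> exp (- ((u - (\<integral>z. X z \<partial>M))\<^sup>2 / \<sigma>\<^sup>2))"
    if "(\<integral>z. X z \<partial>M) \<le> u"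
  proof -
    have "{z\<in>space M. u \<le> X z} = {z\<in>space M. u \<le> (SUP i. Xi i z)}" using sup by auto
    then show ?thesis using bt(2)[of u] that unfolding EX by simp
  qed
qed

section \<open>Path integrals of second-order processes\<close>

text \<open>Joint measurability is what Fubini requires, and the second moment bound, uniform in
  time, admits every integrable function as a kernel. Gaussian and spectral properties enter later,
  in \<open>spectral_process\<close>.\<close>

locale second_order_process = prob_space M for M :: "'a measure" +
  fixes X :: "real \<Rightarrow> 'a \<Rightarrow> real" and C :: real
  assumes joint [measurable]: "(\<lambda>(t, z). X t z) \<in> borel_measurable (borel \<Otimes>\<^sub>M M)"
    and square_integrable: "integrable M (\<lambda>z. (X t z)\<^sup>2)"
    and second_moment_le: "(\<integral>z. (X t z)\<^sup>2 \<partial>M) \<le> C"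
begin

lemma X_measurable [measurable]: "X t \<in> borel_measurable M"
  using measurable_compose[OF measurable_Pair1'[of t borel M] joint] by simp

lemma pair_sf: "pair_sigma_finite lborel M"
  by (simp add: pair_sigma_finite_def sigma_finite_lborel sigma_finite_measure_axioms)

lemma nn_second_moment: "(\<integral>\<^sup>+z. ennreal ((X t z)\<^sup>2) \<partial>M) \<le> ennreal C"
  using second_moment_le[of t] square_integrable[of t]
  by (subst nn_integral_eq_integral) (auto intro: ennreal_leI)

text \<open>|f X| <= |f|^2 + X^2 bounds the integral over the probability space uniformly in t; the
  integrable g then takes care of the integral over time.\<close>

lemma integrable_pair:
  fixes g :: "real \<Rightarrow> 'b::{real_normed_field, banach, second_countable_topology}" and f :: "'a \<Rightarrow> 'b"
  assumes g: "integrable lborel g" and [measurable]: "f \<in> borel_measurable M"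
    and f: "integrable M (\<lambda>z. (norm (f z))\<^sup>2)"
  shows "integrable (lborel \<Otimes>\<^sub>M M) (\<lambda>(t, z). g t * (f z * of_real (X t z)))"
proof -
  have [measurable]: "g \<in> borel_measurable lborel" using g by auto
  define F where "F = (\<integral>\<^sup>+z. ennreal ((norm (f z))\<^sup>2) \<partial>M)"
  have F: "F < \<top>" using f unfolding F_def by (subst nn_integral_eq_integral) auto
  have inner: "(\<integral>\<^sup>+z. ennreal (norm (f z * of_real (X t z))) \<partial>M) \<le> F + ennreal C" for t
  proof -
    have "(\<integral>\<^sup>+z. ennreal (norm (f z * of_real (X t z))) \<partial>M)
        \<le> (\<integral>\<^sup>+z. ennreal ((norm (f z))\<^sup>2) + ennreal ((X t z)\<^sup>2) \<partial>M)"
    proof (rule nn_integral_mono)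
      fix z
      have "2 * (norm (f z) * \<bar>X t z\<bar>) \<le> (norm (f z))\<^sup>2 + (X t z)\<^sup>2"
        using zero_le_power2[of "norm (f z) - \<bar>X t z\<bar>"] unfolding power2_diff by simp
      moreover have "0 \<le> norm (f z) * \<bar>X t z\<bar>" by simp
      ultimately have "norm (f z * of_real (X t z)) \<le> (norm (f z))\<^sup>2 + (X t z)\<^sup>2"
        unfolding norm_mult norm_of_real by linarith
      then show "ennreal (norm (f z * of_real (X t z))) \<le> ennreal ((norm (f z))\<^sup>2) + ennreal ((X t z)\<^sup>2)"
        by (simp add: ennreal_leI flip: ennreal_plus)
    qed
    also have "\<dots> = F + (\<integral>\<^sup>+z. ennreal ((X t z)\<^sup>2) \<partial>M)"
      unfolding F_def by (rule nn_integral_add) auto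
    also have "\<dots> \<le> F + ennreal C" by (intro add_left_mono nn_second_moment)
    finally show ?thesis .
  qed
  have "(\<integral>\<^sup>+x. ennreal (norm ((\<lambda>(t, z). g t * (f z * of_real (X t z))) x)) \<partial>(lborel \<Otimes>\<^sub>M M))
      = (\<integral>\<^sup>+t. \<integral>\<^sup>+z. ennreal (norm (g t)) * ennreal (norm (f z * of_real (X t z))) \<partial>M \<partial>lborel)"
    by (subst nn_integral_fst[symmetric]) (auto simp: norm_mult ennreal_mult)
  also have "\<dots> = (\<integral>\<^sup>+t. ennreal (norm (g t)) * (\<integral>\<^sup>+z. ennreal (norm (f z * of_real (X t z))) \<partial>M) \<partial>lborel)"
    by (intro nn_integral_cong nn_integral_cmult) measurable
  also have "\<dots> \<le> (\<integral>\<^sup>+t. ennreal (norm (g t)) * (F + ennreal C) \<partial>lborel)"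
    by (intro nn_integral_mono mult_left_mono inner) simp
  also have "\<dots> = (\<integral>\<^sup>+t. ennreal (norm (g t)) \<partial>lborel) * (F + ennreal C)"
    by (intro nn_integral_multc) measurable
  also have "\<dots> < \<top>"
    using g F by (auto simp: ennreal_mult_less_top integrable_iff_bounded)
  finally show ?thesis by (intro integrableI_bounded) auto
qed

lemma
  fixes g :: "real \<Rightarrow> 'b::{real_normed_field, banach, second_countable_topology}"
  assumes g: "integrable lborel g"
  defines "Y \<equiv> \<lambda>z. LINT t|lborel. g t * of_real (X t z)"
  shows AE_integrable_path: "AE z in M. integrable lborel (\<lambda>t. g t * of_real (X t z))"
    and path_integral_measurable: "Y \<in> borel_measurable M"
    and path_integral_square_integrable: "integrable M (\<lambda>z. (norm (Y z))\<^sup>2)"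
    and path_integral_fubini: "\<And>f. f \<in> borel_measurable M \<Longrightarrow> integrable M (\<lambda>z. (norm (f z))\<^sup>2) \<Longrightarrow>
      (\<integral>z. f z * Y z \<partial>M) = (LINT t|lborel. g t * (\<integral>z. f z * of_real (X t z) \<partial>M))"
    and path_integral_integrable: "integrable M Y"
    and path_integral_expectation: "(expectation Y) = (LINT t|lborel. g t * (\<integral>z. of_real (X t z) \<partial>M))"
proof -
  interpret P: pair_sigma_finite lborel M by (rule pair_sf)
  have [measurable]: "g \<in> borel_measurable lborel" "g \<in> borel_measurable borel" using g by auto
  have i1: "integrable (lborel \<Otimes>\<^sub>M M) (\<lambda>(t, z). g t * of_real (X t z))"
    using integrable_pair[OF g, of "\<lambda>_. 1"] by simp
  show "AE z in M. integrable lborel (\<lambda>t. g t * of_real (X t z))"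
    using P.AE_integrable_snd[OF i1] by simp
  show Ym[measurable]: "Y \<in> borel_measurable M" unfolding Y_def by measurable
  show iY: "integrable M Y" unfolding Y_def using P.integrable_snd[OF i1] by simp
  show fub: "(\<integral>z. f z * Y z \<partial>M) = (LINT t|lborel. g t * (\<integral>z. f z * of_real (X t z) \<partial>M))"
    if f: "f \<in> borel_measurable M" "integrable M (\<lambda>z. (norm (f z))\<^sup>2)" for f
  proof -
    have "(\<integral>z. f z * Y z \<partial>M) = (\<integral>z. (LINT t|lborel. g t * (f z * of_real (X t z))) \<partial>M)"
      unfolding Y_def by (intro Bochner_Integration.integral_cong refl) (simp flip: integral_mult_right_zero add: ac_simps)
    also have "\<dots> = (LINT t|lborel. (\<integral>z. g t * (f z * of_real (X t z)) \<partial>M))"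
      by (rule P.Fubini_integral) (use integrable_pair[OF g f] in simp)
    finally show ?thesis by simp
  qed
  show "(expectation Y) = (LINT t|lborel. g t * (\<integral>z. of_real (X t z) \<partial>M))"
    using fub[of "\<lambda>_. 1"] by simp
  define c where "c = (\<integral>\<^sup>+t. ennreal (norm (g t)) \<partial>lborel)"
  have c: "c < \<top>" using g by (simp add: c_def integrable_iff_bounded)
  \<comment> \<open>Cauchy-Schwarz with |g X| split into sqrt |g| and sqrt |g| |X|; the first factor
    contributes the L1 norm of g.\<close>
  have "ennreal ((norm (Y z))\<^sup>2) \<le> c * (\<integral>\<^sup>+t. ennreal (norm (g t)) * ennreal ((X t z)\<^sup>2) \<partial>lborel)" if z: "z \<in> space M" for z
  proof -
    have [measurable]: "(\<lambda>t. X t z) \<in> borel_measurable borel"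
      using measurable_compose[OF measurable_Pair2'[OF z] joint] by simp
    have "ennreal (norm (Y z)) \<le> (\<integral>\<^sup>+t. ennreal (norm (g t) * \<bar>X t z\<bar>) \<partial>lborel)"
    \<comment> \<open>On a path where the integrand is not integrable the integral is 0 by
      convention, so the estimate holds for every path.\<close>
    proof (cases "integrable lborel (\<lambda>t. g t * of_real (X t z))")
      case True
      from integral_norm_bound_ennreal[OF this] show ?thesis by (simp add: Y_def norm_mult)
    qed (simp add: Y_def not_integrable_integral_eq)
    then have "ennreal (norm (Y z)) ^ 2 \<le> (\<integral>\<^sup>+t. ennreal (sqrt (norm (g t))) * ennreal (sqrt (norm (g t)) * \<bar>X t z\<bar>) \<partial>lborel) ^ 2"
      by (intro power_mono) (simp_all add: ennreal_mult[symmetric] mult.assoc[symmetric])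
    also have "\<dots> \<le> (\<integral>\<^sup>+t. (ennreal (sqrt (norm (g t))))\<^sup>2 \<partial>lborel) * (\<integral>\<^sup>+t. (ennreal (sqrt (norm (g t)) * \<bar>X t z\<bar>))\<^sup>2 \<partial>lborel)"
      by (rule Cauchy_Schwarz_nn_integral) measurable
    finally show ?thesis
      by (simp add: c_def ennreal_power power_mult_distrib ennreal_mult)
  qed
  then have "(\<integral>\<^sup>+z. ennreal ((norm (Y z))\<^sup>2) \<partial>M) \<le> (\<integral>\<^sup>+z. c * (\<integral>\<^sup>+t. ennreal (norm (g t)) * ennreal ((X t z)\<^sup>2) \<partial>lborel) \<partial>M)"
    by (rule nn_integral_mono)
  also have "\<dots> = c * (\<integral>\<^sup>+z. \<integral>\<^sup>+t. ennreal (norm (g t)) * ennreal ((X t z)\<^sup>2) \<partial>lborel \<partial>M)"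
    by (rule nn_integral_cmult) measurable
  also have "(\<integral>\<^sup>+z. \<integral>\<^sup>+t. ennreal (norm (g t)) * ennreal ((X t z)\<^sup>2) \<partial>lborel \<partial>M)
      = (\<integral>\<^sup>+t. \<integral>\<^sup>+z. ennreal (norm (g t)) * ennreal ((X t z)\<^sup>2) \<partial>M \<partial>lborel)"
    by (rule P.Fubini') measurable
  also have "\<dots> = (\<integral>\<^sup>+t. ennreal (norm (g t)) * (\<integral>\<^sup>+z. ennreal ((X t z)\<^sup>2) \<partial>M) \<partial>lborel)"
    by (intro nn_integral_cong nn_integral_cmult) measurable
  also have "\<dots> \<le> (\<integral>\<^sup>+t. ennreal (norm (g t)) * ennreal C \<partial>lborel)"
    by (intro nn_integral_mono mult_left_mono nn_second_moment) simp
  also have "\<dots> = c * ennreal C" unfolding c_def by (intro nn_integral_multc) measurable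
  finally have "(\<integral>\<^sup>+z. ennreal ((norm (Y z))\<^sup>2) \<partial>M) \<le> c * (c * ennreal C)" by (simp add: mult_left_mono)
  also have "\<dots> < \<top>" using c by (simp add: ennreal_mult_less_top)
  finally show "integrable M (\<lambda>z. (norm (Y z))\<^sup>2)" by (intro integrableI_bounded) auto
qed

end

context second_order_process
begin

definition lin :: "('a \<Rightarrow> real) set" where
  "lin = {L. \<exists>I a. finite I \<and> L = (\<lambda>z. \<Sum>t\<in>I. a t * X t z)}"

lemma lin_zero: "(\<lambda>z. 0) \<in> lin"
  unfolding lin_def by (intro CollectI exI[of _ "{}"]) auto

lemma lin_scale: "L \<in> lin \<Longrightarrow> (\<lambda>z. r * L z) \<in> lin"
  unfolding lin_def
proof (elim CollectE exE conjE)
  fix I a assume "finite I" "L = (\<lambda>z. \<Sum>t\<in>I. a t * X t z)"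
  then show "(\<lambda>z. r * L z) \<in> {L. \<exists>I a. finite I \<and> L = (\<lambda>z. \<Sum>t\<in>I. a t * X t z)}"
    by (intro CollectI exI[of _ I] exI[of _ "\<lambda>t. r * a t"]) (simp add: sum_distrib_left mult.assoc)
qed

lemma lin_add: "L \<in> lin \<Longrightarrow> (\<lambda>z. L z + r * X t z) \<in> lin"
  unfolding lin_def
proof (elim CollectE exE conjE)
  fix I a assume I: "finite I" and L: "L = (\<lambda>z. \<Sum>t\<in>I. a t * X t z)"
  define b where "b s = (if s \<in> I then a s else 0) + (if s = t then r else 0)" for s
  have "L z + r * X t z = (\<Sum>s\<in>insert t I. b s * X s z)" for z
  proof -
    have "(\<Sum>s\<in>insert t I. b s * X s z) =
        (\<Sum>s\<in>insert t I. (if s \<in> I then a s * X s z else 0)) + (\<Sum>s\<in>insert t I. if s = t then r * X s z else 0)"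
      unfolding sum.distrib[symmetric] by (intro sum.cong) (auto simp: b_def distrib_right)
    also have "(\<Sum>s\<in>insert t I. if s = t then r * X s z else 0) = r * X t z" using I by simp
    also have "(\<Sum>s\<in>insert t I. (if s \<in> I then a s * X s z else 0)) = L z"
      unfolding L using I by (intro sum.mono_neutral_cong_right) auto
    finally show ?thesis by simp
  qed
  then show "(\<lambda>z. L z + r * X t z) \<in> {L. \<exists>I a. finite I \<and> L = (\<lambda>z. \<Sum>t\<in>I. a t * X t z)}"
    using I by (intro CollectI exI[of _ "insert t I"] exI[of _ b]) auto
qed

lemma square_integrable_add:
  fixes f g :: "'a \<Rightarrow> real"
  assumes [measurable]: "f \<in> borel_measurable M" "g \<in> borel_measurable M"
    and f: "integrable M (\<lambda>z. (f z)\<^sup>2)" and g: "integrable M (\<lambda>z. (g z)\<^sup>2)"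
  shows "integrable M (\<lambda>z. f z * g z)" "integrable M (\<lambda>z. (f z + g z)\<^sup>2)" "integrable M (\<lambda>z. (f z - g z)\<^sup>2)"
proof -
  show fg: "integrable M (\<lambda>z. f z * g z)"
    by (rule integrable_mult_square_integrable) (use f g in auto)
  have "(\<lambda>z. (f z + g z)\<^sup>2) = (\<lambda>z. (f z)\<^sup>2 + (g z)\<^sup>2 + 2 * (f z * g z))"
    "(\<lambda>z. (f z - g z)\<^sup>2) = (\<lambda>z. (f z)\<^sup>2 + (g z)\<^sup>2 - 2 * (f z * g z))"
    by (auto simp: fun_eq_iff power2_sum power2_diff)
  then show "integrable M (\<lambda>z. (f z + g z)\<^sup>2)" "integrable M (\<lambda>z. (f z - g z)\<^sup>2)"
    using f g fg by auto
qed

lemma lin_square_integrable: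
  assumes "L \<in> lin"
  shows "L \<in> borel_measurable M" "integrable M (\<lambda>z. (L z)\<^sup>2)"
proof -
  obtain I a where I: "finite I" and L: "L = (\<lambda>z. \<Sum>t\<in>I. a t * X t z)" using assms unfolding lin_def by blast
  show "L \<in> borel_measurable M" unfolding L by measurable
  from I show "integrable M (\<lambda>z. (L z)\<^sup>2)" unfolding L
  proof (induction I rule: finite_induct)
    case (insert t I)
    have "integrable M (\<lambda>z. (a t * X t z)\<^sup>2)" using square_integrable[of t] by (simp add: power_mult_distrib)
    then show ?case using insert by (simp add: square_integrable_add(2))
  qed simp
qed

text \<open>Greedy sampling: averaging \<open>sgn (g t) * X t\<close> against the weight \<open>\<bar>g t\<bar>\<close> gives back the
  path integral, so some sample point makes the error grow by no more than orthogonality would.\<close>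

lemma path_integral_sample:
  fixes g :: "real \<Rightarrow> real"
  assumes g: "integrable lborel g" and c: "(LINT t|lborel. \<bar>g t\<bar>) > 0"
    and f: "f \<in> borel_measurable M" "integrable M (\<lambda>z. (f z)\<^sup>2)"
  shows "\<exists>t. (\<integral>z. f z * (LINT t|lborel. g t * X t z) \<partial>M)
    \<le> (LINT t|lborel. \<bar>g t\<bar>) * sgn (g t) * (\<integral>z. f z * X t z \<partial>M)"
proof (rule ccontr)
  define c where "c = (LINT t|lborel. \<bar>g t\<bar>)"
  define E where "E = (\<integral>z. f z * (LINT t|lborel. g t * X t z) \<partial>M)"
  \<comment> \<open>\<open>h t\<close> is the amount by which the claim fails at t. If it were
    positive for all t, its integral against |g| would be positive, yet |g| * sgn g = g makes that
    integral E c - c E = 0.\<close>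
  define h where "h t = E - c * sgn (g t) * (\<integral>z. f z * X t z \<partial>M)" for t
  assume "\<not> ?thesis"
  then have h: "0 < h t" for t unfolding h_def E_def c_def by (simp add: not_le)
  have E: "E = (LINT t|lborel. g t * (\<integral>z. f z * X t z \<partial>M))"
    unfolding E_def using path_integral_fubini[OF g, of f] f by simp
  have ig: "integrable lborel (\<lambda>t. g t * (\<integral>z. f z * X t z \<partial>M))"
  proof -
    interpret P: pair_sigma_finite lborel M by (rule pair_sf)
    show ?thesis using P.integrable_fst'[OF integrable_pair[OF g f(1)]] f(2) by simp
  qed
  have eq: "\<bar>g t\<bar> * h t = E * \<bar>g t\<bar> - c * (g t * (\<integral>z. f z * X t z \<partial>M))" for t
    by (auto simp: h_def algebra_simps abs_sgn)
  have i: "integrable lborel (\<lambda>t. \<bar>g t\<bar> * h t)"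
    unfolding eq using g ig by simp
  have "(LINT t|lborel. \<bar>g t\<bar> * h t) = E * c - c * E"
    unfolding eq using g ig by (simp add: c_def E)
  then have "AE t in lborel. \<bar>g t\<bar> * h t = 0"
    using integral_nonneg_eq_0_iff_AE[OF i] h by (simp add: less_imp_le)
  then have "AE t in lborel. \<bar>g t\<bar> = 0"
    by eventually_elim (use h in \<open>auto simp: less_le\<close>)
  then have "c = 0" unfolding c_def by (rule integral_eq_zero_AE)
  with c show False by (simp add: c_def)
qed

text \<open>Random sampling made deterministic, one point at a time. With e the present error and f
  = e + Y, the chosen t bounds the new squared error by E f^2 - 2 E (f Y) + c^2 C, which equals E
  e^2 - E Y^2 + c^2 C. The growth is thus at most linear in n, and dividing the sum by n leaves a
  mean-square error of order 1 / n.\<close>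

lemma path_integral_greedy:
  fixes g :: "real \<Rightarrow> real"
  assumes g: "integrable lborel g"
  defines "c \<equiv> LINT t|lborel. \<bar>g t\<bar>" and "Y \<equiv> \<lambda>z. LINT t|lborel. g t * X t z"
  shows "\<exists>L\<in>lin. (\<integral>z. (real n * Y z - L z)\<^sup>2 \<partial>M) \<le> real n * (c\<^sup>2 * C)"
proof (cases "c > 0")
  case False
  then have "c = 0" by (simp add: c_def not_less antisym)
  then have "AE t in lborel. \<bar>g t\<bar> = 0"
    unfolding c_def by (subst (asm) integral_nonneg_eq_0_iff_AE) (use g in auto)
  then have "Y z = 0" for z unfolding Y_def by (intro integral_eq_zero_AE) auto
  then show ?thesis using \<open>c = 0\<close> by (intro bexI[OF _ lin_zero]) simp
next
  case True
  have Y: "Y \<in> borel_measurable M" "integrable M (\<lambda>z. (Y z)\<^sup>2)"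
    using path_integral_measurable[OF g] path_integral_square_integrable[OF g] by (simp_all add: Y_def)
  show ?thesis
  proof (induction n)
    case 0
    then show ?case by (intro bexI[OF _ lin_zero]) simp
  next
    case (Suc n)
    then obtain L where L: "L \<in> lin" "(\<integral>z. (real n * Y z - L z)\<^sup>2 \<partial>M) \<le> real n * (c\<^sup>2 * C)" by blast
    note Lm = lin_square_integrable[OF L(1)]
    define e where "e z = real n * Y z - L z" for z
    define f where "f z = e z + Y z" for z
    have e: "e \<in> borel_measurable M" "integrable M (\<lambda>z. (e z)\<^sup>2)"
    proof -
      have nY: "integrable M (\<lambda>z. (real n * Y z)\<^sup>2)" using Y(2) by (simp add: power_mult_distrib)
      show "e \<in> borel_measurable M" unfolding e_def using Y(1) Lm(1) by simp
      show "integrable M (\<lambda>z. (e z)\<^sup>2)"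
        unfolding e_def by (rule square_integrable_add(3)) (use Y(1) Lm nY in auto)
    qed
    have f: "f \<in> borel_measurable M" "integrable M (\<lambda>z. (f z)\<^sup>2)"
      unfolding f_def using e Y by (auto intro: square_integrable_add)
    obtain t where t: "(\<integral>z. f z * Y z \<partial>M) \<le> c * sgn (g t) * (\<integral>z. f z * X t z \<partial>M)"
      using path_integral_sample[OF g _ f] True unfolding c_def Y_def by blast
    define r where "r = c * sgn (g t)"
    have r2: "r\<^sup>2 \<le> c\<^sup>2" by (simp add: r_def power_mult_distrib sgn_if)
    define L' where "L' z = L z + r * X t z" for z
    have L': "L' \<in> lin" unfolding L'_def[abs_def] by (rule lin_add[OF L(1)])
    have fX: "integrable M (\<lambda>z. f z * X t z)" and eY: "integrable M (\<lambda>z. e z * Y z)"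
      using f e Y square_integrable[of t] by (auto intro: square_integrable_add)
    have YY: "integrable M (\<lambda>z. Y z * Y z)" using Y(2) by (simp add: power2_eq_square)
    have "(\<integral>z. (real (Suc n) * Y z - L' z)\<^sup>2 \<partial>M) = (\<integral>z. (f z)\<^sup>2 - 2 * r * (f z * X t z) + r\<^sup>2 * (X t z)\<^sup>2 \<partial>M)"
      by (intro Bochner_Integration.integral_cong refl) (simp add: f_def e_def L'_def power2_eq_square algebra_simps)
    also have "\<dots> = (\<integral>z. (f z)\<^sup>2 \<partial>M) - 2 * r * (\<integral>z. f z * X t z \<partial>M) + r\<^sup>2 * (\<integral>z. (X t z)\<^sup>2 \<partial>M)"
      using f(2) fX square_integrable[of t] by simp
    also have "\<dots> \<le> (\<integral>z. (f z)\<^sup>2 \<partial>M) - 2 * (\<integral>z. f z * Y z \<partial>M) + c\<^sup>2 * C"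
      using t mult_mono[OF r2 second_moment_le[of t]] by (auto simp: r_def mult.assoc)
    also have "(\<integral>z. (f z)\<^sup>2 \<partial>M) - 2 * (\<integral>z. f z * Y z \<partial>M) = (\<integral>z. (e z)\<^sup>2 \<partial>M) - (\<integral>z. (Y z)\<^sup>2 \<partial>M)"
    proof -
      have "(\<integral>z. (f z)\<^sup>2 \<partial>M) = (\<integral>z. (e z)\<^sup>2 + 2 * (e z * Y z) + (Y z)\<^sup>2 \<partial>M)"
        by (intro Bochner_Integration.integral_cong refl) (simp add: f_def power2_eq_square algebra_simps)
      also have "\<dots> = (\<integral>z. (e z)\<^sup>2 \<partial>M) + 2 * (\<integral>z. e z * Y z \<partial>M) + (\<integral>z. (Y z)\<^sup>2 \<partial>M)"
        using e(2) eY Y(2) by simp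
      moreover have "(\<integral>z. f z * Y z \<partial>M) = (\<integral>z. e z * Y z + (Y z)\<^sup>2 \<partial>M)"
        by (intro Bochner_Integration.integral_cong refl) (simp add: f_def power2_eq_square algebra_simps)
      moreover have "(\<integral>z. e z * Y z + (Y z)\<^sup>2 \<partial>M) = (\<integral>z. e z * Y z \<partial>M) + (\<integral>z. (Y z)\<^sup>2 \<partial>M)"
        using eY Y(2) by simp
      ultimately show ?thesis by simp
    qed
    also have "\<dots> + c\<^sup>2 * C \<le> real n * (c\<^sup>2 * C) + c\<^sup>2 * C"
    proof -
      have "0 \<le> (\<integral>z. (Y z)\<^sup>2 \<partial>M)" by simp
      then show ?thesis using L(2) unfolding e_def by linarith
    qed
    finally show ?case by (intro bexI[OF _ L']) (simp add: algebra_simps)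
  qed
qed

lemma path_integral_approx:
  fixes g :: "real \<Rightarrow> real"
  assumes g: "integrable lborel g"
  obtains L :: "nat \<Rightarrow> 'a \<Rightarrow> real" where "\<And>n. L n \<in> lin"
    "(\<lambda>n. \<integral>z. ((LINT t|lborel. g t * X t z) - L n z)\<^sup>2 \<partial>M) \<longlonglongrightarrow> 0"
proof -
  define c where "c = (LINT t|lborel. \<bar>g t\<bar>)"
  define Y where "Y z = (LINT t|lborel. g t * X t z)" for z
  have "\<exists>L\<in>lin. (\<integral>z. (Y z - L z)\<^sup>2 \<partial>M) \<le> (c\<^sup>2 * C) / real (Suc n)" for n
  proof -
    obtain L where L: "L \<in> lin" "(\<integral>z. (real (Suc n) * Y z - L z)\<^sup>2 \<partial>M) \<le> real (Suc n) * (c\<^sup>2 * C)"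
      using path_integral_greedy[OF g, of "Suc n"] unfolding Y_def c_def by blast
    have "(\<integral>z. (Y z - (1 / real (Suc n)) * L z)\<^sup>2 \<partial>M) = (\<integral>z. (1 / real (Suc n))\<^sup>2 * (real (Suc n) * Y z - L z)\<^sup>2 \<partial>M)"
      unfolding power_mult_distrib[symmetric]
      by (intro Bochner_Integration.integral_cong refl) (simp add: right_diff_distrib del: of_nat_Suc)
    also have "\<dots> \<le> (1 / real (Suc n))\<^sup>2 * (real (Suc n) * (c\<^sup>2 * C))"
      using L(2) by (simp only: integral_mult_right_zero) (rule mult_left_mono, auto)
    also have "\<dots> = (c\<^sup>2 * C) / real (Suc n)" by (simp add: power2_eq_square del: of_nat_Suc)
    finally show ?thesis by (intro bexI[OF _ lin_scale[OF L(1)]])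
  qed
  then obtain L where L: "\<And>n. L n \<in> lin" "\<And>n. (\<integral>z. (Y z - L n z)\<^sup>2 \<partial>M) \<le> (c\<^sup>2 * C) / real (Suc n)" by metis
  have lim0: "(\<lambda>n. (c\<^sup>2 * C) / real (Suc n)) \<longlonglongrightarrow> 0" by real_asymp
  have "(\<lambda>n. \<integral>z. (Y z - L n z)\<^sup>2 \<partial>M) \<longlonglongrightarrow> 0"
    by (rule tendsto_sandwich[OF _ _ tendsto_const lim0]) (use L(2) in auto)
  then show thesis using that L(1) unfolding Y_def by blast
qed

end

section \<open>Normal characteristic functions under mean-square limits\<close>

context prob_space
begin

text \<open>The normal characteristic function is recorded at the argument 1 only, with arbitrary
  mean and with variance 0 allowed. In this form the property passes to mean-square limits; other
  arguments are reached by scaling the variable.\<close>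

definition gaussian_char :: "('a \<Rightarrow> real) \<Rightarrow> bool" where
  "gaussian_char Y \<longleftrightarrow> Y \<in> borel_measurable M \<and> integrable M (\<lambda>z. (Y z)\<^sup>2) \<and>
     (\<integral>z. iexp (Y z) \<partial>M) =
       iexp (expectation Y) * of_real (exp (- ((\<integral>z. (Y z)\<^sup>2 \<partial>M) - (expectation Y)\<^sup>2) / 2))"

lemma gaussian_char_cong_AE:
  assumes Y: "gaussian_char Y" and Z: "Z \<in> borel_measurable M" and YZ: "AE z in M. Y z = Z z"
  shows "gaussian_char Z"
proof -
  have Ym[measurable]: "Y \<in> borel_measurable M" using Y by (simp add: gaussian_char_def)
  note [measurable] = Z
  have e: "(\<integral>z. iexp (Z z) \<partial>M) = (\<integral>z. iexp (Y z) \<partial>M)" "(expectation Z) = (expectation Y)"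
    "(\<integral>z. (Z z)\<^sup>2 \<partial>M) = (\<integral>z. (Y z)\<^sup>2 \<partial>M)"
    using YZ by (auto intro!: integral_cong_AE)
  have "AE z in M. (Y z)\<^sup>2 = (Z z)\<^sup>2" using YZ by eventually_elim simp
  then have "integrable M (\<lambda>z. (Z z)\<^sup>2)"
    using Y by (subst (asm) gaussian_char_def) (auto intro: integrable_cong_AE_imp)
  then show ?thesis using Y Z unfolding gaussian_char_def e by simp
qed

lemma normal_rv_gaussian_char:
  assumes "normal_rv M L"
  shows "gaussian_char L"
proof -
  have Lm[measurable]: "L \<in> borel_measurable M" using assms by (simp add: normal_rv_def)
  consider \<mu> \<sigma> where "\<sigma> > 0" "distributed M lborel L (normal_density \<mu> \<sigma>)" | \<mu> where "AE z in M. L z = \<mu>"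
    using assms unfolding normal_rv_def by blast
  then show ?thesis
  proof cases
    case (1 \<mu> \<sigma>)
    define Z where "Z z = (L z - \<mu>) / \<sigma>" for z
    have Zm[measurable]: "Z \<in> borel_measurable M" unfolding Z_def by measurable
    have "distributed M lborel Z std_normal_density"
      using 1 normal_standard_normal_convert[OF 1(1)] unfolding Z_def by blast
    then have "distr M lborel Z = std_normal_distribution" by (rule distributed_distr_eq_density)
    then have dZ: "distr M borel Z = std_normal_distribution"
      by (subst distr_cong[OF refl, of _ lborel _ Z]) auto
    have charL: "(\<integral>z. iexp (t * (L z - \<mu>)) \<partial>M) = of_real (exp (- (t\<^sup>2 * \<sigma>\<^sup>2) / 2))" for t
    proof -
      have "(\<integral>z. iexp (t * (L z - \<mu>)) \<partial>M) = (\<integral>z. iexp ((t * \<sigma>) * Z z) \<partial>M)"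
        using 1(1) by (simp add: Z_def)
      also have "\<dots> = char (distr M borel Z) (t * \<sigma>)"
        unfolding char_def by (subst integral_distr) auto
      also have "\<dots> = of_real (exp (- (t\<^sup>2 * \<sigma>\<^sup>2) / 2))"
        unfolding dZ char_std_normal_distribution by (simp add: power_mult_distrib)
      finally show ?thesis .
    qed
    have var: "integrable M (\<lambda>z. (L z - \<mu>)\<^sup>2)" "(\<integral>z. (L z - \<mu>)\<^sup>2 \<partial>M) = \<sigma>\<^sup>2"
      by (rule variance_of_gaussian_char[OF _ _ charL]; simp)+
    have iL: "integrable M (\<lambda>z. L z - \<mu>)"
      by (rule square_integrable_imp_integrable[OF _ var(1)]) simp
    then have iL': "integrable M L" using Bochner_Integration.integrable_add[OF iL, of "\<lambda>_. \<mu>"] by simp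
    have EL: "(expectation L) = \<mu>" by (rule normal_distributed_expectation[OF 1])
    have sq: "(L z)\<^sup>2 = (L z - \<mu>)\<^sup>2 + 2 * \<mu> * L z - \<mu>\<^sup>2" for z
      by (simp add: power2_eq_square algebra_simps)
    have i2: "integrable M (\<lambda>z. (L z)\<^sup>2)" unfolding sq using var(1) iL' by simp
    have E2: "(\<integral>z. (L z)\<^sup>2 \<partial>M) - \<mu>\<^sup>2 = \<sigma>\<^sup>2" unfolding sq
      using var iL' EL by (simp add: prob_space power2_eq_square)
    have "(\<integral>z. iexp (L z) \<partial>M) = (\<integral>z. iexp \<mu> * iexp (1 * (L z - \<mu>)) \<partial>M)"
      by (intro Bochner_Integration.integral_cong refl) (simp add: exp_add[symmetric] algebra_simps)
    also have "\<dots> = iexp \<mu> * of_real (exp (- \<sigma>\<^sup>2 / 2))"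
      using charL[of 1] by (simp only: integral_mult_right_zero) simp
    finally show ?thesis unfolding gaussian_char_def EL E2 using i2 by simp
  next
    case (2 \<mu>)
    have e: "(\<integral>z. iexp (L z) \<partial>M) = (\<integral>z. iexp \<mu> \<partial>M)" "(expectation L) = (\<integral>z. \<mu> \<partial>M)"
      "(\<integral>z. (L z)\<^sup>2 \<partial>M) = (\<integral>z. \<mu>\<^sup>2 \<partial>M)"
      by (rule integral_cong_AE; use 2 in auto)+
    have "integrable M (\<lambda>z. (L z)\<^sup>2)"
      by (rule integrable_cong_AE_imp[of _ "\<lambda>_. \<mu>\<^sup>2"]) (use 2 in auto)
    then show ?thesis unfolding gaussian_char_def e by (simp add: prob_space)
  qed
qed

text \<open>Mean-square convergence carries along the mean and the second moment, and also the
  characteristic function, since |iexp x - iexp y| <= |x - y|.\<close>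

lemma gaussian_char_limit:
  assumes L: "\<And>n. gaussian_char (L n)"
    and Ym[measurable]: "Y \<in> borel_measurable M" and Y2: "integrable M (\<lambda>z. (Y z)\<^sup>2)"
    and lim: "(\<lambda>n. \<integral>z. (Y z - L n z)\<^sup>2 \<partial>M) \<longlonglongrightarrow> 0"
  shows "gaussian_char Y"
proof -
  have Lm[measurable]: "L n \<in> borel_measurable M" and L2: "integrable M (\<lambda>z. (L n z)\<^sup>2)" for n
    using L by (auto simp: gaussian_char_def)
  define D where "D n z = Y z - L n z" for n z
  define d where "d n = (\<integral>z. (D n z)\<^sup>2 \<partial>M)" for n
  have [measurable]: "D n \<in> borel_measurable M" for n unfolding D_def by measurable
  have YL: "integrable M (\<lambda>z. Y z * L n z)" for n by (rule integrable_mult_square_integrable) (use Y2 L2 in auto)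
  have D2: "integrable M (\<lambda>z. (D n z)\<^sup>2)" for n
    unfolding D_def power2_diff using Y2 L2[of n] YL[of n] by (simp add: mult.assoc)
  have iY: "integrable M Y" and iL: "integrable M (L n)" and iD: "integrable M (D n)" for n
    by (rule square_integrable_imp_integrable, simp, rule Y2 L2 D2)+
  have YD: "integrable M (\<lambda>z. Y z * D n z)" for n by (rule integrable_mult_square_integrable) (use Y2 D2 in auto)
  have d0: "0 \<le> d n" for n by (simp add: d_def)
  have d_lim: "d \<longlonglongrightarrow> 0" using lim by (simp add: d_def[abs_def] D_def)
  have sd_lim: "(\<lambda>n. sqrt (d n)) \<longlonglongrightarrow> 0" using tendsto_real_sqrt[OF d_lim] by simp
  have absD: "(\<integral>z. \<bar>D n z\<bar> \<partial>M) \<le> sqrt (d n)" for n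
  proof -
    have "0 \<le> variance (\<lambda>z. \<bar>D n z\<bar>)" by (rule variance_positive)
    also have "\<dots> = (\<integral>z. \<bar>D n z\<bar>\<^sup>2 \<partial>M) - (\<integral>z. \<bar>D n z\<bar> \<partial>M)\<^sup>2"
      using iD D2 by (intro variance_eq) auto
    finally have "(\<integral>z. \<bar>D n z\<bar> \<partial>M)\<^sup>2 \<le> d n" by (simp add: d_def)
    then show ?thesis by (rule real_le_rsqrt)
  qed
  have ED_lim: "(\<lambda>n. \<integral>z. D n z \<partial>M) \<longlonglongrightarrow> 0"
  proof (rule Lim_null_comparison[OF _ sd_lim], rule always_eventually, rule allI)
    fix n show "norm (expectation (D n)) \<le> sqrt (d n)"
      unfolding real_norm_def by (rule order_trans[OF integral_abs_bound absD])
  qed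
  have EL_lim: "(\<lambda>n. \<integral>z. L n z \<partial>M) \<longlonglongrightarrow> (expectation Y)"
  proof -
    have "(expectation (L n)) = (expectation Y) - (expectation (D n))" for n
      unfolding D_def using iY iL by simp
    then show ?thesis using tendsto_diff[OF tendsto_const ED_lim, of "\<integral>z. Y z \<partial>M"] by simp
  qed
  have EYD: "(\<lambda>n. \<integral>z. Y z * D n z \<partial>M) \<longlonglongrightarrow> 0"
  proof (rule Lim_null_comparison)
    define A where "A = (\<integral>z. (Y z)\<^sup>2 \<partial>M)"
    show "\<forall>\<^sub>F n in sequentially. norm (\<integral>z. Y z * D n z \<partial>M) \<le> (sqrt (d n) + 1 / real (Suc n)) * A + sqrt (d n)"
    proof (rule always_eventually, rule allI)
      fix n
      \<comment> \<open>The weight in |Y D| <= e Y^2 + D^2 / e. With e close to sqrt (d n) both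
        terms tend to 0 in mean; the summand 1 / (n + 1) keeps e positive when d n = 0.\<close>
      define e where "e = sqrt (d n) + 1 / real (Suc n)"
      have sd: "0 \<le> sqrt (d n)" using d0 by simp
      have e: "0 < e" "sqrt (d n) \<le> e" unfolding e_def using sd by (auto intro: add_nonneg_pos)
      have "norm (\<integral>z. Y z * D n z \<partial>M) \<le> (\<integral>z. \<bar>Y z * D n z\<bar> \<partial>M)" by simp
      also have "\<dots> \<le> (\<integral>z. e * (Y z)\<^sup>2 + (1 / e) * (D n z)\<^sup>2 \<partial>M)"
      proof (rule integral_mono)
        fix z
        have "0 \<le> (sqrt e * \<bar>Y z\<bar> - (1 / sqrt e) * \<bar>D n z\<bar>)\<^sup>2" by simp
        also have "\<dots> = e * (Y z)\<^sup>2 + (1 / e) * (D n z)\<^sup>2 - 2 * \<bar>Y z * D n z\<bar>"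
          using e by (simp add: power2_diff power_mult_distrib power_divide abs_mult)
        finally show "\<bar>Y z * D n z\<bar> \<le> e * (Y z)\<^sup>2 + (1 / e) * (D n z)\<^sup>2"
          using abs_ge_zero[of "Y z * D n z"] by linarith
      qed (use YD Y2 D2 in auto)
      also have "\<dots> = e * A + (1 / e) * d n" using Y2 D2 by (simp add: A_def d_def)
      also have "(1 / e) * d n \<le> sqrt (d n)"
      proof -
        have "d n = sqrt (d n) * sqrt (d n)" using d0 by simp
        also have "\<dots> \<le> sqrt (d n) * e" using e sd by (intro mult_left_mono)
        finally show ?thesis using e by (simp add: divide_simps)
      qed
      finally show "norm (\<integral>z. Y z * D n z \<partial>M) \<le> (sqrt (d n) + 1 / real (Suc n)) * A + sqrt (d n)"
        by (simp add: e_def)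
    qed
    have "(\<lambda>n. (sqrt (d n) + 1 / real (Suc n)) * A + sqrt (d n)) \<longlonglongrightarrow> (0 + 0) * A + 0"
      by (intro tendsto_intros sd_lim LIMSEQ_Suc[OF lim_1_over_n])
    then show "(\<lambda>n. (sqrt (d n) + 1 / real (Suc n)) * A + sqrt (d n)) \<longlonglongrightarrow> 0" by simp
  qed
  have EL2_lim: "(\<lambda>n. \<integral>z. (L n z)\<^sup>2 \<partial>M) \<longlonglongrightarrow> (\<integral>z. (Y z)\<^sup>2 \<partial>M)"
  proof -
    have "(\<integral>z. (L n z)\<^sup>2 \<partial>M) = (\<integral>z. (Y z)\<^sup>2 \<partial>M) - 2 * (\<integral>z. Y z * D n z \<partial>M) + d n" for n
    proof -
      have "(\<integral>z. (L n z)\<^sup>2 \<partial>M) = (\<integral>z. (Y z)\<^sup>2 - 2 * (Y z * D n z) + (D n z)\<^sup>2 \<partial>M)"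
        by (intro Bochner_Integration.integral_cong refl) (simp add: D_def power2_eq_square algebra_simps)
      then show ?thesis using Y2 YD D2 by (simp add: d_def)
    qed
    moreover have "(\<lambda>n. (\<integral>z. (Y z)\<^sup>2 \<partial>M) - 2 * (\<integral>z. Y z * D n z \<partial>M) + d n) \<longlonglongrightarrow> (\<integral>z. (Y z)\<^sup>2 \<partial>M) - 2 * 0 + 0"
      by (intro tendsto_intros EYD d_lim)
    ultimately show ?thesis by simp
  qed
  have char_lim: "(\<lambda>n. \<integral>z. iexp (L n z) \<partial>M) \<longlonglongrightarrow> (\<integral>z. iexp (Y z) \<partial>M)"
  proof -
    have ie: "integrable M (\<lambda>z. iexp (f z))" if "f \<in> borel_measurable M" for f
      using integrable_iexp_mult[OF that, of "\<lambda>_. 1"] by simp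
    have "(\<lambda>n. (\<integral>z. iexp (L n z) \<partial>M) - (\<integral>z. iexp (Y z) \<partial>M)) \<longlonglongrightarrow> 0"
    proof (rule Lim_null_comparison[OF _ sd_lim], rule always_eventually, rule allI)
      fix n
      have "norm ((\<integral>z. iexp (L n z) \<partial>M) - (\<integral>z. iexp (Y z) \<partial>M)) = norm (\<integral>z. iexp (L n z) - iexp (Y z) \<partial>M)"
        by (simp add: ie)
      also have "\<dots> \<le> (\<integral>z. norm (iexp (L n z) - iexp (Y z)) \<partial>M)" by (rule integral_norm_bound)
      also have "\<dots> \<le> (\<integral>z. \<bar>D n z\<bar> \<partial>M)"
      proof (rule integral_mono)
        show "integrable M (\<lambda>z. norm (iexp (L n z) - iexp (Y z)))" by (simp add: ie)
        fix z
        have "iexp (L n z) - iexp (Y z) = iexp (L n z) * (1 - iexp (D n z))"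
          by (simp add: D_def right_diff_distrib exp_add[symmetric])
        then have "norm (iexp (L n z) - iexp (Y z)) = norm (iexp (D n z) - 1)"
          by (simp add: norm_mult norm_minus_commute)
        also have "\<dots> \<le> \<bar>D n z\<bar>" using iexp_approx1[of "D n z" 0] by simp
        finally show "norm (iexp (L n z) - iexp (Y z)) \<le> \<bar>D n z\<bar>" .
      qed (use iD in auto)
      finally show "norm ((\<integral>z. iexp (L n z) \<partial>M) - (\<integral>z. iexp (Y z) \<partial>M)) \<le> sqrt (d n)"
        using absD[of n] by simp
    qed
    then show ?thesis by (simp add: LIM_zero_iff)
  qed
  have "(\<lambda>n. \<integral>z. iexp (L n z) \<partial>M) \<longlonglongrightarrow>
      iexp (expectation Y) * of_real (exp (- ((\<integral>z. (Y z)\<^sup>2 \<partial>M) - (expectation Y)\<^sup>2) / 2))"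
  proof -
    have "(\<integral>z. iexp (L n z) \<partial>M) =
       iexp (expectation (L n)) * of_real (exp (- ((\<integral>z. (L n z)\<^sup>2 \<partial>M) - (expectation (L n))\<^sup>2) / 2))" for n
      using L[of n] by (simp add: gaussian_char_def)
    then show ?thesis by (auto intro!: tendsto_intros EL_lim EL2_lim)
  qed
  from LIMSEQ_unique[OF char_lim this] show ?thesis
    using Ym Y2 by (simp add: gaussian_char_def)
qed

end

lemma (in second_order_process) gaussian_char_path_integral:
  fixes g :: "real \<Rightarrow> real"
  assumes g: "integrable lborel g" and lin: "\<And>L. L \<in> lin \<Longrightarrow> gaussian_char L"
  shows "gaussian_char (\<lambda>z. LINT t|lborel. g t * X t z)"
proof -
  obtain L :: "nat \<Rightarrow> 'a \<Rightarrow> real" where L: "\<And>n. L n \<in> lin"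
    "(\<lambda>n. \<integral>z. ((LINT t|lborel. g t * X t z) - L n z)\<^sup>2 \<partial>M) \<longlonglongrightarrow> 0"
    using path_integral_approx[OF g] by blast
  show ?thesis
    by (rule gaussian_char_limit[OF lin[OF L(1)] _ _ L(2)])
      (use path_integral_measurable[OF g] path_integral_square_integrable[OF g] in simp_all)
qed

section \<open>Spectral representation of the wavelet transform\<close>

lemma fourier_measurable [measurable]:
  assumes [measurable]: "g \<in> borel_measurable borel"
  shows "fourier g \<in> borel_measurable borel"
  unfolding fourier_def[abs_def] by measurable

lemma norm_fourier_le: "cmod (fourier g l) \<le> (LINT t|lborel. cmod (g t))"
proof -
  have "cmod (fourier g l) \<le> (LINT t|lborel. cmod (iexp (- (t * l)) * g t))"
    unfolding fourier_def by (rule integral_norm_bound)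
  then show ?thesis by (simp add: norm_mult)
qed

lemma fourier_0: "fourier g 0 = (LINT t|lborel. g t)"
  by (simp add: fourier_def)

lemma fourier_cnj: "fourier (\<lambda>t. cnj (g t)) l = cnj (fourier g (- l))"
  unfolding fourier_def by (simp flip: Bochner_Integration.integral_cnj add: exp_cnj)

text \<open>The multiplication formula for the Fourier transform. It is used with r = 1 and with r =
  -1, because the covariance kernel oscillates with opposite signs in its two time
  arguments.\<close>

lemma fourier_swap:
  assumes g: "integrable lborel g" and q: "integrable lborel q"
  shows "integrable lborel (\<lambda>t. g t * (LINT l|lborel. iexp (- (t * (r * l))) * q l))"
    and "(LINT t|lborel. g t * (LINT l|lborel. iexp (- (t * (r * l))) * q l)) = (LINT l|lborel. fourier g (r * l) * q l)"
proof -
  have [measurable]: "g \<in> borel_measurable lborel" "q \<in> borel_measurable lborel" using g q by auto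
  have i: "integrable (lborel \<Otimes>\<^sub>M lborel) (\<lambda>(t, l). g t * (iexp (- (t * (r * l))) * q l))"
  proof (rule lborel_pair.Fubini_integrable)
    show "integrable lborel (\<lambda>t. LINT l|lborel. norm (case (t, l) of (t, l) \<Rightarrow> g t * (iexp (- (t * (r * l))) * q l)))"
      using g by (simp add: norm_mult)
    show "AE t in lborel. integrable lborel (\<lambda>l. case (t, l) of (t, l) \<Rightarrow> g t * (iexp (- (t * (r * l))) * q l))"
    proof (rule AE_I2)
      fix t
      have "integrable lborel (\<lambda>l. iexp (- (t * (r * l))) * q l)"
        by (rule Bochner_Integration.integrable_bound[OF q]) (auto simp: norm_mult)
      then show "integrable lborel (\<lambda>l. case (t, l) of (t, l) \<Rightarrow> g t * (iexp (- (t * (r * l))) * q l))" by simp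
    qed
  qed measurable
  show "integrable lborel (\<lambda>t. g t * (LINT l|lborel. iexp (- (t * (r * l))) * q l))"
    using lborel_pair.integrable_fst'[OF i] by simp
  have "(LINT t|lborel. g t * (LINT l|lborel. iexp (- (t * (r * l))) * q l))
      = (LINT t|lborel. LINT l|lborel. g t * (iexp (- (t * (r * l))) * q l))" by simp
  also have "\<dots> = (LINT l|lborel. LINT t|lborel. g t * (iexp (- (t * (r * l))) * q l))"
    by (rule lborel_pair.Fubini_integral[symmetric, OF i])
  also have "\<dots> = (LINT l|lborel. fourier g (r * l) * q l)"
  proof (intro Bochner_Integration.integral_cong refl)
    fix l
    have "(LINT t|lborel. g t * (iexp (- (t * (r * l))) * q l)) = (LINT t|lborel. (iexp (- (t * (r * l))) * g t) * q l)"
      by (simp add: ac_simps)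
    then show "(LINT t|lborel. g t * (iexp (- (t * (r * l))) * q l)) = fourier g (r * l) * q l"
      by (simp add: fourier_def)
  qed
  finally show "(LINT t|lborel. g t * (LINT l|lborel. iexp (- (t * (r * l))) * q l)) = (LINT l|lborel. fourier g (r * l) * q l)" .
qed

text \<open>The noise conditions prescribe covariances and leave the mean free, so the product
  moments carry the square of the mean next to the spectral integral.\<close>

locale spectral_process = second_order_process +
  fixes p :: "real \<Rightarrow> real" and \<mu> :: real
  assumes p_nonneg: "0 \<le> p l" and p_integrable: "integrable lborel p"
    and mean: "(\<integral>z. X t z \<partial>M) = \<mu>"
    and moment: "complex_of_real (\<integral>z. X s z * X t z \<partial>M) = (LINT l|lborel. iexp ((s - t) * l) * of_real (p l)) + of_real (\<mu>\<^sup>2)"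
    and gaussian_lin: "L \<in> lin \<Longrightarrow> gaussian_char L"
begin

text \<open>The kernel iexp ((s - t) * l) splits into one factor for each time, and two applications
  of \<open>fourier_swap\<close> produce the transforms at l and at -l. The identity is bilinear,
  without conjugation, so that E (Y Y) and E |Y|^2 are both instances of it.\<close>

lemma product_moment:
  fixes g h :: "real \<Rightarrow> complex"
  assumes g: "integrable lborel g" and h: "integrable lborel h"
  shows "(\<integral>z. (LINT t|lborel. g t * of_real (X t z)) * (LINT t|lborel. h t * of_real (X t z)) \<partial>M)
    = (LINT l|lborel. fourier g l * fourier h (- l) * of_real (p l)) + of_real (\<mu>\<^sup>2) * fourier g 0 * fourier h 0"
proof -
  define Yh where "Yh z = (LINT t|lborel. h t * of_real (X t z))" for z
  have Yh: "Yh \<in> borel_measurable M" "integrable M (\<lambda>z. (norm (Yh z))\<^sup>2)"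
    using path_integral_measurable[OF h] path_integral_square_integrable[OF h] by (simp_all add: Yh_def[abs_def])
  have [measurable]: "h \<in> borel_measurable borel" "p \<in> borel_measurable borel" using h p_integrable by auto
  have pt: "integrable lborel (\<lambda>l. iexp (- (t * l)) * complex_of_real (p l))" for t
    by (rule Bochner_Integration.integrable_bound[OF p_integrable]) (auto simp: norm_mult)
  have q: "integrable lborel (\<lambda>l. fourier h (- l) * complex_of_real (p l))"
  proof (rule Bochner_Integration.integrable_bound)
    show "integrable lborel (\<lambda>l. (LINT t|lborel. cmod (h t)) * p l)" using p_integrable by simp
    show "AE l in lborel. norm (fourier h (- l) * complex_of_real (p l)) \<le> norm ((LINT t|lborel. cmod (h t)) * p l)"
      using norm_fourier_le[of h] p_nonneg by (auto simp: norm_mult abs_mult intro!: mult_right_mono order_trans[OF norm_fourier_le])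
  qed measurable
  have inner: "(\<integral>z. Yh z * of_real (X t z) \<partial>M)
      = (LINT l|lborel. iexp (- (t * (1 * l))) * (fourier h (- l) * of_real (p l))) + of_real (\<mu>\<^sup>2) * fourier h 0" for t
  proof -
    have "(\<integral>z. Yh z * of_real (X t z) \<partial>M) = (\<integral>z. of_real (X t z) * Yh z \<partial>M)" by (simp add: mult.commute)
    also have "\<dots> = (LINT s|lborel. h s * (\<integral>z. complex_of_real (X t z) * of_real (X s z) \<partial>M))"
      unfolding Yh_def by (rule path_integral_fubini[OF h]) (use square_integrable[of t] in auto)
    also have "\<dots> = (LINT s|lborel. h s * (LINT l|lborel. iexp (- (s * (-1 * l))) * (iexp (- (t * l)) * of_real (p l))) + of_real (\<mu>\<^sup>2) * h s)"
    proof (intro Bochner_Integration.integral_cong refl)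
      fix s
      have "(\<integral>z. complex_of_real (X t z) * of_real (X s z) \<partial>M) = complex_of_real (\<integral>z. X s z * X t z \<partial>M)"
        by (simp flip: integral_complex_of_real add: mult.commute)
      also have "\<dots> = (LINT l|lborel. iexp ((s - t) * l) * of_real (p l)) + of_real (\<mu>\<^sup>2)" by (rule moment)
      also have "(\<lambda>l. iexp ((s - t) * l) * complex_of_real (p l)) = (\<lambda>l. iexp (- (s * (-1 * l))) * (iexp (- (t * l)) * of_real (p l)))"
      proof
        fix l
        have "iexp ((s - t) * l) = iexp (- (s * (-1 * l))) * iexp (- (t * l))"
          unfolding exp_add[symmetric] by (simp add: algebra_simps)
        then show "iexp ((s - t) * l) * complex_of_real (p l) = iexp (- (s * (-1 * l))) * (iexp (- (t * l)) * of_real (p l))"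
          by (simp only: mult.assoc)
      qed
      finally show "h s * (\<integral>z. complex_of_real (X t z) * of_real (X s z) \<partial>M) =
          h s * (LINT l|lborel. iexp (- (s * (-1 * l))) * (iexp (- (t * l)) * of_real (p l))) + of_real (\<mu>\<^sup>2) * h s"
        by (simp add: distrib_left mult.commute)
    qed
    also have "\<dots> = (LINT l|lborel. fourier h (-1 * l) * (iexp (- (t * l)) * of_real (p l))) + of_real (\<mu>\<^sup>2) * fourier h 0"
    proof -
      have "integrable lborel (\<lambda>s. of_real (\<mu>\<^sup>2) * h s)" using h by simp
      from Bochner_Integration.integral_add[OF fourier_swap(1)[OF h pt[of t], of "-1"] this] show ?thesis
        unfolding fourier_0 fourier_swap(2)[OF h pt] integral_mult_right_zero .
    qed
    finally show ?thesis by (simp add: ac_simps)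
  qed
  have "(\<integral>z. (LINT t|lborel. g t * of_real (X t z)) * Yh z \<partial>M) = (\<integral>z. Yh z * (LINT t|lborel. g t * of_real (X t z)) \<partial>M)"
    by (simp add: mult.commute)
  also have "\<dots> = (LINT t|lborel. g t * (\<integral>z. Yh z * of_real (X t z) \<partial>M))"
    by (rule path_integral_fubini[OF g Yh])
  also have "\<dots> = (LINT t|lborel. g t * (LINT l|lborel. iexp (- (t * (1 * l))) * (fourier h (- l) * of_real (p l))) + (of_real (\<mu>\<^sup>2) * fourier h 0) * g t)"
    unfolding inner by (simp only: distrib_left mult.commute)
  also have "\<dots> = (LINT l|lborel. fourier g (1 * l) * (fourier h (- l) * of_real (p l))) + (of_real (\<mu>\<^sup>2) * fourier h 0) * fourier g 0"
  proof -
    have "integrable lborel (\<lambda>t. (of_real (\<mu>\<^sup>2) * fourier h 0) * g t)" using g by simp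
    from Bochner_Integration.integral_add[OF fourier_swap(1)[OF g q, of 1] this] show ?thesis
      unfolding fourier_0[of g] fourier_swap(2)[OF g q] integral_mult_right_zero .
  qed
  finally show ?thesis by (simp add: Yh_def ac_simps)
qed

text \<open>Of l and -l at least one is nonnegative, so the product of the transforms at l and -l
  vanishes and E (Y Y) = 0. As (Re Y)^2 = Re (Y Y + cnj Y Y) / 2, the real part has half of E |Y|^2
  as second moment. The constant mean contributes only multiples of \<open>fourier f 0\<close>,
  which is 0.\<close>

lemma char_path_integral:
  fixes f :: "real \<Rightarrow> complex"
  assumes f: "integrable lborel f" and one_sided: "\<And>l. 0 \<le> l \<Longrightarrow> fourier f l = 0"
  defines "Y \<equiv> \<lambda>z. LINT t|lborel. f t * of_real (X t z)"
  shows "(\<integral>z. iexp (Re (Y z)) \<partial>M) =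
    complex_of_real (exp (- (LINT l:{0<..}|lborel. (cmod (fourier f (- l)))\<^sup>2 * p l) / 4))"
proof -
  define g where "g t = Re (f t)" for t
  have g: "integrable lborel g" unfolding g_def using f by simp
  define Yr where "Yr z = (LINT t|lborel. g t * X t z)" for z
  have Ym[measurable]: "Y \<in> borel_measurable M" and Y2: "integrable M (\<lambda>z. (norm (Y z))\<^sup>2)"
    using path_integral_measurable[OF f] path_integral_square_integrable[OF f] by (simp_all add: Y_def)
  have gc: "gaussian_char Yr" unfolding Yr_def by (rule gaussian_char_path_integral[OF g gaussian_lin])
  have "AE z in M. Yr z = Re (Y z)"
    using AE_integrable_path[OF f]
  proof eventually_elim
    case (elim z)
    show ?case unfolding Yr_def Y_def g_def using integral_Re[OF elim] by simp
  qed
  then have gcR: "gaussian_char (\<lambda>z. Re (Y z))"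
    by (rule gaussian_char_cong_AE[OF gc, rotated]) simp
  have iY: "integrable M Y" unfolding Y_def by (rule path_integral_integrable[OF f])
  have "(expectation Y) = of_real \<mu> * fourier f 0"
    unfolding Y_def fourier_0 by (subst path_integral_expectation[OF f]) (simp add: mean mult.commute)
  then have "(\<integral>z. Re (Y z) \<partial>M) = 0" using one_sided[of 0] integral_Re[OF iY] by simp
  with gcR have char: "(\<integral>z. iexp (Re (Y z)) \<partial>M) = of_real (exp (- (\<integral>z. (Re (Y z))\<^sup>2 \<partial>M) / 2))"
    by (simp add: gaussian_char_def)
  have cf: "integrable lborel (\<lambda>t. cnj (f t))" using f by simp
  have YY0: "(\<integral>z. Y z * Y z \<partial>M) = 0"
  proof -
    have "fourier f l * fourier f (- l) = 0" for l
      using one_sided[of l] one_sided[of "- l"] by (cases "0 \<le> l") auto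
    then have "(LINT l|lborel. fourier f l * fourier f (- l) * complex_of_real (p l)) = 0"
      by (simp only: mult_zero_left integral_zero)
    then show ?thesis unfolding Y_def product_moment[OF f f] using one_sided[of 0] by simp
  qed
  have YcY: "(\<integral>z. cnj (Y z) * Y z \<partial>M) = of_real (LINT l:{0<..}|lborel. (cmod (fourier f (- l)))\<^sup>2 * p l)"
  proof -
    have "(\<integral>z. cnj (Y z) * Y z \<partial>M) = (\<integral>z. (LINT t|lborel. cnj (f t) * of_real (X t z)) * Y z \<partial>M)"
      unfolding Y_def by (simp flip: Bochner_Integration.integral_cnj)
    also have "\<dots> = (LINT l|lborel. cnj (fourier f (- l)) * fourier f (- l) * of_real (p l))"
      unfolding Y_def product_moment[OF cf f] using one_sided[of 0] by (simp add: fourier_cnj)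
    also have "\<dots> = (LINT l|lborel. complex_of_real (indicator {0<..} l * ((cmod (fourier f (- l)))\<^sup>2 * p l)))"
    proof (intro Bochner_Integration.integral_cong refl)
      fix l
      have "cnj (fourier f (- l)) * fourier f (- l) = of_real ((cmod (fourier f (- l)))\<^sup>2)"
        by (subst complex_norm_square) (simp add: mult.commute)
      then show "cnj (fourier f (- l)) * fourier f (- l) * of_real (p l)
          = complex_of_real (indicator {0<..} l * ((cmod (fourier f (- l)))\<^sup>2 * p l))"
        using one_sided[of "- l"] by (cases "0 < l") auto
    qed
    finally show ?thesis by (simp add: set_lebesgue_integral_def del: of_real_mult)
  qed
  have iYY1: "integrable M (\<lambda>z. Y z * Y z)"
    by (rule Bochner_Integration.integrable_bound[OF Y2]) (auto simp: norm_mult power2_eq_square)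
  have [measurable]: "(\<lambda>z. cnj (Y z)) \<in> borel_measurable M"
    using iY by (intro borel_measurable_integrable) simp
  have iYY2: "integrable M (\<lambda>z. cnj (Y z) * Y z)"
    by (rule Bochner_Integration.integrable_bound[OF Y2]) (auto simp: norm_mult power2_eq_square)
  define A where "A z = Y z * Y z + cnj (Y z) * Y z" for z
  have iA: "integrable M A" unfolding A_def using iYY1 iYY2 by (rule Bochner_Integration.integrable_add)
  have EA: "(expectation A) = of_real (LINT l:{0<..}|lborel. (cmod (fourier f (- l)))\<^sup>2 * p l)"
    unfolding A_def Bochner_Integration.integral_add[OF iYY1 iYY2] YY0 YcY by (rule add_0_left)
  have A: "(Re (Y z))\<^sup>2 = Re (A z) / 2" for z by (simp add: A_def power2_eq_square)
  have "(\<integral>z. (Re (Y z))\<^sup>2 \<partial>M) = Re (expectation A) / 2"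
    unfolding A using integral_Re[OF iA] by simp
  then have "(\<integral>z. (Re (Y z))\<^sup>2 \<partial>M) = (LINT l:{0<..}|lborel. (cmod (fourier f (- l)))\<^sup>2 * p l) / 2"
    unfolding EA by simp
  then show ?thesis unfolding char by simp
qed

end

section \<open>Dilated wavelets, modifications of the noise, and the joint law of the
  transform\<close>

lemma
  assumes \<psi>: "integrable lborel \<psi>" and s: "0 < s"
  shows integrable_dilate: "integrable lborel (\<lambda>t. of_real (1 / s) * cnj (\<psi> (t / s)))"
    and fourier_dilate: "fourier (\<lambda>t. of_real (1 / s) * cnj (\<psi> (t / s))) l = cnj (fourier \<psi> (- (s * l)))"
proof -
  have "integrable lborel (\<lambda>t. cnj (\<psi> (0 + (1 / s) * t)))"
    using lborel_integrable_real_affine[of "\<lambda>t. cnj (\<psi> t)" "1 / s" 0] \<psi> s by simp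
  then show "integrable lborel (\<lambda>t. of_real (1 / s) * cnj (\<psi> (t / s)))" by simp
  have "fourier (\<lambda>t. of_real (1 / s) * cnj (\<psi> (t / s))) l
      = \<bar>s\<bar> *\<^sub>R (LINT t|lborel. iexp (- ((0 + s * t) * l)) * (of_real (1 / s) * cnj (\<psi> ((0 + s * t) / s))))"
    unfolding fourier_def using s by (intro lborel_integral_real_affine) simp
  also have "(\<lambda>t. iexp (- ((0 + s * t) * l)) * (of_real (1 / s) * cnj (\<psi> ((0 + s * t) / s))))
      = (\<lambda>t. of_real (1 / s) * (iexp (- (t * (s * l))) * cnj (\<psi> t)))"
    using s by (simp add: fun_eq_iff ac_simps)
  also have "\<bar>s\<bar> *\<^sub>R (LINT t|lborel. of_real (1 / s) * (iexp (- (t * (s * l))) * cnj (\<psi> t)))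
      = (LINT t|lborel. iexp (- (t * (s * l))) * cnj (\<psi> t))"
    unfolding integral_mult_right_zero using s by (simp add: scaleR_conv_of_real)
  also have "\<dots> = cnj (fourier \<psi> (- (s * l)))"
    by (simp add: fourier_cnj[symmetric]) (simp add: fourier_def)
  finally show "fourier (\<lambda>t. of_real (1 / s) * cnj (\<psi> (t / s))) l = cnj (fourier \<psi> (- (s * l)))" .
qed

lemma stationary_integral:
  fixes F :: "(real \<Rightarrow> real) \<Rightarrow> real"
  assumes "stationary M \<Phi>" and I: "finite I"
    and \<Phi>: "\<And>t. \<Phi> t \<in> borel_measurable M"
    and F: "F \<in> borel_measurable (\<Pi>\<^sub>M t\<in>I. borel)"
  shows "(\<integral>z. F (\<lambda>t\<in>I. \<Phi> (t + h) z) \<partial>M) = (\<integral>z. F (\<lambda>t\<in>I. \<Phi> t z) \<partial>M)"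
proof -
  have m: "(\<lambda>z. \<lambda>t\<in>I. \<Phi> (t + r) z) \<in> M \<rightarrow>\<^sub>M (\<Pi>\<^sub>M t\<in>I. borel)" for r
    by (intro measurable_restrict \<Phi>)
  have "(\<integral>z. F (\<lambda>t\<in>I. \<Phi> (t + h) z) \<partial>M) = (\<integral>x. F x \<partial>distr M (\<Pi>\<^sub>M t\<in>I. borel) (\<lambda>z. \<lambda>t\<in>I. \<Phi> (t + h) z))"
    by (rule integral_distr[OF m F, symmetric])
  also have "distr M (\<Pi>\<^sub>M t\<in>I. borel) (\<lambda>z. \<lambda>t\<in>I. \<Phi> (t + h) z) = distr M (\<Pi>\<^sub>M t\<in>I. borel) (\<lambda>z. \<lambda>t\<in>I. \<Phi> t z)"
    using assms(1) I by (simp add: stationary_def)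
  also have "(\<integral>x. F x \<partial>distr M (\<Pi>\<^sub>M t\<in>I. borel) (\<lambda>z. \<lambda>t\<in>I. \<Phi> t z)) = (\<integral>z. F (\<lambda>t\<in>I. \<Phi> t z) \<partial>M)"
    using integral_distr[OF m[of 0] F] by simp
  finally show ?thesis .
qed

text \<open>The moments and linear combinations in question involve finitely many times each, so
  almost sure equality at every single time transfers their properties from \<Phi> to \<Phi>'.
  Stationarity makes the second moment at time 0 a uniform bound and extends the covariance formula,
  given against time 0, to all pairs of times.\<close>

lemma spectral_process_modification:
  assumes M: "prob_space M" and noise: "stationary_gaussian_noise M \<Phi> p"
    and mod: "measurable_modification M \<Phi> \<Phi>'"
  shows "spectral_process M \<Phi>' (\<integral>z. (\<Phi> 0 z)\<^sup>2 \<partial>M) p (\<integral>z. \<Phi> 0 z \<partial>M)"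
proof -
  interpret prob_space M by (rule M)
  have normal: "normal_rv M (\<lambda>z. \<Sum>t\<in>I. c t * \<Phi> t z)" if "finite I" for I c
    using noise that by (simp add: stationary_gaussian_noise_def gaussian_process_def)
  have st: "stationary M \<Phi>" and sd: "has_spectral_density M \<Phi> p"
    using noise by (simp_all add: stationary_gaussian_noise_def)
  have gc: "gaussian_char (\<Phi> t)" for t
    using normal_rv_gaussian_char[OF normal[of "{t}" "\<lambda>_. 1"]] by simp
  have \<Phi>m[measurable]: "\<Phi> t \<in> borel_measurable M" and \<Phi>2: "integrable M (\<lambda>z. (\<Phi> t z)\<^sup>2)" for t
    using gc by (simp_all add: gaussian_char_def)
  have \<Phi>1: "integrable M (\<Phi> t)" for t
    by (rule square_integrable_imp_integrable[OF \<Phi>m \<Phi>2])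
  have joint[measurable]: "(\<lambda>(t, z). \<Phi>' t z) \<in> borel_measurable (borel \<Otimes>\<^sub>M M)"
    and ae: "AE z in M. \<Phi>' t z = \<Phi> t z" for t
    using mod by (simp_all add: measurable_modification_def)
  have \<Phi>'m[measurable]: "\<Phi>' t \<in> borel_measurable M" for t
    using measurable_compose[OF measurable_Pair1'[of t borel M] joint] by simp
  define \<mu> where "\<mu> = (\<integral>z. \<Phi> 0 z \<partial>M)"
  have mean: "(\<integral>z. \<Phi> t z \<partial>M) = \<mu>" for t
    using stationary_integral[OF st, of "{0}" "\<lambda>x. x 0" t] by (simp add: \<mu>_def)
  have shift: "(\<integral>z. \<Phi> (a + h) z * \<Phi> (b + h) z \<partial>M) = (\<integral>z. \<Phi> a z * \<Phi> b z \<partial>M)" for a b h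
    using stationary_integral[OF st, of "{a, b}" "\<lambda>x. x a * x b" h] by simp
  have moment\<Phi>: "complex_of_real (\<integral>z. \<Phi> s z * \<Phi> t z \<partial>M) = (LINT l|lborel. iexp ((s - t) * l) * of_real (p l)) + of_real (\<mu>\<^sup>2)" for s t
  proof -
    have iprod: "integrable M (\<lambda>z. \<Phi> (s - t) z * \<Phi> 0 z)"
      by (intro integrable_mult_square_integrable \<Phi>m \<Phi>2)
    have "cov M (\<Phi> (s - t)) (\<Phi> 0) = (\<integral>z. \<Phi> (s - t) z * \<Phi> 0 z - \<mu> * \<Phi> (s - t) z - \<mu> * \<Phi> 0 z + \<mu>\<^sup>2 \<partial>M)"
      unfolding cov_def mean
      by (intro Bochner_Integration.integral_cong refl) (simp add: power2_eq_square algebra_simps)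
    also have "\<dots> = (\<integral>z. \<Phi> (s - t) z * \<Phi> 0 z \<partial>M) - \<mu>\<^sup>2"
      using iprod \<Phi>1 by (simp add: mean prob_space power2_eq_square)
    finally have "(\<integral>z. \<Phi> s z * \<Phi> t z \<partial>M) = cov M (\<Phi> (s - t)) (\<Phi> 0) + \<mu>\<^sup>2"
      using shift[of "s - t" t 0] by simp
    then show ?thesis using sd by (simp add: has_spectral_density_def)
  qed
  have sq': "integrable M (\<lambda>z. (\<Phi>' t z)\<^sup>2)" for t
  proof (rule integrable_cong_AE_imp[OF \<Phi>2[of t]])
    show "AE z in M. (\<Phi> t z)\<^sup>2 = (\<Phi>' t z)\<^sup>2" using ae[of t] by eventually_elim simp
  qed simp
  have C: "(\<integral>z. (\<Phi>' t z)\<^sup>2 \<partial>M) \<le> (\<integral>z. (\<Phi> 0 z)\<^sup>2 \<partial>M)" for t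
  proof -
    have "(\<integral>z. (\<Phi>' t z)\<^sup>2 \<partial>M) = (\<integral>z. (\<Phi> t z)\<^sup>2 \<partial>M)"
      by (rule integral_cong_AE) (use ae[of t] in auto)
    also have "\<dots> = (\<integral>z. (\<Phi> 0 z)\<^sup>2 \<partial>M)"
      using shift[of 0 t 0] by (simp add: power2_eq_square)
    finally show ?thesis by simp
  qed
  interpret S: second_order_process M \<Phi>' "\<integral>z. (\<Phi> 0 z)\<^sup>2 \<partial>M"
    by standard (use joint sq' C in auto)
  show ?thesis unfolding \<mu>_def[symmetric]
  proof
    show "0 \<le> p l" for l using sd by (simp add: has_spectral_density_def less_imp_le)
    show "integrable lborel p" using sd by (simp add: has_spectral_density_def)
    show "(\<integral>z. \<Phi>' t z \<partial>M) = \<mu>" for t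
      unfolding mean[of t, symmetric] by (rule integral_cong_AE) (use ae[of t] in auto)
    fix s t
    have "AE z in M. \<Phi>' s z * \<Phi>' t z = \<Phi> s z * \<Phi> t z"
      using ae[of s] ae[of t] by eventually_elim simp
    then have "(\<integral>z. \<Phi>' s z * \<Phi>' t z \<partial>M) = (\<integral>z. \<Phi> s z * \<Phi> t z \<partial>M)"
      by (intro integral_cong_AE) auto
    then show "complex_of_real (\<integral>z. \<Phi>' s z * \<Phi>' t z \<partial>M) = (LINT l|lborel. iexp ((s - t) * l) * of_real (p l)) + of_real (\<mu>\<^sup>2)"
      using moment\<Phi>[of s t] by simp
  next
    fix L assume "L \<in> S.lin"
    then obtain I a where I: "finite I" and L: "L = (\<lambda>z. \<Sum>t\<in>I. a t * \<Phi>' t z)" unfolding S.lin_def by blast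
    show "gaussian_char L"
    proof (rule gaussian_char_cong_AE[OF normal_rv_gaussian_char[OF normal[OF I, of a]]])
      show "L \<in> borel_measurable M" unfolding L by measurable
      have "AE z in M. \<forall>t\<in>I. \<Phi>' t z = \<Phi> t z" using I ae by (intro AE_finite_allI)
      then show "AE z in M. (\<Sum>t\<in>I. a t * \<Phi> t z) = L z" by eventually_elim (simp add: L)
    qed
  qed
qed

text \<open>A combination of values W 0 (s i) is almost surely a single path integral, whose kernel
  \<open>f\<close> is the same combination of dilated conjugated wavelets. Conjugation reflects
  frequencies, so analyticity of \<psi> makes the transform of \<open>f\<close> vanish on the
  nonnegative half-line.\<close>

lemma wavelet_transform_spectral_gaussian:
  assumes M: "prob_space M" and noise: "stationary_gaussian_noise M \<Phi> p"
    and \<psi>: "integrable lborel \<psi>" and analytic: "\<And>l. l \<le> 0 \<Longrightarrow> fourier \<psi> l = 0"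
    and W: "wavelet_transform_version M \<psi> \<Phi> W"
  shows "spectral_gaussian M p {0<..} (W 0) (\<lambda>s l. cnj (fourier \<psi> (s * l)))"
  unfolding spectral_gaussian_def
proof (intro conjI ballI allI impI)
  interpret prob_space M by (rule M)
  show Wm: "W 0 s \<in> borel_measurable M" if "s \<in> {0<..}" for s
    using W that by (simp add: wavelet_transform_version_def)
  fix N :: nat and c :: "nat \<Rightarrow> complex" and s :: "nat \<Rightarrow> real" assume s: "\<forall>i<N. s i \<in> {0<..}"
  obtain \<Phi>' where mod: "measurable_modification M \<Phi> \<Phi>'"
    and WI: "\<And>t s. 0 < s \<Longrightarrow> AE z in M. W t s z = wavelet_integral \<psi> (\<lambda>\<tau>. \<Phi>' \<tau> z) t s"
  proof -
    have "\<exists>\<Phi>'. measurable_modification M \<Phi> \<Phi>' \<and>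
        (\<forall>t. \<forall>s>0. AE z in M. W t s z = wavelet_integral \<psi> (\<lambda>\<tau>. \<Phi>' \<tau> z) t s)"
      using W by (simp add: wavelet_transform_version_def)
    then show ?thesis using that by auto
  qed
  interpret spectral_process M \<Phi>' "\<integral>z. (\<Phi> 0 z)\<^sup>2 \<partial>M" p "\<integral>z. \<Phi> 0 z \<partial>M"
    by (rule spectral_process_modification[OF M noise mod])
  define \<phi> where "\<phi> i t = complex_of_real (1 / s i) * cnj (\<psi> (t / s i))" for i t
  define f where "f t = (\<Sum>i<N. c i * \<phi> i t)" for t
  have \<phi>i: "integrable lborel (\<phi> i)" if "i < N" for i
    unfolding \<phi>_def using integrable_dilate[OF \<psi>, of "s i"] s that by simp
  have f: "integrable lborel f" unfolding f_def using \<phi>i by (intro Bochner_Integration.integrable_sum integrable_mult_right) auto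
  have ff: "fourier f l = (\<Sum>i<N. c i * cnj (fourier \<psi> (- (s i * l))))" for l
  proof -
    have ie: "integrable lborel (\<lambda>t. c i * (iexp (- (t * l)) * \<phi> i t))" if "i < N" for i
      using \<phi>i[OF that] by (intro integrable_mult_right Bochner_Integration.integrable_bound[OF \<phi>i[OF that]]) (auto simp: norm_mult)
    have "fourier f l = (LINT t|lborel. (\<Sum>i<N. c i * (iexp (- (t * l)) * \<phi> i t)))"
      unfolding fourier_def f_def by (simp add: sum_distrib_left ac_simps)
    also have "\<dots> = (\<Sum>i<N. LINT t|lborel. c i * (iexp (- (t * l)) * \<phi> i t))"
      by (intro Bochner_Integration.integral_sum ie) simp
    also have "\<dots> = (\<Sum>i<N. c i * fourier (\<phi> i) l)"
      by (simp add: fourier_def)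
    also have "\<dots> = (\<Sum>i<N. c i * cnj (fourier \<psi> (- (s i * l))))"
    proof (intro sum.cong refl)
      fix i assume "i \<in> {..<N}"
      then have "0 < s i" using s by simp
      then show "c i * fourier (\<phi> i) l = c i * cnj (fourier \<psi> (- (s i * l)))"
        unfolding \<phi>_def[abs_def] by (subst fourier_dilate[OF \<psi>]) simp_all
    qed
    finally show ?thesis .
  qed
  have one_sided: "fourier f l = 0" if "0 \<le> l" for l
    unfolding ff using s that by (intro sum.neutral ballI) (simp add: analytic less_imp_le)
  have "AE z in M. \<forall>i\<in>{..<N}. integrable lborel (\<lambda>t. \<phi> i t * of_real (\<Phi>' t z))"
    using AE_integrable_path[OF \<phi>i] by (intro AE_finite_allI) auto
  moreover have "AE z in M. \<forall>i\<in>{..<N}. W 0 (s i) z = wavelet_integral \<psi> (\<lambda>\<tau>. \<Phi>' \<tau> z) 0 (s i)"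
    using WI s by (intro AE_finite_allI) auto
  ultimately have ae: "AE z in M. (\<Sum>i<N. c i * W 0 (s i) z) = (LINT t|lborel. f t * of_real (\<Phi>' t z))"
  proof eventually_elim
    case (elim z)
    have "(LINT t|lborel. f t * of_real (\<Phi>' t z)) = (LINT t|lborel. (\<Sum>i<N. c i * (\<phi> i t * of_real (\<Phi>' t z))))"
      by (simp add: f_def sum_distrib_right mult.assoc)
    also have "\<dots> = (\<Sum>i<N. LINT t|lborel. c i * (\<phi> i t * of_real (\<Phi>' t z)))"
      using elim(1) by (intro Bochner_Integration.integral_sum integrable_mult_right) auto
    also have "\<dots> = (\<Sum>i<N. c i * W 0 (s i) z)"
      using elim(2) by (intro sum.cong refl) (simp add: wavelet_integral_def \<phi>_def ac_simps)
    finally show ?case by simp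
  qed
  have [measurable]: "(\<lambda>z. \<Sum>i<N. c i * W 0 (s i) z) \<in> borel_measurable M"
    using s by (intro borel_measurable_sum borel_measurable_times borel_measurable_const Wm) auto
  have [measurable]: "(\<lambda>z. LINT t|lborel. f t * of_real (\<Phi>' t z)) \<in> borel_measurable M"
    by (rule path_integral_measurable[OF f])
  have "(\<integral>z. iexp (Re (\<Sum>i<N. c i * W 0 (s i) z)) \<partial>M) = (\<integral>z. iexp (Re (LINT t|lborel. f t * of_real (\<Phi>' t z))) \<partial>M)"
  proof (rule integral_cong_AE)
    show "AE z in M. iexp (Re (\<Sum>i<N. c i * W 0 (s i) z)) = iexp (Re (LINT t|lborel. f t * of_real (\<Phi>' t z)))"
      using ae by eventually_elim simp
  qed measurable
  also have "\<dots> = complex_of_real (exp (- (LINT l:{0<..}|lborel. (cmod (fourier f (- l)))\<^sup>2 * p l) / 4))"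
    by (rule char_path_integral[OF f one_sided])
  finally show "(\<integral>z. iexp (Re (\<Sum>i<N. c i * W 0 (s i) z)) \<partial>M) =
      complex_of_real (exp (- (LINT l:{0<..}|lborel. (cmod (\<Sum>i<N. c i * cnj (fourier \<psi> (s i * l))))\<^sup>2 * p l) / 4))"
    by (simp add: ff)
qed

section \<open>Passage to the scale derivative\<close>

lemma spectral_gaussian_subset:
  "spectral_gaussian M p S V \<kappa> \<Longrightarrow> T \<subseteq> S \<Longrightarrow> spectral_gaussian M p T V \<kappa>"
  unfolding spectral_gaussian_def by blast

text \<open>Differentiability along a sequence, as measurability of limits and dominated convergence
  require; increments proportional to s keep all points positive when s is.\<close>

lemma LIMSEQ_difference_quotient:
  fixes f :: "real \<Rightarrow> complex"
  assumes "(f has_vector_derivative f') (at s)" and "s \<noteq> 0"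
  shows "(\<lambda>n. (f (s + s / real (Suc n)) - f s) / of_real (s / real (Suc n))) \<longlonglongrightarrow> f'"
proof -
  have "((\<lambda>h. (f (s + h) - f s) /\<^sub>R h) \<longlongrightarrow> f') (at 0)"
  proof (subst LIM_zero_iff[symmetric], rule tendsto_norm_zero_cancel)
    have "((\<lambda>h. norm (f (s + h) - f s - h *\<^sub>R f') / norm h) \<longlongrightarrow> 0) (at 0)"
      using assms(1) by (simp add: has_vector_derivative_def has_derivative_at)
    moreover have "\<forall>\<^sub>F h in at 0. norm (f (s + h) - f s - h *\<^sub>R f') / norm h = norm ((f (s + h) - f s) /\<^sub>R h - f')"
    proof (rule eventually_at_topological[THEN iffD2], intro exI[of _ UNIV] conjI ballI impI)
      fix h :: real assume "h \<noteq> 0"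
      then have "(f (s + h) - f s) /\<^sub>R h - f' = (f (s + h) - f s - h *\<^sub>R f') /\<^sub>R h"
        by (simp add: scaleR_diff_right)
      then show "norm (f (s + h) - f s - h *\<^sub>R f') / norm h = norm ((f (s + h) - f s) /\<^sub>R h - f')"
        by (simp add: divide_inverse mult.commute)
    qed auto
    ultimately show "((\<lambda>h. norm ((f (s + h) - f s) /\<^sub>R h - f')) \<longlongrightarrow> 0) (at 0)"
      by (rule Lim_transform_eventually)
  qed
  moreover have "filterlim (\<lambda>n. s / real (Suc n)) (at 0) sequentially"
  proof (rule filterlim_atI)
    show "(\<lambda>n. s / real (Suc n)) \<longlonglongrightarrow> 0" by real_asymp
    show "\<forall>\<^sub>F n in sequentially. s / real (Suc n) \<noteq> 0" using assms(2) by simp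
  qed
  ultimately have "(\<lambda>n. (f (s + s / real (Suc n)) - f s) /\<^sub>R (s / real (Suc n))) \<longlonglongrightarrow> f'"
    by (rule filterlim_compose)
  then show ?thesis by (simp add: scaleR_conv_of_real divide_inverse mult.commute)
qed

text \<open>Difference quotients are linear combinations of values of V, so their characteristic
  functions are known. As the increments shrink, the left-hand sides converge by dominated
  convergence along the paths, and the spectral integrals because \<open>B\<close> bounds the
  quotients of \<kappa> uniformly in the frequency while p is integrable.\<close>

lemma spectral_gaussian_derivative:
  assumes M: "prob_space M" and V: "spectral_gaussian M p {0<..} V \<kappa>"
    and p: "\<And>l. 0 \<le> p l" "integrable lborel p"
    and V': "\<And>z s. z \<in> space M \<Longrightarrow> 0 < s \<Longrightarrow> ((\<lambda>r. V r z) has_vector_derivative V' s z) (at s)"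
    and \<kappa>_meas: "\<And>s. 0 < s \<Longrightarrow> \<kappa> s \<in> borel_measurable borel"
    and \<kappa>': "\<And>l s. 0 < l \<Longrightarrow> 0 < s \<Longrightarrow> ((\<lambda>r. \<kappa> r l) has_vector_derivative \<kappa>' s l) (at s)"
    and B: "\<And>r s l. 0 < l \<Longrightarrow> 0 < s \<Longrightarrow> s \<le> r \<Longrightarrow> cmod (\<kappa> r l - \<kappa> s l) \<le> B / s * (r - s)"
  shows "spectral_gaussian M p {0<..} V' \<kappa>'"
  unfolding spectral_gaussian_def
proof (intro conjI ballI allI impI)
  interpret prob_space M by (rule M)
  have Vm: "V s \<in> borel_measurable M" if "0 < s" for s
    using V that by (simp add: spectral_gaussian_def)
  have [measurable]: "p \<in> borel_measurable borel" using p(2) by auto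
  show V'm: "V' s \<in> borel_measurable M" if "s \<in> {0<..}" for s
  proof (rule borel_measurable_LIMSEQ_metric)
    show "(\<lambda>z. (V (s + s / real (Suc n)) z - V s z) / of_real (s / real (Suc n))) \<in> borel_measurable M" for n
      using that by (intro borel_measurable_divide borel_measurable_diff borel_measurable_const Vm) (auto intro: add_pos_pos)
    show "(\<lambda>n. (V (s + s / real (Suc n)) z - V s z) / of_real (s / real (Suc n))) \<longlonglongrightarrow> V' s z" if "z \<in> space M" for z
      using \<open>s \<in> {0<..}\<close> by (intro LIMSEQ_difference_quotient V' that) auto
  qed
  fix N :: nat and c :: "nat \<Rightarrow> complex" and s :: "nat \<Rightarrow> real" assume "\<forall>i<N. s i \<in> {0<..}"
  then have s: "0 < s i" if "i < N" for i using that by simp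
  define h where "h n i = s i / real (Suc n)" for n i
  have h: "0 < h n i" if "i < N" for n i using s[OF that] by (simp add: h_def)
  \<comment> \<open>N difference quotients form one combination of 2 N values: indices below N
    belong to the shifted scales, index i >= N to the scale s (i - N).\<close>
  define c2 where "c2 n i = (if i < N then c i / of_real (h n i) else - c (i - N) / of_real (h n (i - N)))" for n i
  define s2 where "s2 n i = (if i < N then s i + h n i else s (i - N))" for n i
  have quot: "(\<Sum>i<N + N. c2 n i * f (s2 n i)) = (\<Sum>i<N. c i * ((f (s i + h n i) - f (s i)) / of_real (h n i)))"
    for f :: "real \<Rightarrow> complex" and n
    unfolding sum_lessThan_concat sum.distrib[symmetric]
    by (intro sum.cong refl) (simp add: c2_def s2_def diff_divide_distrib right_diff_distrib)
  have s2: "\<forall>i<N + N. s2 n i \<in> {0<..}" for n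
  proof (intro allI impI)
    fix i assume "i < N + N"
    then show "s2 n i \<in> {0<..}" using s[of i] s[of "i - N"] h[of i n] by (auto simp: s2_def)
  qed
  define A where "A n l = (\<Sum>i<N. c i * ((\<kappa> (s i + h n i) l - \<kappa> (s i) l) / of_real (h n i)))" for n l
  define A0 where "A0 l = (\<Sum>i<N. c i * \<kappa>' (s i) l)" for l
  have A_lim: "(\<lambda>n. A n l) \<longlonglongrightarrow> A0 l" if "0 < l" for l
    unfolding A_def A0_def h_def
    by (intro tendsto_sum tendsto_mult tendsto_const LIMSEQ_difference_quotient \<kappa>' that) (use s in force)+
  have Am[measurable]: "A n \<in> borel_measurable borel" for n
    unfolding A_def using s h
    by (intro borel_measurable_sum borel_measurable_times borel_measurable_divide borel_measurable_diff
        borel_measurable_const \<kappa>_meas) (auto intro: add_pos_pos)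
  \<comment> \<open>The Lipschitz bound divided by the increment: a majorant of |A n l| that depends
    on neither n nor l.\<close>
  define b where "b = (\<Sum>i<N. cmod (c i) * (B / s i))"
  have A_bound: "cmod (A n l) \<le> b" if l: "0 < l" for n l
    unfolding A_def b_def
  proof (rule sum_norm_le)
    fix i assume "i \<in> {..<N}"
    then have i: "i < N" by simp
    have "cmod (\<kappa> (s i + h n i) l - \<kappa> (s i) l) \<le> B / s i * h n i"
      using B[OF l s[OF i], of "s i + h n i"] h[OF i, of n] by simp
    then have "cmod ((\<kappa> (s i + h n i) l - \<kappa> (s i) l) / of_real (h n i)) \<le> B / s i"
      using h[OF i, of n] by (simp add: norm_divide pos_divide_le_eq)
    then show "cmod (c i * ((\<kappa> (s i + h n i) l - \<kappa> (s i) l) / of_real (h n i))) \<le> cmod (c i) * (B / s i)"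
      unfolding norm_mult by (rule mult_left_mono) simp
  qed
  have q_lim: "(\<lambda>n. LINT l:{0<..}|lborel. (cmod (A n l))\<^sup>2 * p l) \<longlonglongrightarrow> (LINT l:{0<..}|lborel. (cmod (A0 l))\<^sup>2 * p l)"
    unfolding set_lebesgue_integral_def
  proof (rule integral_dominated_convergence[where w = "\<lambda>l. b\<^sup>2 * p l"])
    have lim: "(\<lambda>n. indicator {0<..} l *\<^sub>R ((cmod (A n l))\<^sup>2 * p l)) \<longlonglongrightarrow> indicator {0<..} l *\<^sub>R ((cmod (A0 l))\<^sup>2 * p l)" for l
      by (cases "0 < l") (auto intro!: tendsto_intros A_lim)
    show "AE l in lborel. (\<lambda>n. indicator {0<..} l *\<^sub>R ((cmod (A n l))\<^sup>2 * p l)) \<longlonglongrightarrow> indicator {0<..} l *\<^sub>R ((cmod (A0 l))\<^sup>2 * p l)"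
      using lim by simp
    have m: "(\<lambda>l. indicator {0<..} l *\<^sub>R ((cmod (A n l))\<^sup>2 * p l)) \<in> borel_measurable lborel" for n
      by measurable
    show "(\<lambda>l. indicator {0<..} l *\<^sub>R ((cmod (A n l))\<^sup>2 * p l)) \<in> borel_measurable lborel" for n by (rule m)
    show "(\<lambda>l. indicator {0<..} l *\<^sub>R ((cmod (A0 l))\<^sup>2 * p l)) \<in> borel_measurable lborel"
      by (rule borel_measurable_LIMSEQ_real[OF lim m])
    show "integrable lborel (\<lambda>l. b\<^sup>2 * p l)" using p(2) by simp
    show "AE l in lborel. norm (indicator {0<..} l *\<^sub>R ((cmod (A n l))\<^sup>2 * p l)) \<le> b\<^sup>2 * p l" for n
    proof (rule AE_I2)
      fix l
      show "norm (indicator {0<..} l *\<^sub>R ((cmod (A n l))\<^sup>2 * p l)) \<le> b\<^sup>2 * p l"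
      proof (cases "0 < l")
        case True
        have "(cmod (A n l))\<^sup>2 * p l \<le> b\<^sup>2 * p l"
          by (intro mult_right_mono power_mono A_bound True p) simp
        then show ?thesis using True p(1)[of l] by (simp add: abs_mult)
      qed (use p(1)[of l] in simp)
    qed
  qed
  define Y where "Y n z = (\<Sum>i<N. c i * ((V (s i + h n i) z - V (s i) z) / of_real (h n i)))" for n z
  have char: "(\<integral>z. iexp (Re (Y n z)) \<partial>M) = complex_of_real (exp (- (LINT l:{0<..}|lborel. (cmod (A n l))\<^sup>2 * p l) / 4))" for n
    using spectral_gaussian_char[OF V s2[of n], of "c2 n"]
    unfolding quot[of n "\<lambda>r. V r _"] quot[of n "\<lambda>r. \<kappa> r _"] Y_def A_def .
  have rhs: "(\<lambda>n. \<integral>z. iexp (Re (Y n z)) \<partial>M) \<longlonglongrightarrow> complex_of_real (exp (- (LINT l:{0<..}|lborel. (cmod (A0 l))\<^sup>2 * p l) / 4))"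
    unfolding char by (intro tendsto_intros q_lim) auto
  have Y_lim: "(\<lambda>n. Y n z) \<longlonglongrightarrow> (\<Sum>i<N. c i * V' (s i) z)" if "z \<in> space M" for z
    unfolding Y_def h_def
    by (intro tendsto_sum tendsto_mult tendsto_const LIMSEQ_difference_quotient V' that) (use s in force)+
  have Ym[measurable]: "Y n \<in> borel_measurable M" for n
    unfolding Y_def using s h
    by (intro borel_measurable_sum borel_measurable_times borel_measurable_divide borel_measurable_diff
        borel_measurable_const Vm) (auto intro: add_pos_pos)
  have [measurable]: "V' (s i) \<in> borel_measurable M" if "i < N" for i using V'm s that by simp
  have lhs: "(\<lambda>n. \<integral>z. iexp (Re (Y n z)) \<partial>M) \<longlonglongrightarrow> (\<integral>z. iexp (Re (\<Sum>i<N. c i * V' (s i) z)) \<partial>M)"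
  proof (rule integral_dominated_convergence[where w = "\<lambda>_. 1"])
    show "AE z in M. (\<lambda>n. iexp (Re (Y n z))) \<longlonglongrightarrow> iexp (Re (\<Sum>i<N. c i * V' (s i) z))"
      by (intro AE_I2 tendsto_intros Y_lim)
    show "(\<lambda>z. iexp (Re (\<Sum>i<N. c i * V' (s i) z))) \<in> borel_measurable M" by measurable
    show "(\<lambda>z. iexp (Re (Y n z))) \<in> borel_measurable M" for n by measurable
  qed simp_all
  show "(\<integral>z. iexp (Re (\<Sum>i<N. c i * V' (s i) z)) \<partial>M) =
      complex_of_real (exp (- (LINT l:{0<..}|lborel. (cmod (\<Sum>i<N. c i * \<kappa>' (s i) l))\<^sup>2 * p l) / 4))"
    using LIMSEQ_unique[OF lhs rhs] by (simp only: A0_def)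
qed

text \<open>This makes the supremum that defines the standard deviation one over a set bounded
  above.\<close>

lemma bdd_above_spectral_variance:
  assumes p: "\<And>l. 0 \<le> p l" "integrable lborel p" and k: "\<And>s l. s \<in> {a..b} \<Longrightarrow> 0 < l \<Longrightarrow> cmod (\<kappa> s l) \<le> K"
  shows "bdd_above ((\<lambda>s. LINT l:{0<..}|lborel. (cmod (\<kappa> s l))\<^sup>2 * p l) ` {a..b})"
proof (rule bdd_aboveI2)
  fix s assume s: "s \<in> {a..b}"
  show "(LINT l:{0<..}|lborel. (cmod (\<kappa> s l))\<^sup>2 * p l) \<le> (LINT l|lborel. K\<^sup>2 * p l)"
    unfolding set_lebesgue_integral_def
  proof (rule integral_mono')
    show "integrable lborel (\<lambda>l. K\<^sup>2 * p l)" using p(2) by simp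
    show "0 \<le> K\<^sup>2 * p l" for l using p(1) by simp
    show "indicator {0<..} l *\<^sub>R ((cmod (\<kappa> s l))\<^sup>2 * p l) \<le> K\<^sup>2 * p l" for l
    proof (cases "0 < l")
      case True
      have "(cmod (\<kappa> s l))\<^sup>2 * p l \<le> K\<^sup>2 * p l"
        by (intro mult_right_mono power_mono k s True p) simp
      then show ?thesis using True by simp
    qed (use p(1)[of l] in simp)
  qed
qed

text \<open>The chain rule along the line of fixed t identifies the scale derivative with the
  partial derivative in the second variable; that one is differentiable on the half-plane and hence
  continuous.\<close>

lemma C2_paths_scale:
  assumes "C2_paths M W" and z: "z \<in> space M" and s: "0 < s"
  shows "((\<lambda>r. W t r z) has_vector_derivative deriv_scale W t s z) (at s)"
    and "continuous_on {0<..} (\<lambda>s. deriv_scale W t s z)"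
proof -
  let ?U = "UNIV \<times> {0<..} :: (real \<times> real) set"
  have "Ck_on (Suc (Suc 0)) ?U (\<lambda>(t, s). W t s z)"
    using assms by (simp add: C2_paths_def numeral_2_eq_2)
  then obtain f1 f2 where f: "\<And>x. x \<in> ?U \<Longrightarrow> ((\<lambda>(t, s). W t s z) has_derivative (\<lambda>h. fst h *\<^sub>R f1 x + snd h *\<^sub>R f2 x)) (at x)"
    and f2: "Ck_on (Suc 0) ?U f2"
    unfolding Ck_on.simps(2)[of "Suc 0"] by blast
  from f2 obtain g1 g2 where g: "\<And>x. x \<in> ?U \<Longrightarrow> (f2 has_derivative (\<lambda>h. fst h *\<^sub>R g1 x + snd h *\<^sub>R g2 x)) (at x)"
    unfolding Ck_on.simps(2)[of 0] by blast
  have der: "((\<lambda>r. W t r z) has_vector_derivative f2 (t, s)) (at s)" if "0 < s" for s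
  proof -
    have 1: "(Pair t has_derivative (\<lambda>h. (0, h))) (at s)" by (auto intro!: derivative_eq_intros)
    have 2: "((\<lambda>(t, s). W t s z) has_derivative (\<lambda>h. fst h *\<^sub>R f1 (t, s) + snd h *\<^sub>R f2 (t, s))) (at (t, s))"
      using f that by auto
    show ?thesis
      using has_derivative_compose[OF 1 2] by (simp add: has_vector_derivative_def)
  qed
  have ds: "deriv_scale W t s z = f2 (t, s)" if "0 < s" for s
    unfolding deriv_scale_def using der[OF that] by (rule vector_derivative_at)
  show "((\<lambda>r. W t r z) has_vector_derivative deriv_scale W t s z) (at s)"
    using der[OF s] ds[OF s] by simp
  have "continuous_on ?U f2"
    using g by (meson has_derivative_continuous continuous_at_imp_continuous_on)
  then have "continuous_on {0<..} (\<lambda>s. f2 (t, s))"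
    by (rule continuous_on_compose2) (auto intro!: continuous_intros)
  then show "continuous_on {0<..} (\<lambda>s. deriv_scale W t s z)"
    by (rule continuous_on_eq) (simp add: ds)
qed

theorem lemma4:
  fixes M :: "'a measure"
    and \<Phi> :: "real \<Rightarrow> 'a \<Rightarrow> real"
    and p :: "real \<Rightarrow> real"
    and \<psi> :: "real \<Rightarrow> complex"
    and W :: "real \<Rightarrow> real \<Rightarrow> 'a \<Rightarrow> complex"
    and w :: "real \<Rightarrow> real"
    and a b :: real
  assumes "prob_space M"
    and "stationary_gaussian_noise M \<Phi> p"
    and "spectral_decay p"
    and "long_range_dependent p \<or> short_range_dependent p"
    and "regular_analytic_wavelet \<psi>"
    and "wavelet_transform_version M \<psi> \<Phi> W"
    and "C2_paths M W"
    and "0 < a" and "a < b"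
    and "continuous_on {a..b} w" and "bounded (w ` {a..b})" and "\<forall>s\<in>{a..b}. 0 \<le> w s"
  shows
    "(let X = max_modulus w a b W; \<sigma> = max_sd w a b \<psi> p; m = integral\<^sup>L M X in
        integrable M X \<and>
        (\<forall>u\<ge>m. measure M {\<omega> \<in> space M. X \<omega> \<ge> u} \<le> exp (- ((u - m)\<^sup>2 / \<sigma>\<^sup>2)))) \<and>
     (let X = max_modulus w a b (deriv_scale W); \<sigma> = max_sd_deriv w a b \<psi> p; m = integral\<^sup>L M X in
        integrable M X \<and>
        (\<forall>u\<ge>m. measure M {\<omega> \<in> space M. X \<omega> \<ge> u} \<le> exp (- ((u - m)\<^sup>2 / \<sigma>\<^sup>2))))"
proof -
  note M = assms(1) and C2 = assms(7) and ab = \<open>0 < a\<close> \<open>a < b\<close>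
  have p: "\<And>l. 0 \<le> p l" "integrable lborel p"
    using assms(2) by (auto simp: stationary_gaussian_noise_def has_spectral_density_def less_imp_le)
  have \<psi>: "integrable lborel \<psi>" and analytic: "\<And>l. l \<le> 0 \<Longrightarrow> fourier \<psi> l = 0"
    and diff: "\<And>l. 0 < l \<Longrightarrow> D 0 (fourier \<psi>) differentiable (at l)"
    and bw: "bounded_weighted 1 (D 1 (fourier \<psi>))"
    using assms(5) by (auto simp: regular_analytic_wavelet_def)
  have [measurable]: "fourier \<psi> \<in> borel_measurable borel"
    using \<psi> by (intro fourier_measurable) auto
  define \<psi>' where "\<psi>' = D 1 (fourier \<psi>)"
  have der: "(fourier \<psi> has_vector_derivative \<psi>' l) (at l)" if "0 < l" for l
    using diff[OF that] by (simp add: \<psi>'_def D_def vector_derivative_works)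
  \<comment> \<open>The bound on the derivative with weight q = 1 controls l * \<psi>' (s * l), the
    scale derivative of \<kappa> up to conjugation, by B / s uniformly in l.\<close>
  obtain B where B: "\<And>l. 0 < l \<Longrightarrow> l * cmod (\<psi>' l) \<le> B"
    using bw unfolding bounded_weighted_def bdd_above_def \<psi>'_def[symmetric] by (auto simp: norm_mult)
  define \<kappa> where "\<kappa> s l = cnj (fourier \<psi> (s * l))" for s l
  define \<kappa>' where "\<kappa>' s l = cnj (of_real l * \<psi>' (s * l))" for s l
  have W0: "spectral_gaussian M p {0<..} (W 0) \<kappa>"
    unfolding \<kappa>_def[abs_def]
    by (rule wavelet_transform_spectral_gaussian[OF M assms(2) \<psi> analytic assms(6)])
  have W1: "spectral_gaussian M p {0<..} (deriv_scale W 0) \<kappa>'"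
  proof (rule spectral_gaussian_derivative[OF M W0 p])
    show "((\<lambda>r. W 0 r \<omega>) has_vector_derivative deriv_scale W 0 s \<omega>) (at s)" if "\<omega> \<in> space M" "0 < s" for \<omega> s
      by (rule C2_paths_scale(1)[OF C2 that])
    show "\<kappa> s \<in> borel_measurable borel" for s
    proof -
      have "(\<lambda>l. fourier \<psi> (s * l)) \<in> borel_measurable borel" by measurable
      then show ?thesis unfolding \<kappa>_def by (rule measurable_compose) (intro borel_measurable_continuous_onI continuous_intros)
    qed
    fix l s :: real assume l: "0 < l" and s: "0 < s"
    have d: "((\<lambda>r. fourier \<psi> (r * l)) has_vector_derivative l *\<^sub>R \<psi>' (s * l)) (at s)" if "0 < s" for s
    proof -
      have "((\<lambda>r. r * l) has_vector_derivative l) (at s)" by (auto intro!: derivative_eq_intros)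
      from vector_diff_chain_at[OF this der[of "s * l"]] show ?thesis using l that by (simp add: o_def)
    qed
    show "((\<lambda>r. \<kappa> r l) has_vector_derivative \<kappa>' s l) (at s)"
      using has_vector_derivative_cnj[OF d[OF s]] by (simp add: \<kappa>_def \<kappa>'_def scaleR_conv_of_real)
    \<comment> \<open>Mean value inequality on [s, r]: at the intermediate point x the derivative is
      at most B / x <= B / s.\<close>
    show "cmod (\<kappa> r l - \<kappa> s l) \<le> B / s * (r - s)" if "s \<le> r" for r
    proof (cases "s = r")
      case False
      then have sr: "s < r" using that by simp
      have "\<exists>x\<in>{s<..<r}. cmod (fourier \<psi> (r * l) - fourier \<psi> (s * l)) \<le> cmod ((r - s) *\<^sub>R (l *\<^sub>R \<psi>' (x * l)))"
      proof (rule mvt_general[OF sr])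
        show "continuous_on {s..r} (\<lambda>r. fourier \<psi> (r * l))"
        proof (intro continuous_at_imp_continuous_on ballI)
          fix x assume "x \<in> {s..r}"
          then show "isCont (\<lambda>r. fourier \<psi> (r * l)) x"
            using has_vector_derivative_continuous[OF d[of x]] s by simp
        qed
        show "((\<lambda>r. fourier \<psi> (r * l)) has_derivative (\<lambda>h. h *\<^sub>R (l *\<^sub>R \<psi>' (x * l)))) (at x)" if "s < x" for x
          using d[of x] that s by (simp add: has_vector_derivative_def)
      qed
      then obtain x where x: "s < x" "cmod (fourier \<psi> (r * l) - fourier \<psi> (s * l)) \<le> (r - s) * (l * cmod (\<psi>' (x * l)))"
        using sr l by (auto simp: abs_mult)
      have "x * (l * cmod (\<psi>' (x * l))) \<le> B" using B[of "x * l"] x s l by (simp add: mult.assoc)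
      moreover have "s * (l * cmod (\<psi>' (x * l))) \<le> x * (l * cmod (\<psi>' (x * l)))"
        using x l by (intro mult_right_mono) auto
      ultimately have "l * cmod (\<psi>' (x * l)) \<le> B / s" using s by (simp add: pos_le_divide_eq mult.commute)
      then have "(r - s) * (l * cmod (\<psi>' (x * l))) \<le> (r - s) * (B / s)" using sr by (intro mult_left_mono) auto
      with x have "cmod (fourier \<psi> (r * l) - fourier \<psi> (s * l)) \<le> B / s * (r - s)" by (simp add: mult.commute)
      then show ?thesis by (simp add: \<kappa>_def flip: complex_cnj_diff)
    qed simp
  qed
  have sub: "{a..b} \<subseteq> {0<..}" using ab by auto
  have w0: "\<And>s. s \<in> {a..b} \<Longrightarrow> 0 \<le> w s" using assms(12) by blast
  have ab': "a \<le> b" using ab by simp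
  \<comment> \<open>The L1 norm of \<psi> bounds its transform at every frequency.\<close>
  have b0: "bdd_above ((\<lambda>s. LINT l:{0<..}|lborel. (cmod (\<kappa> s l))\<^sup>2 * p l) ` {a..b})"
    by (rule bdd_above_spectral_variance[OF p, where K = "LINT t|lborel. cmod (\<psi> t)"]) (simp add: \<kappa>_def norm_fourier_le)
  have b1: "bdd_above ((\<lambda>s. LINT l:{0<..}|lborel. (cmod (\<kappa>' s l))\<^sup>2 * p l) ` {a..b})"
  proof (rule bdd_above_spectral_variance[OF p, where K = "B / a"])
    fix s l :: real assume s: "s \<in> {a..b}" and l: "0 < l"
    have s0: "0 < s" using s ab by auto
    have "s * (l * cmod (\<psi>' (s * l))) \<le> B" using B[of "s * l"] s0 l by (simp add: mult.assoc)
    moreover have "a * (l * cmod (\<psi>' (s * l))) \<le> s * (l * cmod (\<psi>' (s * l)))"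
      using s l by (intro mult_right_mono) auto
    ultimately have "a * (l * cmod (\<psi>' (s * l))) \<le> B" by linarith
    then have "l * cmod (\<psi>' (s * l)) \<le> B / a" using ab by (simp add: pos_le_divide_eq mult.commute)
    then show "cmod (\<kappa>' s l) \<le> B / a" using l by (simp add: \<kappa>'_def norm_mult)
  qed
  have c0: "continuous_on {a..b} (\<lambda>s. W 0 s \<omega>)" if "\<omega> \<in> space M" for \<omega>
  proof (intro continuous_at_imp_continuous_on ballI)
    fix s assume "s \<in> {a..b}"
    then have "0 < s" using ab by simp
    from has_vector_derivative_continuous[OF C2_paths_scale(1)[OF C2 that this]]
    show "isCont (\<lambda>s. W 0 s \<omega>) s" .
  qed
  \<comment> \<open>The continuity part of \<open>C2_paths_scale\<close> does not mention the scale
    s, so its positivity premise is discharged with the arbitrary choice s = 1.\<close>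
  have c1: "continuous_on {a..b} (\<lambda>s. deriv_scale W 0 s \<omega>)" if "\<omega> \<in> space M" for \<omega>
    using continuous_on_subset[OF C2_paths_scale(2)[OF C2 that zero_less_one] sub] .
  note sup0 = spectral_gaussian_sup[OF M spectral_gaussian_subset[OF W0 sub] p(1) ab' c0 assms(10) w0 b0]
  note sup1 = spectral_gaussian_sup[OF M spectral_gaussian_subset[OF W1 sub] p(1) ab' c1 assms(10) w0 b1]
  \<comment> \<open>The kernels \<kappa> and \<kappa>' are conjugates of the expressions in the
    definitions; the modulus does not see the conjugation.\<close>
  have e: "max_modulus w a b W = (\<lambda>\<omega>. SUP s\<in>{a..b}. w s * cmod (W 0 s \<omega>))"
    "max_modulus w a b (deriv_scale W) = (\<lambda>\<omega>. SUP s\<in>{a..b}. w s * cmod (deriv_scale W 0 s \<omega>))"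
    "max_sd w a b \<psi> p = (SUP s\<in>{a..b}. w s * sqrt (LINT l:{0<..}|lborel. (cmod (\<kappa> s l))\<^sup>2 * p l))"
    "max_sd_deriv w a b \<psi> p = (SUP s\<in>{a..b}. w s * sqrt (LINT l:{0<..}|lborel. (cmod (\<kappa>' s l))\<^sup>2 * p l))"
    by (auto simp: max_modulus_def max_sd_def max_sd_deriv_def \<kappa>_def \<kappa>'_def \<psi>'_def norm_mult)
  show ?thesis
    unfolding Let_def e by (intro conjI allI impI sup0 sup1)
qed

end
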